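(* Let $T>0$, let $u_0\in \mathrm{Lip}(\mathbb{R}^N)$, and let $H:\mathbb{R}^N\times\mathbb{R}^N\to\mathbb{R}$ satisfy (H1), (H2), (H3) and (H4) (listed in the context). For $t\in(0,T]$ let $S_t^+$ be the forward viscosity operator associated with $H$. Then, for any $w\in \mathrm{Lip}(\mathbb{R}^N)$ and any $t\in(0,T]$, $$\frac{S_t^+(u_0+\delta w)(\cdot)-S_t^+u_0(\cdot)}{\delta}\longrightarrow \partial_w S_t^+u_0(\cdot)\quad\text{as }\delta\to0^+,\quad\text{in } L^1_{loc}(\mathbb{R}^N),$$ where $\partial_wS_t^+u_0\in L^\infty_{loc}(\mathbb{R}^N)$ is defined almost everywhere in the following way: at any point $x\in\mathbb{R}^N$ where $S_t^+u_0(\cdot)$ is differentiable, $$\partial_wS_t^+u_0(x)=w(\xi_{t,x}(0)),$$ with $(\xi_{t,x},p_{t,x})$, $\xi_{t,x},p_{t,x}\in C^1([0,t];\mathbb{R}^N)$, being the unique solution of the backward system of ODEs $$\dot\xi_{t,x}(s)=H_p(\xi_{t,x}(s),p_{t,x}(s)),\qquad \dot p_{t,x}(s)=-H_x(\xi_{t,x}(s),p_{t,x}(s)),\qquad s\in(0,t),$$ $$\xi_{t,x}(t)=x,\qquad p_{t,x}(t)=\nabla S_t^+u_0(x).$$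
   Context: $\mathrm{Lip}(\mathbb{R}^N)$ is the space of (globally) Lipschitz functions $\mathbb{R}^N\to\mathbb{R}$. Hypotheses on $H=H(x,p)$: (H1) $H\in C^2(\mathbb{R}^{2N})$ and there is $c_0>0$ with $c_0I_N\le H_{pp}(x,p)$ (order of symmetric matrices) for all $x,p$; (H2) there is $C_0\ge0$ with $H(x,p)\ge -C_0$ for all $x,p$ and $H(x,0)\le C_0$ for all $x$; (H3) there is $C_{\mathrm{Lip}}>0$ with $|H_x(x,p)|\le C_{\mathrm{Lip}}$ for all $x,p$; (H4) for every $R>0$ there is $C_R>0$ with $|H_p(x,p)|\le C_R$ for all $x$ and all $|p|\le R$. Let $H^*(x,q)=\max_{p\in\mathbb{R}^N}\{p\cdot q-H(x,p)\}$. The forward viscosity operator $S_t^+:\mathrm{Lip}(\mathbb{R}^N)\to\mathrm{Lip}(\mathbb{R}^N)$ is $$S_t^+u_0(x)=\inf_{\xi\in W^{1,1}((0,t);\mathbb{R}^N),\ \xi(t)=x}\Big\{\int_0^tH^*(\xi(s),\dot\xi(s))\,ds+u_0(\xi(0))\Big\};$$ equivalently, $S_t^+u_0=u(t,\cdot)$ where $u$ is the unique viscosity solution of $\partial_tu+H(x,\nabla_xu)=0$ in $(0,T)\times\mathbb{R}^N$, $u(0,\cdot)=u_0$. Since $S_t^+u_0$ is Lipschitz, it is differentiable a.e. by Rademacher's theorem. *)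

theory Defs
  imports "HOL-Analysis.Analysis"
begin

section \<open>Function spaces and differential notation\<close>

definition Lip :: "('a::metric_space \<Rightarrow> 'b::metric_space) set" where
  "Lip = {f. \<exists>L. L-lipschitz_on UNIV f}"

definition C2 :: "('a::real_normed_vector \<Rightarrow> 'b::real_normed_vector) \<Rightarrow> bool" where
  "C2 f \<longleftrightarrow> (\<exists>(f' :: 'a \<Rightarrow> 'a \<Rightarrow>\<^sub>L 'b) (f'' :: 'a \<Rightarrow> 'a \<Rightarrow>\<^sub>L ('a \<Rightarrow>\<^sub>L 'b)).
     (\<forall>z. (f has_derivative blinfun_apply (f' z)) (at z)) \<and>
     (\<forall>z. (f' has_derivative blinfun_apply (f'' z)) (at z)) \<and>
     continuous_on UNIV f'')"

(* One-sided derivatives at the endpoints. *)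
definition C1_interval :: "real \<Rightarrow> real \<Rightarrow> (real \<Rightarrow> 'a::real_normed_vector) \<Rightarrow> bool" where
  "C1_interval a b \<gamma> \<longleftrightarrow> (\<exists>\<gamma>'. continuous_on {a..b} \<gamma>' \<and>
     (\<forall>s\<in>{a..b}. (\<gamma> has_vector_derivative \<gamma>' s) (at s within {a..b})))"

(* Meaningful only where f is differentiable; there GDERIV determines D uniquely. *)
definition grad :: "('a::real_inner \<Rightarrow> real) \<Rightarrow> 'a \<Rightarrow> 'a" where
  "grad f x = (THE D. GDERIV f x :> D)"

definition L1_loc :: "('a::euclidean_space \<Rightarrow> real) \<Rightarrow> bool" where
  "L1_loc f \<longleftrightarrow> (\<forall>K. compact K \<longrightarrow> set_integrable lebesgue K f)"

definition Linf_loc :: "('a::euclidean_space \<Rightarrow> real) \<Rightarrow> bool" where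
  "Linf_loc f \<longleftrightarrow> f \<in> borel_measurable lebesgue \<and>
     (\<forall>K. compact K \<longrightarrow> (\<exists>M. AE x in lebesgue. x \<in> K \<longrightarrow> \<bar>f x\<bar> \<le> M))"

definition tendsto_L1_loc ::
  "('i \<Rightarrow> 'a::euclidean_space \<Rightarrow> real) \<Rightarrow> ('a \<Rightarrow> real) \<Rightarrow> 'i filter \<Rightarrow> bool" where
  "tendsto_L1_loc f g F \<longleftrightarrow>
     (\<forall>\<^sub>F i in F. L1_loc (f i)) \<and> L1_loc g \<and>
     (\<forall>K. compact K \<longrightarrow> ((\<lambda>i. LINT x:K|lebesgue. \<bar>f i x - g x\<bar>) \<longlongrightarrow> 0) F)"

(* C^1 functions on the line with compact support in (0,t), paired with their derivative. *)
definition test_function :: "real \<Rightarrow> (real \<Rightarrow> real) \<Rightarrow> (real \<Rightarrow> real) \<Rightarrow> bool" where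
  "test_function t \<phi> \<phi>' \<longleftrightarrow>
     (\<forall>s. (\<phi> has_real_derivative \<phi>' s) (at s)) \<and> continuous_on UNIV \<phi>' \<and>
     (\<exists>K. compact K \<and> K \<subseteq> {0<..<t} \<and> (\<forall>s. s \<notin> K \<longrightarrow> \<phi> s = 0))"

(* W^{1,1}((0,t)): xi is the continuous representative on [0,t], so that its endpoint values
   make sense, and v is its weak derivative, which is unique up to a null set. *)
definition W11 :: "real \<Rightarrow> (real \<Rightarrow> 'a::euclidean_space) \<Rightarrow> (real \<Rightarrow> 'a) \<Rightarrow> bool" where
  "W11 t \<xi> v \<longleftrightarrow> continuous_on {0..t} \<xi> \<and> set_integrable lebesgue {0<..<t} v \<and>
     (\<forall>\<phi> \<phi>'. test_function t \<phi> \<phi>' \<longrightarrow>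
       (LINT s:{0<..<t}|lebesgue. \<phi>' s *\<^sub>R \<xi> s) = - (LINT s:{0<..<t}|lebesgue. \<phi> s *\<^sub>R v s))"

section \<open>Hamiltonians\<close>

abbreviation H_x :: "(real^'n \<Rightarrow> real^'n \<Rightarrow> real) \<Rightarrow> real^'n \<Rightarrow> real^'n \<Rightarrow> real^'n" where
  "H_x H x p \<equiv> grad (\<lambda>y. H y p) x"

abbreviation H_p :: "(real^'n \<Rightarrow> real^'n \<Rightarrow> real) \<Rightarrow> real^'n \<Rightarrow> real^'n \<Rightarrow> real^'n" where
  "H_p H x p \<equiv> grad (H x) p"

abbreviation H_pp :: "(real^'n \<Rightarrow> real^'n \<Rightarrow> real) \<Rightarrow> real^'n \<Rightarrow> real^'n \<Rightarrow> real^'n^'n" where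
  "H_pp H x p \<equiv> jacobian (H_p H x) (at p)"

(* The order of symmetric matrices. *)
definition loewner_le :: "real^'n^'n \<Rightarrow> real^'n^'n \<Rightarrow> bool" where
  "loewner_le A B \<longleftrightarrow> (\<forall>v. v \<bullet> (A *v v) \<le> v \<bullet> (B *v v))"

definition H1 :: "(real^'n \<Rightarrow> real^'n \<Rightarrow> real) \<Rightarrow> bool" where
  "H1 H \<longleftrightarrow> C2 (\<lambda>(x, p). H x p) \<and> (\<exists>c\<^sub>0>0. \<forall>x p. loewner_le (mat c\<^sub>0) (H_pp H x p))"

definition H2 :: "(real^'n \<Rightarrow> real^'n \<Rightarrow> real) \<Rightarrow> bool" where
  "H2 H \<longleftrightarrow> (\<exists>C\<^sub>0\<ge>0. (\<forall>x p. H x p \<ge> - C\<^sub>0) \<and> (\<forall>x. H x 0 \<le> C\<^sub>0))"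

definition H3 :: "(real^'n \<Rightarrow> real^'n \<Rightarrow> real) \<Rightarrow> bool" where
  "H3 H \<longleftrightarrow> (\<exists>C>0. \<forall>x p. norm (H_x H x p) \<le> C)"

definition H4 :: "(real^'n \<Rightarrow> real^'n \<Rightarrow> real) \<Rightarrow> bool" where
  "H4 H \<longleftrightarrow> (\<forall>R>0. \<exists>C>0. \<forall>x p. norm p \<le> R \<longrightarrow> norm (H_p H x p) \<le> C)"

(* Under H1 the supremum is finite and attained, i.e. a maximum. *)
definition conj_H :: "(real^'n \<Rightarrow> real^'n \<Rightarrow> real) \<Rightarrow> real^'n \<Rightarrow> real^'n \<Rightarrow> real" where
  "conj_H H x q = (SUP p. p \<bullet> q - H x p)"

section \<open>The forward viscosity operator\<close>

(* Extended-real valued: for a W^{1,1} curve the action may be infinite, where the Bochner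
   integral would return 0. The negative part is at most C_0 t under H2. *)
definition action ::
  "(real^'n \<Rightarrow> real^'n \<Rightarrow> real) \<Rightarrow> real \<Rightarrow> (real \<Rightarrow> real^'n) \<Rightarrow> (real \<Rightarrow> real^'n) \<Rightarrow> ereal" where
  "action H t \<xi> v =
     enn2ereal (\<integral>\<^sup>+s\<in>{0<..<t}. ennreal (conj_H H (\<xi> s) (v s)) \<partial>lebesgue) -
     enn2ereal (\<integral>\<^sup>+s\<in>{0<..<t}. ennreal (- conj_H H (\<xi> s) (v s)) \<partial>lebesgue)"

definition S_plus ::
  "(real^'n \<Rightarrow> real^'n \<Rightarrow> real) \<Rightarrow> real \<Rightarrow> (real^'n \<Rightarrow> real) \<Rightarrow> real^'n \<Rightarrow> real" where
  "S_plus H t u\<^sub>0 x = real_of_ereal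
     (INF (\<xi>, v)\<in>{(\<xi>, v). W11 t \<xi> v \<and> \<xi> t = x}. action H t \<xi> v + ereal (u\<^sub>0 (\<xi> 0)))"

section \<open>Backward characteristics and the directional derivative\<close>

(* Functions on [0,t] are represented by functions undefined outside {0..t}, so that
   uniqueness on [0,t] is plain uniqueness. *)
definition backward_characteristic ::
  "(real^'n \<Rightarrow> real^'n \<Rightarrow> real) \<Rightarrow> real \<Rightarrow> real^'n \<Rightarrow> real^'n \<Rightarrow>
     (real \<Rightarrow> real^'n) \<times> (real \<Rightarrow> real^'n) \<Rightarrow> bool" where
  "backward_characteristic H t x q = (\<lambda>(\<xi>, p).
     \<xi> \<in> extensional {0..t} \<and> p \<in> extensional {0..t} \<and>
     C1_interval 0 t \<xi> \<and> C1_interval 0 t p \<and>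
     (\<forall>s\<in>{0<..<t}. (\<xi> has_vector_derivative H_p H (\<xi> s) (p s)) (at s) \<and>
                    (p has_vector_derivative - H_x H (\<xi> s) (p s)) (at s)) \<and>
     \<xi> t = x \<and> p t = q)"

(* The value 0 off the set of differentiability points is an arbitrary choice on a null set. *)
definition dS_plus ::
  "(real^'n \<Rightarrow> real^'n \<Rightarrow> real) \<Rightarrow> real \<Rightarrow> (real^'n \<Rightarrow> real) \<Rightarrow> (real^'n \<Rightarrow> real) \<Rightarrow> real^'n \<Rightarrow> real" where
  "dS_plus H t u\<^sub>0 w x =
     (if S_plus H t u\<^sub>0 differentiable (at x)
      then w (fst (THE z. backward_characteristic H t x (grad (S_plus H t u\<^sub>0) x) z) 0)
      else 0)"

end

theory Submission
  imports Defs
begin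

text \<open>
  No minimiser of the action is ever constructed. Cutting off large velocities shows that the
  infimum may be taken over curves with a fixed velocity bound. The Lagrangian has a one-sided
  second-order expansion, inherited by duality from the Hamiltonian. At a differentiability point
  \<open>x\<close> of the value function \<open>U\<close>, let \<open>(\<xi>, p)\<close> be a near-minimiser ending at \<open>x\<close> with its
  Legendre momentum, and let \<open>m\<close> solve \<open>m' = - H\<^sub>x(\<xi>, p)\<close>, \<open>m(t) = \<nabla>U(x)\<close>. Varying the velocity
  by \<open>- \<epsilon> (p - m)\<close>, with free end point, gives \<open>\<integral> \<bar>p - m\<bar>\<^sup>2 \<le> \<eta> / \<epsilon> + o(1) + C \<epsilon>\<close>, where \<open>\<eta>\<close> is the
  excess of the cost. So near-minimisers nearly solve the characteristic system; by Gronwall they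
  form a Cauchy family as \<open>\<eta>\<close> tends to 0, which gives both the existence of the backward
  characteristic and the convergence of the starting points to \<open>\<xi>\<^bsub>t,x\<^esub>(0)\<close>. The difference quotient
  lies between the values of \<open>w\<close> at two such starting points. The same expansion makes \<open>U\<close>
  semiconcave, hence differentiable almost everywhere, and dominated convergence concludes.
\<close>

section \<open>Hamiltonians\<close>

text \<open>With a fixed end point the variation would determine p - m only up to an additive
  constant; freeing the end point and paying with the first-order expansion of U at x is what brings
  in the terminal value \<nabla>U(x). Working with excesses of the cost replaces the compactness and
  regularity theory behind the existence of minimisers, and it also handles the perturbed datum: one
  velocity bound serves all data u_0 + \<delta> w with \<delta> \<le> 1, so the starting points of
  near-minimisers ending at x stay within a fixed distance of x, and a near-minimiser for the
  perturbed datum is one for u_0 with an additional excess of order \<delta>. The gradient of the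
  perturbed value function therefore never has to be compared with \<nabla>U. Strong convexity
  enters twice: it makes the Legendre map a continuous bijection in the momentum, and it absorbs the
  linear error terms when the Lagrangian is bounded from above by a quadratic expansion.\<close>

lemma GDERIV_grad: "GDERIV f x :> grad f x" if "f differentiable (at x)"
  for f :: "'a::euclidean_space \<Rightarrow> real"
proof -
  obtain f' where f': "(f has_derivative f') (at x)"
    using \<open>f differentiable (at x)\<close> by (auto simp: differentiable_def)
  define D where "D = (\<Sum>b\<in>Basis. f' b *\<^sub>R b)"
  have lin: "linear f'" using f' by (rule has_derivative_linear)
  have "f' h = h \<bullet> D" for h
  proof -
    have "f' h = f' (\<Sum>b\<in>Basis. (h \<bullet> b) *\<^sub>R b)" by (simp add: euclidean_representation)
    also have "\<dots> = (\<Sum>b\<in>Basis. (h \<bullet> b) * f' b)"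
      by (simp add: linear_sum[OF lin] linear_cmul[OF lin])
    also have "\<dots> = h \<bullet> D" by (simp add: D_def inner_sum_right mult.commute)
    finally show ?thesis .
  qed
  then have D: "GDERIV f x :> D" using f' by (simp add: gderiv_def) (metis (full_types) ext)
  have "E = D" if "GDERIV f x :> E" for E
  proof -
    have "(\<lambda>h. h \<bullet> E) = (\<lambda>h. h \<bullet> D)"
      using that D has_derivative_unique unfolding gderiv_def by blast
    then have "(E - D) \<bullet> E = (E - D) \<bullet> D" by meson
    then have "(E - D) \<bullet> (E - D) = 0" by (simp add: inner_diff_right)
    then show ?thesis by simp
  qed
  with D show ?thesis unfolding grad_def by (metis (mono_tags, lifting) theI_unique)
qed

lemma grad_eqI: "grad f x = D" if "GDERIV f x :> D" for f :: "'a::euclidean_space \<Rightarrow> real"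
proof -
  have "f differentiable (at x)" using that unfolding gderiv_def differentiable_def by blast
  then have "(\<lambda>h. h \<bullet> grad f x) = (\<lambda>h. h \<bullet> D)"
    using that GDERIV_grad has_derivative_unique unfolding gderiv_def by blast
  then have "(grad f x - D) \<bullet> grad f x = (grad f x - D) \<bullet> D" by meson
  then have "(grad f x - D) \<bullet> (grad f x - D) = 0" by (simp add: inner_diff_right)
  then show ?thesis by simp
qed

text \<open>One radius and one constant for both components of the characteristic vector field, in
  the form that the Gronwall arguments consume.\<close>

definition flow_lipschitz :: "('a::real_normed_vector \<Rightarrow> 'a \<Rightarrow> 'a) \<Rightarrow> ('a \<Rightarrow> 'a \<Rightarrow> 'a) \<Rightarrow> real \<Rightarrow> real \<Rightarrow> bool" where
  "flow_lipschitz f g R K \<longleftrightarrow> K \<ge> 0 \<and>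
     (\<forall>x y p r. norm x \<le> R \<longrightarrow> norm y \<le> R \<longrightarrow> norm p \<le> R \<longrightarrow> norm r \<le> R \<longrightarrow>
        norm (f x p - f y r) \<le> K * (norm (x - y) + norm (p - r)) \<and>
        norm (g x p - g y r) \<le> K * (norm (x - y) + norm (p - r)))"

lemma flow_lipschitzD:
  assumes "flow_lipschitz f g R K"
  shows "K \<ge> 0"
    and "norm x \<le> R \<Longrightarrow> norm y \<le> R \<Longrightarrow> norm p \<le> R \<Longrightarrow> norm r \<le> R \<Longrightarrow>
      norm (f x p - f y r) \<le> K * (norm (x - y) + norm (p - r)) \<and>
      norm (g x p - g y r) \<le> K * (norm (x - y) + norm (p - r))"
  using assms unfolding flow_lipschitz_def by blast+

text \<open>Second derivatives are already integrated away here: the bound on \<open>H_pp\<close>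
  becomes a quadratic supporting inequality, and C2 regularity becomes local Lipschitz continuity of
  both partial gradients.\<close>

locale hamiltonian =
  fixes H :: "real^'n \<Rightarrow> real^'n \<Rightarrow> real" and Hp Hx :: "real^'n \<Rightarrow> real^'n \<Rightarrow> real^'n"
    and c0 C0 CL :: real
  assumes c0_pos: "c0 > 0" and C0_nonneg: "C0 \<ge> 0" and CL_nonneg: "CL \<ge> 0"
    and H_lower: "\<And>x p. - C0 \<le> H x p" and H_zero: "\<And>x. H x 0 \<le> C0"
    and GDERIV_p: "\<And>x p. GDERIV (H x) p :> Hp x p"
    and GDERIV_x: "\<And>x p. GDERIV (\<lambda>y. H y p) x :> Hx x p"
    and strong_convex: "\<And>x p r. H x p + Hp x p \<bullet> r + c0 / 2 * (norm r)\<^sup>2 \<le> H x (p + r)"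
    and Hx_bound: "\<And>x p. norm (Hx x p) \<le> CL"
    and Hp_bound: "\<And>R. \<exists>C\<ge>0. \<forall>x p. norm p \<le> R \<longrightarrow> norm (Hp x p) \<le> C"
    and local_lipschitz: "\<And>R. \<exists>K. flow_lipschitz Hp Hx R K"

text \<open>Mean value inequality on a closed ball, which is convex and compact, so that the
  continuous \<open>f''\<close> is bounded there. The maximum with 0 covers an empty ball, where the
  bound K may be negative.\<close>

lemma C2_local_lipschitz:
  fixes f' :: "'a::euclidean_space \<Rightarrow> 'a \<Rightarrow>\<^sub>L 'b::real_normed_vector"
  assumes d: "\<And>z. (f' has_derivative blinfun_apply (f'' z)) (at z)" and c: "continuous_on UNIV f''"
  shows "\<exists>K\<ge>0. \<forall>z\<in>cball 0 R. \<forall>z'\<in>cball 0 R. norm (f' z - f' z') \<le> K * norm (z - z')"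
proof -
  have "bounded (f'' ` cball 0 R)"
    by (intro compact_imp_bounded compact_continuous_image continuous_on_subset[OF c]) auto
  then obtain K where K: "\<And>z. z \<in> cball 0 R \<Longrightarrow> norm (f'' z) \<le> K"
    unfolding bounded_iff by blast
  have "norm (f' z - f' z') \<le> max K 0 * norm (z - z')" if "z \<in> cball 0 R" "z' \<in> cball 0 R" for z z'
  proof (rule differentiable_bound[of "cball 0 R" f' "\<lambda>z. blinfun_apply (f'' z)"])
    show "(f' has_derivative blinfun_apply (f'' x)) (at x within cball 0 R)" for x
      using d has_derivative_at_withinI by blast
    show "onorm (blinfun_apply (f'' x)) \<le> max K 0" if "x \<in> cball 0 R" for x
      using K[OF that] by (simp add: norm_blinfun.rep_eq)
  qed (use that in auto)
  then show ?thesis by (intro exI[of _ "max K 0"]) auto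
qed

lemma hamiltonian_exists:
  fixes H :: "real^'n \<Rightarrow> real^'n \<Rightarrow> real"
  assumes "H1 H" "H2 H" "H3 H" "H4 H"
  shows "\<exists>c0 C0 CL. hamiltonian H (H_p H) (H_x H) c0 C0 CL"
proof -
  obtain f' :: "(real^'n) \<times> (real^'n) \<Rightarrow> ((real^'n) \<times> (real^'n)) \<Rightarrow>\<^sub>L real" and f''
    where f': "\<And>z. ((\<lambda>(x, p). H x p) has_derivative blinfun_apply (f' z)) (at z)"
      and f'': "\<And>z. (f' has_derivative blinfun_apply (f'' z)) (at z)" and f''c: "continuous_on UNIV f''"
    using \<open>H1 H\<close> unfolding H1_def C2_def by blast
  obtain c0 where c0: "c0 > 0" and pp: "\<And>x p. loewner_le (mat c0) (H_pp H x p)"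
    using \<open>H1 H\<close> unfolding H1_def by blast
  obtain C0 where C0: "C0 \<ge> 0" "\<And>x p. H x p \<ge> - C0" "\<And>x. H x 0 \<le> C0"
    using \<open>H2 H\<close> unfolding H2_def by blast
  obtain CL where CL: "CL > 0" "\<And>x p. norm (H_x H x p) \<le> CL"
    using \<open>H3 H\<close> unfolding H3_def by blast
  have dp: "(H x has_derivative (\<lambda>r. blinfun_apply (f' (x, p)) (0, r))) (at p)" for x p
  proof -
    have "((\<lambda>p. (x, p)) has_derivative (\<lambda>r. (0, r))) (at p)"
      by (auto intro!: derivative_eq_intros)
    from has_derivative_compose[OF this f'] show ?thesis by simp
  qed
  have dx: "((\<lambda>y. H y p) has_derivative (\<lambda>r. blinfun_apply (f' (x, p)) (r, 0))) (at x)" for x p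
  proof -
    have "((\<lambda>x. (x, p)) has_derivative (\<lambda>r. (r, 0))) (at x)"
      by (auto intro!: derivative_eq_intros)
    from has_derivative_compose[OF this f'] show ?thesis by simp
  qed
  have gp: "GDERIV (H x) p :> H_p H x p" for x p
    using dp by (intro GDERIV_grad) (auto simp: differentiable_def)
  have gx: "GDERIV (\<lambda>y. H y p) x :> H_x H x p" for x p
    using dx by (intro GDERIV_grad) (auto simp: differentiable_def)
  have pv: "blinfun_apply (f' (x, p)) (0, r) = r \<bullet> H_p H x p" for x p r
    using has_derivative_unique[OF dp gp[unfolded gderiv_def]] by meson
  have xv: "blinfun_apply (f' (x, p)) (r, 0) = r \<bullet> H_x H x p" for x p r
    using has_derivative_unique[OF dx gx[unfolded gderiv_def]] by meson
  \<comment> \<open>The jacobian in (H1) is informative only where \<open>H_p H x\<close> is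
    differentiable. Its coordinates are evaluations of \<open>f'\<close> at fixed vectors, so
    \<open>f''\<close> provides the derivative.\<close>
  have Hpdiff: "(H_p H x) differentiable (at p)" for x p
  proof -
    have eq: "H_p H x = (\<lambda>p. \<Sum>b\<in>Basis. blinfun_apply (f' (x, p)) (0, b) *\<^sub>R b)"
    proof (rule ext)
      fix p
      have "H_p H x p = (\<Sum>b\<in>Basis. (H_p H x p \<bullet> b) *\<^sub>R b)" by (simp only: euclidean_representation)
      then show "H_p H x p = (\<Sum>b\<in>Basis. blinfun_apply (f' (x, p)) (0, b) *\<^sub>R b)"
        by (simp only: pv inner_commute)
    qed
    have "((\<lambda>p. (x, p)) has_derivative (\<lambda>r. (0, r))) (at p)"
      by (auto intro!: derivative_eq_intros)
    from has_derivative_compose[OF this f'']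
    have "((\<lambda>p. f' (x, p)) has_derivative (\<lambda>r. blinfun_apply (f'' (x, p)) (0, r))) (at p)" .
    then have "((\<lambda>p. \<Sum>b\<in>Basis. blinfun_apply (f' (x, p)) (0, b) *\<^sub>R b) has_derivative
        (\<lambda>r. \<Sum>b\<in>Basis. blinfun_apply (blinfun_apply (f'' (x, p)) (0, r)) (0, b) *\<^sub>R b)) (at p)"
      by (intro has_derivative_sum has_derivative_scaleR_left
          bounded_linear.has_derivative[OF blinfun.bounded_linear_left])
    then show ?thesis unfolding eq differentiable_def by blast
  qed
  have sc: "H x p + H_p H x p \<bullet> r + c0 / 2 * (norm r)\<^sup>2 \<le> H x (p + r)" for x p r
  proof -
    have d1: "((\<lambda>s. H x (p + s *\<^sub>R r)) has_real_derivative r \<bullet> H_p H x (p + s *\<^sub>R r)) (at s)" for s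
    proof -
      have "((\<lambda>s. p + s *\<^sub>R r) has_derivative (\<lambda>h. h *\<^sub>R r)) (at s)"
        by (auto intro!: derivative_eq_intros)
      from has_derivative_compose[OF this gp[unfolded gderiv_def]]
      show ?thesis unfolding has_field_derivative_def
        by (rule has_derivative_eq_rhs) (auto simp: fun_eq_iff)
    qed
    have d2: "((\<lambda>s. r \<bullet> H_p H x (p + s *\<^sub>R r)) has_real_derivative r \<bullet> (H_pp H x (p + s *\<^sub>R r) *v r)) (at s)" for s
    proof -
      have "((\<lambda>s. p + s *\<^sub>R r) has_derivative (\<lambda>h. h *\<^sub>R r)) (at s)"
        by (auto intro!: derivative_eq_intros)
      from has_derivative_compose[OF this jacobian_works[THEN iffD1, OF Hpdiff]]
      have "((\<lambda>s. H_p H x (p + s *\<^sub>R r)) has_derivative (\<lambda>h. H_pp H x (p + s *\<^sub>R r) *v (h *\<^sub>R r))) (at s)" .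
      then have "((\<lambda>s. r \<bullet> H_p H x (p + s *\<^sub>R r)) has_derivative (\<lambda>h. r \<bullet> (H_pp H x (p + s *\<^sub>R r) *v (h *\<^sub>R r)))) (at s)"
        by (rule has_derivative_inner_right)
      then show ?thesis unfolding has_field_derivative_def
        by (rule has_derivative_eq_rhs) (auto simp: fun_eq_iff matrix_vector_mult_scaleR)
    qed
    have ppr: "c0 * (norm r)\<^sup>2 \<le> r \<bullet> (H_pp H x p *v r)" for p
    proof -
      have "(mat c0 :: real^'n^'n) *v r = c0 *\<^sub>R r"
        by (simp add: matrix_vector_mult_def mat_def vec_eq_iff if_distrib[where f="\<lambda>u. u * _"] cong: if_cong)
      then show ?thesis using pp[of x p] unfolding loewner_le_def
        by (metis inner_scaleR_right power2_norm_eq_inner)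
    qed
    \<comment> \<open>First integration of the bound on \<open>H_pp\<close> along the ray from p in
      direction r; the second one is the monotonicity of k below.\<close>
    have mono1: "r \<bullet> H_p H x p + c0 * s * (norm r)\<^sup>2 \<le> r \<bullet> H_p H x (p + s *\<^sub>R r)" if "s \<ge> 0" for s
    proof -
      have "(\<lambda>s. r \<bullet> H_p H x (p + s *\<^sub>R r) - c0 * s * (norm r)\<^sup>2) 0 \<le> (\<lambda>s. r \<bullet> H_p H x (p + s *\<^sub>R r) - c0 * s * (norm r)\<^sup>2) s"
      proof (rule DERIV_nonneg_imp_nondecreasing[OF that])
        fix s
        have "((\<lambda>s. r \<bullet> H_p H x (p + s *\<^sub>R r) - c0 * s * (norm r)\<^sup>2) has_real_derivative
            r \<bullet> (H_pp H x (p + s *\<^sub>R r) *v r) - c0 * (norm r)\<^sup>2) (at s)"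
          by (rule d2 derivative_eq_intros refl | simp)+
        then show "\<exists>y. ((\<lambda>s. r \<bullet> H_p H x (p + s *\<^sub>R r) - c0 * s * (norm r)\<^sup>2) has_real_derivative y) (at s) \<and> 0 \<le> y"
          using ppr[of "p + s *\<^sub>R r"] by force
      qed
      then show ?thesis by simp
    qed
    \<comment> \<open>The derivative of k at s is exactly the gap in \<open>mono1\<close>, so
      \<open>k 0 \<le> k 1\<close> is the claim.\<close>
    define k where "k = (\<lambda>s. H x (p + s *\<^sub>R r) - s * (r \<bullet> H_p H x p) - c0 / 2 * s\<^sup>2 * (norm r)\<^sup>2)"
    have k': "(k has_real_derivative r \<bullet> H_p H x (p + s *\<^sub>R r) - r \<bullet> H_p H x p - c0 * s * (norm r)\<^sup>2) (at s)" for s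
      unfolding k_def by (rule d1 derivative_eq_intros refl | simp)+
    have "\<exists>y. (k has_real_derivative y) (at s) \<and> 0 \<le> y" if "0 \<le> s" for s
    proof (intro exI conjI)
      show "0 \<le> r \<bullet> H_p H x (p + s *\<^sub>R r) - r \<bullet> H_p H x p - c0 * s * (norm r)\<^sup>2"
        using mono1[OF that] by linarith
    qed (rule k')
    then have "k 0 \<le> k 1"
      by (rule DERIV_nonneg_imp_nondecreasing[OF zero_le_one])
    moreover have "k 0 = H x p" "k 1 = H x (p + r) - r \<bullet> H_p H x p - c0 / 2 * (norm r)\<^sup>2"
      by (simp_all add: k_def)
    ultimately have "H x p + r \<bullet> H_p H x p + c0 / 2 * (norm r)\<^sup>2 \<le> H x (p + r)" by linarith
    then show ?thesis by (simp add: inner_commute)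
  qed
  have hpb: "\<exists>C\<ge>0. \<forall>x p. norm p \<le> R \<longrightarrow> norm (H_p H x p) \<le> C" for R
  proof -
    obtain C where "C > 0" "\<And>x p. norm p \<le> max R 1 \<Longrightarrow> norm (H_p H x p) \<le> C"
      using \<open>H4 H\<close> unfolding H4_def by (metis less_max_iff_disj zero_less_one)
    then show ?thesis by (intro exI[of _ C]) auto
  qed
  have ll: "\<exists>K. flow_lipschitz (H_p H) (H_x H) R K" for R
  proof -
    \<comment> \<open>Positions and momenta of norm at most R form pairs of norm at most 2
      R.\<close>
    obtain K where K: "K \<ge> 0" "\<And>z z'. norm z \<le> 2 * R \<Longrightarrow> norm z' \<le> 2 * R \<Longrightarrow> norm (f' z - f' z') \<le> K * norm (z - z')"
      using C2_local_lipschitz[OF f'' f''c, of "2 * R"] unfolding Ball_def mem_cball_0 by blast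
    have *: "norm (H_p H x p - H_p H y r) \<le> K * (norm (x - y) + norm (p - r)) \<and>
        norm (H_x H x p - H_x H y r) \<le> K * (norm (x - y) + norm (p - r))"
      if "norm x \<le> R" "norm y \<le> R" "norm p \<le> R" "norm r \<le> R" for x y p r
    proof -
      have n: "norm (x, p) \<le> 2 * R" "norm (y, r) \<le> 2 * R"
        using norm_Pair_le[of x p] norm_Pair_le[of y r] that by linarith+
      let ?k = "K * (norm (x - y) + norm (p - r))"
      have "norm (f' (x, p) - f' (y, r)) \<le> K * norm ((x, p) - (y, r))" by (rule K(2)[OF n])
      also have "\<dots> \<le> ?k"
        using norm_Pair_le[of "x - y" "p - r"] K(1) by (intro mult_left_mono) auto
      finally have k: "norm (f' (x, p) - f' (y, r)) \<le> ?k" .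
      \<comment> \<open>A partial gradient difference a is recovered from the operator norm by
        testing with the vector that represents a itself; this gives
        \<open>norm a * norm a \<le> ?k * norm a\<close>, and one factor cancels.\<close>
      have aux: "norm a \<le> ?k" if "blinfun_apply (f' (x, p) - f' (y, r)) z = a \<bullet> a" "norm z = norm a"
        for a :: "real^'n" and z
      proof -
        have "norm a * norm a = norm (a \<bullet> a)" by (simp add: dot_square_norm power2_eq_square)
        also have "\<dots> \<le> norm (f' (x, p) - f' (y, r)) * norm z"
          using norm_blinfun[of "f' (x, p) - f' (y, r)" z] that by simp
        also have "\<dots> \<le> ?k * norm a" using k that by (simp add: mult_right_mono)
        finally have "norm a * norm a \<le> ?k * norm a" .
        then show ?thesis using K(1) by (cases "norm a = 0") auto
      qed
      show ?thesis
      proof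
        show "norm (H_p H x p - H_p H y r) \<le> ?k"
          by (rule aux[where z="(0, H_p H x p - H_p H y r)"])
             (simp_all add: blinfun.diff_left pv inner_diff_right)
        show "norm (H_x H x p - H_x H y r) \<le> ?k"
          by (rule aux[where z="(H_x H x p - H_x H y r, 0)"])
             (simp_all add: blinfun.diff_left xv inner_diff_right)
      qed
    qed
    show ?thesis unfolding flow_lipschitz_def using K(1) * by blast
  qed
  have "hamiltonian H (H_p H) (H_x H) c0 C0 CL"
    by unfold_locales (use c0 C0 CL gp gx sc hpb ll in auto)
  then show ?thesis by blast
qed

section \<open>The Lagrangian\<close>

text \<open>Young's inequality, by completing the square. It removes a linear term at the price of a
  strongly convex one.\<close>

lemma quadratic_le: "a * b - c / 2 * a\<^sup>2 \<le> b\<^sup>2 / (2 * c)" if "c > 0" for a b c :: real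
proof -
  have "0 \<le> (c * a - b)\<^sup>2 / (2 * c)" using that by simp
  also have "\<dots> = b\<^sup>2 / (2 * c) - (a * b - c / 2 * a\<^sup>2)"
    using that by (simp add: field_simps power2_eq_square)
  finally show ?thesis by simp
qed

context hamiltonian
begin

abbreviation L :: "real^'n \<Rightarrow> real^'n \<Rightarrow> real" where "L \<equiv> conj_H H"

text \<open>The inverse Legendre map. The choice is determinate because \<open>Hp x\<close> is onto
  by \<open>Hp_surj\<close> and injective by \<open>Hp_monotone\<close>.\<close>

definition P :: "real^'n \<Rightarrow> real^'n \<Rightarrow> real^'n" where "P x q = (SOME p. Hp x p = q)"

lemma H_quadratic_lower: "c0 / 2 * (norm p)\<^sup>2 - norm p * norm (Hp x 0) - C0 \<le> H x p"
proof -
  have "H x 0 + Hp x 0 \<bullet> p + c0 / 2 * (norm p)\<^sup>2 \<le> H x p"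
    using strong_convex[of x 0 p] by simp
  moreover have "- (norm p * norm (Hp x 0)) \<le> Hp x 0 \<bullet> p"
    using Cauchy_Schwarz_ineq2[of "Hp x 0" p] by (simp add: mult.commute abs_le_iff)
  ultimately show ?thesis using H_lower[of x 0] by linarith
qed

lemma H_continuous_p: "continuous_on UNIV (H x)"
  using GDERIV_p[of x] unfolding gderiv_def
  by (meson continuous_at_imp_continuous_on has_derivative_continuous)

lemma H_lipschitz_x: "\<bar>H x p - H y p\<bar> \<le> CL * norm (x - y)"
proof -
  have "norm (H x p - H y p) \<le> CL * norm (x - y)"
  proof (rule differentiable_bound[of UNIV "\<lambda>x. H x p" "\<lambda>x h. h \<bullet> Hx x p"])
    show "((\<lambda>x. H x p) has_derivative (\<lambda>h. h \<bullet> Hx z p)) (at z within UNIV)" for z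
      using GDERIV_x unfolding gderiv_def by simp
    show "onorm (\<lambda>h. h \<bullet> Hx z p) \<le> CL" for z
    proof (rule onorm_le)
      fix h
      have "norm (h \<bullet> Hx z p) \<le> norm h * norm (Hx z p)" using Cauchy_Schwarz_ineq2 by simp
      also have "\<dots> \<le> CL * norm h" using mult_left_mono[OF Hx_bound[of z p], of "norm h"] by (simp add: mult.commute)
      finally show "norm (h \<bullet> Hx z p) \<le> CL * norm h" .
    qed
  qed auto
  then show ?thesis by simp
qed

text \<open>The Lipschitz bound in x is uniform in p, which upgrades separate continuity to joint
  continuity.\<close>

lemma H_continuous: "continuous_on UNIV (\<lambda>(x, p). H x p)"
proof (clarsimp simp: continuous_on_eq_continuous_within continuous_within)
  fix x p
  have 1: "((\<lambda>z. H x (snd z)) \<longlongrightarrow> H x p) (at (x, p))"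
    using H_continuous_p[of x] by (intro continuous_on_tendsto_compose[of UNIV "H x"]) (auto intro!: tendsto_eq_intros)
  have "((\<lambda>z. H (fst z) (snd z) - H x (snd z)) \<longlongrightarrow> 0) (at (x, p))"
  proof (rule Lim_null_comparison)
    show "\<forall>\<^sub>F z in at (x, p). norm (H (fst z) (snd z) - H x (snd z)) \<le> CL * norm (fst z - x)"
      using H_lipschitz_x by simp
    show "((\<lambda>z. CL * norm (fst z - x)) \<longlongrightarrow> 0) (at (x, p))"
      by (auto intro!: tendsto_eq_intros)
  qed
  from tendsto_add[OF this 1] show "((\<lambda>(x, p). H x p) \<longlongrightarrow> H x p) (at (x, p))"
    by (simp add: case_prod_unfold)
qed

text \<open>The function \<open>H x p - p \<bullet> q\<close> is coercive by strong convexity, hence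
  has a minimum, and at a minimum its gradient \<open>Hp x p - q\<close> vanishes.\<close>

lemma Hp_surj: "\<exists>p. Hp x p = q"
proof -
  define b where "b = norm q + norm (Hp x 0)"
  \<comment> \<open>Beyond this radius \<open>c0 / 2 * norm p - b\<close> is at least
    \<open>2 * C0 + 1\<close>, so the quadratic lower bound exceeds the value at 0. The final
    summand ensures \<rho> \<ge> 1, so that multiplying by \<open>norm p\<close> only helps.\<close>
  define \<rho> where "\<rho> = 2 * (b + 2 * C0 + 1) / c0 + 1"
  have b: "b \<ge> 0" by (simp add: b_def)
  have \<rho>: "\<rho> \<ge> 1" using b c0_pos C0_nonneg by (simp add: \<rho>_def)
  let ?f = "\<lambda>p. H x p - p \<bullet> q"
  have large: "?f 0 \<le> ?f p" if "norm p \<ge> \<rho>" for p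
  proof -
    have n1: "norm p \<ge> 1" using that \<rho> by linarith
    have "b + 2 * C0 + 1 \<le> c0 / 2 * \<rho>" using c0_pos by (simp add: \<rho>_def field_simps)
    also have "\<dots> \<le> c0 / 2 * norm p" using that c0_pos by simp
    finally have e: "2 * C0 + 1 \<le> c0 / 2 * norm p - b" by linarith
    then have "0 \<le> c0 / 2 * norm p - b" using C0_nonneg by linarith
    from mult_right_mono[OF n1 this]
    have "c0 / 2 * norm p - b \<le> norm p * (c0 / 2 * norm p - b)" by (simp only: mult_1)
    note order_trans[OF e this]
    also have "\<dots> = c0 / 2 * (norm p)\<^sup>2 - norm p * b" by (simp add: right_diff_distrib power2_eq_square)
    finally have "2 * C0 + 1 \<le> c0 / 2 * (norm p)\<^sup>2 - norm p * b" .
    moreover have "p \<bullet> q \<le> norm p * norm q" by (rule norm_cauchy_schwarz)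
    moreover have "norm p * b = norm p * norm q + norm p * norm (Hp x 0)" by (simp only: b_def distrib_left)
    moreover have "(0::real^'n) \<bullet> q = 0" by simp
    ultimately show ?thesis
      using H_quadratic_lower[of p x] H_zero[of x] by linarith
  qed
  have "continuous_on (cball 0 \<rho>) ?f"
    by (intro continuous_intros continuous_on_subset[OF H_continuous_p]) auto
  moreover have "cball (0::real^'n) \<rho> \<noteq> {}" using \<rho> by simp
  ultimately obtain p where p: "p \<in> cball 0 \<rho>" "\<And>r. r \<in> cball 0 \<rho> \<Longrightarrow> ?f p \<le> ?f r"
    using continuous_attains_inf[OF compact_cball, of 0 \<rho> ?f] by blast
  have min: "?f p \<le> ?f r" for r
  proof (cases "norm r \<le> \<rho>")
    case False
    then have "?f 0 \<le> ?f r" by (intro large) auto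
    moreover have "?f p \<le> ?f 0" using p(2)[of 0] \<rho> by simp
    ultimately show ?thesis by linarith
  qed (use p in auto)
  have "(?f has_derivative (\<lambda>h. h \<bullet> Hp x p - h \<bullet> q)) (at p)"
    using GDERIV_p[of x p] unfolding gderiv_def by (auto intro!: derivative_eq_intros)
  then have "(\<lambda>h. h \<bullet> Hp x p - h \<bullet> q) = (\<lambda>h. 0)"
    by (rule has_derivative_local_min) (simp add: min)
  then have "(Hp x p - q) \<bullet> (Hp x p - q) = 0" by (metis inner_diff_right)
  then show ?thesis by auto
qed

lemma Hp_P [simp]: "Hp x (P x q) = q"
  unfolding P_def by (rule someI_ex) (rule Hp_surj)

text \<open>The supporting hyperplane of \<open>H x\<close> at \<open>P x q\<close> has slope q, so
  the supremum in \<open>conj_H\<close> is attained there.\<close>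

lemma conj_le_P: "p \<bullet> q - H x p \<le> P x q \<bullet> q - H x (P x q)"
proof -
  have "H x (P x q) + q \<bullet> (p - P x q) + c0 / 2 * (norm (p - P x q))\<^sup>2 \<le> H x p"
    using strong_convex[of x "P x q" "p - P x q"] by simp
  moreover have "0 \<le> c0 / 2 * (norm (p - P x q))\<^sup>2" using c0_pos by simp
  ultimately show ?thesis by (simp add: inner_diff_right inner_commute)
qed

lemma L_eq: "L x q = P x q \<bullet> q - H x (P x q)"
  unfolding conj_H_def by (rule cSup_eq_maximum) (use conj_le_P in auto)

lemma L_ge: "p \<bullet> q - H x p \<le> L x q"
  using conj_le_P by (simp add: L_eq)

lemma L_le: "L x q \<le> B" if "\<And>p. p \<bullet> q - H x p \<le> B"
  using that by (simp add: L_eq)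

lemma L_lower: "- C0 \<le> L x q"
  using L_ge[of 0 q x] H_zero[of x] by simp

lemma L_zero: "L x 0 \<le> C0"
  by (rule L_le) (use H_lower in \<open>simp add: minus_le_iff\<close>)

lemma L_lipschitz_x: "L x q \<le> L y q + CL * norm (x - y)"
proof (rule L_le)
  fix p show "p \<bullet> q - H x p \<le> L y q + CL * norm (x - y)"
    using L_ge[of p q y] H_lipschitz_x[of x p y] by (simp add: abs_le_iff)
qed

text \<open>Test the supremum with the momentum of length R in the direction of q; on the ball of
  radius R, H is bounded above uniformly in x by convexity, (H4) and the bound on
  \<open>H x 0\<close>.\<close>

lemma L_superlinear: "\<exists>C\<ge>0. \<forall>x q. R * norm q - C \<le> L x q" if "R \<ge> 0"
proof -
  obtain C where C: "C \<ge> 0" "\<And>x p. norm p \<le> R \<Longrightarrow> norm (Hp x p) \<le> C"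
    using Hp_bound[of R] by blast
  have "R * norm q - (C0 + R * C) \<le> L x q" for x q
  proof -
    \<comment> \<open>For q = 0 the division returns 0, hence p = 0 and the identity
      \<open>p \<bullet> q = R * norm q\<close> persists.\<close>
    define p where "p = (R / norm q) *\<^sub>R q"
    have pq: "p \<bullet> q = R * norm q" by (simp add: p_def dot_square_norm power2_eq_square)
    have np: "norm p \<le> R" using that by (simp add: p_def)
    have "H x p + Hp x p \<bullet> (- p) + c0 / 2 * (norm p)\<^sup>2 \<le> H x 0"
      using strong_convex[of x p "- p"] by simp
    moreover have "0 \<le> c0 / 2 * (norm p)\<^sup>2" using c0_pos by simp
    moreover have "Hp x p \<bullet> p \<le> R * C"
    proof -
      have "Hp x p \<bullet> p \<le> norm (Hp x p) * norm p" by (rule norm_cauchy_schwarz)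
      also have "\<dots> \<le> C * R" using C np by (intro mult_mono) auto
      finally show ?thesis by (simp add: mult.commute)
    qed
    ultimately have "H x p \<le> C0 + R * C" using H_zero[of x] by simp
    then show ?thesis using L_ge[of p q x] pq by linarith
  qed
  then show ?thesis using C C0_nonneg that by (intro exI[of _ "C0 + R * C"]) auto
qed

text \<open>Add the convexity inequalities at p and at r and apply Cauchy-Schwarz. This yields
  injectivity of the Legendre map and both the bounds and the continuity of P.\<close>

lemma Hp_monotone: "c0 * norm (p - r) \<le> norm (Hp x p - Hp x r)"
proof -
  have "H x p + Hp x p \<bullet> (r - p) + c0 / 2 * (norm (p - r))\<^sup>2 \<le> H x r"
    using strong_convex[of x p "r - p"] by (simp add: norm_minus_commute)
  moreover have "H x r + Hp x r \<bullet> (p - r) + c0 / 2 * (norm (p - r))\<^sup>2 \<le> H x p"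
    using strong_convex[of x r "p - r"] by simp
  ultimately have "c0 * (norm (p - r))\<^sup>2 \<le> (Hp x p - Hp x r) \<bullet> (p - r)"
    by (simp add: inner_diff_left inner_diff_right)
  also have "\<dots> \<le> norm (Hp x p - Hp x r) * norm (p - r)" by (rule norm_cauchy_schwarz)
  finally have "(c0 * norm (p - r)) * norm (p - r) \<le> norm (Hp x p - Hp x r) * norm (p - r)"
    by (simp add: power2_eq_square mult.assoc)
  then show ?thesis by (cases "p = r") auto
qed

lemma P_bound: "\<exists>B\<ge>0. \<forall>x q. norm q \<le> M \<longrightarrow> norm (P x q) \<le> B"
proof -
  obtain C where C: "C \<ge> 0" "\<And>x p. norm p \<le> 0 \<Longrightarrow> norm (Hp x p) \<le> C"
    using Hp_bound[of 0] by blast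
  have "norm (P x q) \<le> (\<bar>M\<bar> + C) / c0" if "norm q \<le> M" for x q
  proof -
    have "c0 * norm (P x q) \<le> norm (q - Hp x 0)"
      using Hp_monotone[of "P x q" 0 x] by simp
    also have "\<dots> \<le> norm q + norm (Hp x 0)" by (rule norm_triangle_ineq4)
    also have "\<dots> \<le> \<bar>M\<bar> + C" using C(2)[of 0 x] that by simp
    finally show ?thesis using c0_pos by (simp add: field_simps)
  qed
  then show ?thesis using C(1) c0_pos by (intro exI[of _ "(\<bar>M\<bar> + C) / c0"]) auto
qed

text \<open>Monotonicity is used at the moving base point y, where \<open>Hp y (P y r) = r\<close>
  holds exactly; what remains is \<open>Hp y - Hp x\<close> at the fixed momentum
  \<open>P x q\<close>, controlled by the local Lipschitz constant.\<close>

lemma P_continuous: "continuous_on UNIV (\<lambda>(x, q). P x q)"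
proof (clarsimp simp: continuous_on_eq_continuous_within continuous_within)
  fix x q :: "real^'n"
  obtain B where B: "B \<ge> 0" "\<And>y r. norm r \<le> norm q + 1 \<Longrightarrow> norm (P y r) \<le> B" using P_bound by blast
  define R where "R = max (norm x + 1) B"
  obtain K where "flow_lipschitz Hp Hx R K" using local_lipschitz by blast
  note K = flow_lipschitzD[OF this]
  have est: "norm (P y r - P x q) \<le> (norm (r - q) + K * norm (y - x)) / c0"
    if y: "norm y \<le> norm x + 1" and r: "norm r \<le> norm q + 1" for y r
  proof -
    have "c0 * norm (P y r - P x q) \<le> norm (Hp y (P y r) - Hp y (P x q))" by (rule Hp_monotone)
    also have "\<dots> = norm ((r - q) + (Hp x (P x q) - Hp y (P x q)))" by simp
    also have "\<dots> \<le> norm (r - q) + norm (Hp x (P x q) - Hp y (P x q))" by (rule norm_triangle_ineq)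
    also have "norm (Hp x (P x q) - Hp y (P x q)) \<le> K * (norm (x - y) + norm (P x q - P x q))"
      using B(2)[of q x] y by (intro K(2)[THEN conjunct1]) (auto simp: R_def)
    finally show ?thesis using c0_pos by (simp add: field_simps norm_minus_commute)
  qed
  have "\<forall>\<^sub>F z in at (x, q). dist z (x, q) < 1"
    unfolding eventually_at by (intro exI[of _ 1]) auto
  then have ev: "\<forall>\<^sub>F z in at (x, q). norm (P (fst z) (snd z) - P x q) \<le> (norm (snd z - q) + K * norm (fst z - x)) / c0"
  proof eventually_elim
    case (elim z)
    have "dist (fst z) x < 1" "dist (snd z) q < 1"
      using dist_fst_le[of z "(x, q)"] dist_snd_le[of z "(x, q)"] elim by auto
    then show ?case
      using norm_triangle_ineq2[of "fst z" x] norm_triangle_ineq2[of "snd z" q]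
      by (intro est) (auto simp: dist_norm)
  qed
  have "((\<lambda>z. P (fst z) (snd z) - P x q) \<longlongrightarrow> 0) (at (x, q))"
    by (rule Lim_null_comparison[OF ev]) (use c0_pos in \<open>auto intro!: tendsto_eq_intros\<close>)
  then show "((\<lambda>(x, q). P x q) \<longlongrightarrow> P x q) (at (x, q))"
    by (subst Lim_null) (simp add: case_prod_unfold)
qed

lemma L_continuous: "continuous_on UNIV (\<lambda>(x, q). L x q)"
proof -
  have 1: "continuous_on UNIV (\<lambda>z. P (fst z) (snd z))"
    using P_continuous by (simp add: case_prod_unfold)
  have "continuous_on UNIV (\<lambda>z. (\<lambda>(x, p). H x p) (fst z, P (fst z) (snd z)))"
    by (rule continuous_on_compose2[OF H_continuous]) (auto intro!: continuous_intros 1)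
  then show ?thesis
    unfolding L_eq case_prod_unfold by (auto intro!: continuous_intros 1)
qed

section \<open>One-sided expansions of the Hamiltonian and the Lagrangian\<close>

text \<open>The remainder is at most \<open>norm h\<close> times the oscillation of
  \<open>Hx\<close> along the segment; this crude form of Taylor's formula costs K instead of K /
  2.\<close>

lemma H_expansion_x:
  assumes K: "\<And>x y. norm x \<le> R \<Longrightarrow> norm y \<le> R \<Longrightarrow> norm (Hx x p - Hx y p) \<le> K * norm (x - y)" "K \<ge> 0"
    and x: "norm x \<le> R" "norm (x + h) \<le> R"
  shows "H x p + Hx x p \<bullet> h - K * (norm h)\<^sup>2 \<le> H (x + h) p"
proof -
  let ?S = "closed_segment x (x + h)"
  have sub: "?S \<subseteq> cball 0 R" using x by (intro closed_segment_subset) auto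
  have "norm (H (x + h) p - H x p - ((x + h) - x) \<bullet> Hx x p) \<le> norm ((x + h) - x) * (K * norm h)"
  proof (rule differentiable_bound_linearization[of x "x + h" ?S "\<lambda>x. H x p" "\<lambda>x h. h \<bullet> Hx x p" x])
    show "x + s *\<^sub>R (x + h - x) \<in> ?S" if "s \<in> {0..1}" for s
      using that by (auto simp: closed_segment_def algebra_simps intro!: exI[of _ s])
    show "((\<lambda>x. H x p) has_derivative (\<lambda>h. h \<bullet> Hx z p)) (at z within ?S)" for z
      using GDERIV_x unfolding gderiv_def by (blast intro: has_derivative_at_withinI)
    show "onorm ((\<lambda>k. k \<bullet> Hx z p) - (\<lambda>k. k \<bullet> Hx x p)) \<le> K * norm h" if "z \<in> ?S" for z
      unfolding fun_diff_def
    proof (rule onorm_le)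
      fix k
      have zx: "norm (z - x) \<le> norm h"
        using segment_bound[OF that] by simp
      have "norm (k \<bullet> Hx z p - k \<bullet> Hx x p) \<le> norm k * norm (Hx z p - Hx x p)"
        using Cauchy_Schwarz_ineq2[of k "Hx z p - Hx x p"] by (simp add: inner_diff_right)
      also have "\<dots> \<le> norm k * (K * norm (z - x))"
        using sub that x by (intro mult_left_mono K(1)) auto
      also have "\<dots> \<le> norm k * (K * norm h)" using zx K(2) by (intro mult_left_mono) auto
      finally show "norm (k \<bullet> Hx z p - k \<bullet> Hx x p) \<le> K * norm h * norm k" by (simp add: mult.commute)
    qed
  qed simp
  then show ?thesis by (simp add: abs_le_iff inner_commute power2_eq_square algebra_simps)
qed

text \<open>The one-sided second-order expansion of the Lagrangian only needs a lower expansion of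
  \<^term>\<open>H\<close> (Legendre duality reverses the inequality), so differentiability of \<^term>\<open>conj_H H\<close> is never used.\<close>

lemma L_semiconcave:
  "\<exists>C\<ge>0. \<forall>x h q k. norm x \<le> R \<longrightarrow> norm (x + h) \<le> R \<longrightarrow> norm q \<le> R \<longrightarrow>
     L (x + h) (q + k) \<le> L x q + P x q \<bullet> k - Hx x (P x q) \<bullet> h + C * ((norm h)\<^sup>2 + (norm k)\<^sup>2)"
proof -
  obtain B where B: "B \<ge> 0" "\<And>x q. norm q \<le> R \<Longrightarrow> norm (P x q) \<le> B" using P_bound by blast
  define R' where "R' = max R B"
  obtain K where "flow_lipschitz Hp Hx R' K" using local_lipschitz by blast
  note K = flow_lipschitzD[OF this]
  \<comment> \<open>K comes from the expansion of H in x, and 1 / c0 is the price of absorbing the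
    terms linear in \<open>\<pi> - p\<close>.\<close>
  define C where "C = K + (1 + K\<^sup>2) / c0"
  have "L (x + h) (q + k) \<le> L x q + P x q \<bullet> k - Hx x (P x q) \<bullet> h + C * ((norm h)\<^sup>2 + (norm k)\<^sup>2)"
    if x: "norm x \<le> R" "norm (x + h) \<le> R" and q: "norm q \<le> R" for x h q k
  proof (rule L_le)
    fix \<pi>
    define p where "p = P x q"
    define r where "r = \<pi> - p"
    have pb: "norm p \<le> R'" using B(2)[OF q, of x] by (simp add: p_def R'_def)
    have xb: "norm x \<le> R'" "norm (x + h) \<le> R'" using x by (auto simp: R'_def)
    have 1: "H (x + h) p + Hp (x + h) p \<bullet> r + c0 / 2 * (norm r)\<^sup>2 \<le> H (x + h) \<pi>"
      using strong_convex[of "x + h" p r] by (simp add: r_def)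
    have Kx: "norm (Hx y p - Hx z p) \<le> K * norm (y - z)" if "norm y \<le> R'" "norm z \<le> R'" for y z
      using K(2)[OF that pb pb] by simp
    have 2: "H x p + Hx x p \<bullet> h - K * (norm h)\<^sup>2 \<le> H (x + h) p"
      by (rule H_expansion_x[of R' p K]) (use xb K Kx in auto)
    have 3: "q \<bullet> r - K * norm h * norm r \<le> Hp (x + h) p \<bullet> r"
    proof -
      have "(q - Hp (x + h) p) \<bullet> r \<le> norm (Hp x p - Hp (x + h) p) * norm r"
        using norm_cauchy_schwarz[of "q - Hp (x + h) p" r] by (simp add: p_def)
      also have "\<dots> \<le> (K * norm h) * norm r"
        using K(2)[OF xb pb pb] by (intro mult_right_mono) auto
      finally show ?thesis by (simp add: inner_diff_left)
    qed
    have 4: "r \<bullet> k \<le> norm r * norm k" by (rule norm_cauchy_schwarz)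
    \<comment> \<open>This makes the bound uniform over the competitor \<pi>: everything linear in
      r, from the change k of velocity and from moving the base point of \<open>Hp\<close>, is
      swallowed by strong convexity.\<close>
    have 5: "norm r * (norm k + K * norm h) - c0 / 2 * (norm r)\<^sup>2 \<le> (norm k + K * norm h)\<^sup>2 / (2 * c0)"
      by (rule quadratic_le[OF c0_pos])
    have 6: "(norm k + K * norm h)\<^sup>2 / (2 * c0) \<le> ((norm k)\<^sup>2 + K\<^sup>2 * (norm h)\<^sup>2) / c0"
    proof -
      have "(norm k + K * norm h)\<^sup>2 \<le> 2 * ((norm k)\<^sup>2 + K\<^sup>2 * (norm h)\<^sup>2)"
        using sum_squares_bound[of "norm k" "K * norm h"] by (simp add: power2_sum power_mult_distrib)
      then show ?thesis using c0_pos by (simp add: field_simps)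
    qed
    have 7: "K * (norm h)\<^sup>2 + ((norm k)\<^sup>2 + K\<^sup>2 * (norm h)\<^sup>2) / c0 \<le> C * ((norm h)\<^sup>2 + (norm k)\<^sup>2)"
    proof -
      have "C * ((norm h)\<^sup>2 + (norm k)\<^sup>2) - (K * (norm h)\<^sup>2 + ((norm k)\<^sup>2 + K\<^sup>2 * (norm h)\<^sup>2) / c0)
         = K * (norm k)\<^sup>2 + ((norm h)\<^sup>2 + K\<^sup>2 * (norm k)\<^sup>2) / c0"
        by (simp add: C_def algebra_simps add_divide_distrib)
      also have "\<dots> \<ge> 0" using K(1) c0_pos by simp
      finally show ?thesis by simp
    qed
    have "\<pi> \<bullet> (q + k) = p \<bullet> q + p \<bullet> k + q \<bullet> r + r \<bullet> k"
      by (simp add: r_def inner_add_right inner_diff_left inner_diff_right inner_commute)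
    moreover have "L x q = p \<bullet> q - H x p" by (simp add: L_eq p_def)
    moreover have "norm r * (norm k + K * norm h) = norm r * norm k + K * norm h * norm r"
      by (simp add: algebra_simps)
    ultimately show "\<pi> \<bullet> (q + k) - H (x + h) \<pi> \<le> L x q + P x q \<bullet> k - Hx x (P x q) \<bullet> h + C * ((norm h)\<^sup>2 + (norm k)\<^sup>2)"
      using 1 2 3 4 5 6 7 unfolding p_def[symmetric] by linarith
  qed
  moreover have "C \<ge> 0" using K(1) c0_pos by (simp add: C_def)
  ultimately show ?thesis by blast
qed

end

section \<open>Bounded measurable velocities\<close>

text \<open>This class is closed under continuous operations and under indefinite integration, so
  integrability side conditions reduce to applying closure rules.\<close>

definition bmeas :: "real \<Rightarrow> (real \<Rightarrow> 'a::euclidean_space) \<Rightarrow> bool" where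
  "bmeas t f \<longleftrightarrow> f \<in> borel_measurable (lebesgue_on {0..t}) \<and> bounded (f ` {0..t})"

lemma bmeas_bound: "\<exists>B\<ge>0. \<forall>s\<in>{0..t}. norm (f s) \<le> B" if "bmeas t f"
  using that unfolding bmeas_def bounded_pos by (auto intro: less_imp_le)

text \<open>The closure of the bounded range is compact, so its image under g is bounded.\<close>

lemma bmeas_compose:
  fixes g :: "'a::euclidean_space \<Rightarrow> 'b::euclidean_space"
  assumes "continuous_on UNIV g" "bmeas t f"
  shows "bmeas t (\<lambda>s. g (f s))"
proof -
  have "(\<lambda>s. g (f s)) \<in> borel_measurable (lebesgue_on {0..t})"
    using assms by (auto simp: bmeas_def intro: measurable_compose borel_measurable_continuous_onI)
  moreover have "bounded (g ` closure (f ` {0..t}))"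
    using assms by (intro compact_imp_bounded compact_continuous_image continuous_on_subset[OF assms(1)])
      (auto simp: bmeas_def compact_closure)
  then have "bounded ((\<lambda>s. g (f s)) ` {0..t})"
    by (rule bounded_subset) (use closure_subset in fastforce)
  ultimately show ?thesis by (simp add: bmeas_def)
qed

lemma bmeas_Pair: "bmeas t (\<lambda>s. (f s, g s))" if "bmeas t f" "bmeas t g"
proof -
  have "bounded (f ` {0..t} \<times> g ` {0..t})" using that by (auto simp: bmeas_def intro: bounded_Times)
  then have "bounded ((\<lambda>s. (f s, g s)) ` {0..t})" by (rule bounded_subset) auto
  with that show ?thesis by (auto simp: bmeas_def)
qed

lemma bmeas_compose2:
  assumes "continuous_on UNIV (\<lambda>z. g (fst z) (snd z))" "bmeas t f" "bmeas t h"
  shows "bmeas t (\<lambda>s. g (f s) (h s))"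
  using bmeas_compose[OF assms(1) bmeas_Pair[OF assms(2,3)]] by simp

lemma bmeas_continuous: "bmeas t f" if "continuous_on {0..t} f"
  using that unfolding bmeas_def
  by (auto intro!: continuous_imp_measurable_on_sets_lebesgue compact_imp_bounded compact_continuous_image)

lemma bmeas_add: "bmeas t f \<Longrightarrow> bmeas t g \<Longrightarrow> bmeas t (\<lambda>s. f s + g s)"
  by (rule bmeas_compose2[of "(+)"]) (auto intro!: continuous_intros)
lemma bmeas_diff: "bmeas t f \<Longrightarrow> bmeas t g \<Longrightarrow> bmeas t (\<lambda>s. f s - g s)"
  by (rule bmeas_compose2[of "(-)"]) (auto intro!: continuous_intros)
lemma bmeas_inner: "bmeas t f \<Longrightarrow> bmeas t g \<Longrightarrow> bmeas t (\<lambda>s. f s \<bullet> g s)"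
  by (rule bmeas_compose2[of "(\<bullet>)"]) (auto intro!: continuous_intros)
lemma bmeas_scaleR: "bmeas t f \<Longrightarrow> bmeas t g \<Longrightarrow> bmeas t (\<lambda>s. f s *\<^sub>R g s)"
  by (rule bmeas_compose2[of "(*\<^sub>R)"]) (auto intro!: continuous_intros)
lemma bmeas_norm: "bmeas t f \<Longrightarrow> bmeas t (\<lambda>s. norm (f s))"
  by (rule bmeas_compose) (auto intro!: continuous_intros)
lemma bmeas_power2: "bmeas t f \<Longrightarrow> bmeas t (\<lambda>s. (f s :: real)\<^sup>2)"
  by (rule bmeas_compose) (auto intro!: continuous_intros)
lemma bmeas_const: "bmeas t (\<lambda>s. c)"
  by (rule bmeas_continuous) auto
lemma bmeas_ident: "bmeas t (\<lambda>s. s)"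
  by (rule bmeas_continuous) auto

lemmas bmeas_intros = bmeas_add bmeas_diff bmeas_inner bmeas_scaleR bmeas_norm bmeas_power2 bmeas_const bmeas_ident

lemma bmeas_absolutely_integrable: "f absolutely_integrable_on {0..t}" if "bmeas t f"
proof -
  obtain B where B: "\<forall>s\<in>{0..t}. norm (f s) \<le> B" using bmeas_bound[OF \<open>bmeas t f\<close>] by blast
  show ?thesis
    by (rule measurable_bounded_by_integrable_imp_absolutely_integrable[of f _ "\<lambda>_. B"])
       (use that B in \<open>auto simp: bmeas_def\<close>)
qed

lemma bmeas_integrable: "f integrable_on {a..b}" if "bmeas t f" "0 \<le> a" "b \<le> t"
proof -
  have "f integrable_on {0..t}"
    using bmeas_absolutely_integrable[OF that(1)] set_lebesgue_integral_eq_integral(1) by blast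
  then show ?thesis by (rule integrable_on_subinterval) (use that in auto)
qed

lemma bmeas_integral: "bmeas t (\<lambda>s. integral {0..s} f)" if "bmeas t f"
  by (intro bmeas_continuous indefinite_integral_continuous_1 bmeas_integrable[OF that]) auto

lemma bmeas_integral': "bmeas t (\<lambda>s. integral {s..t} f)" if "bmeas t f"
  by (intro bmeas_continuous indefinite_integral_continuous_1' bmeas_integrable[OF that]) auto

section \<open>Fubini on a triangle and integral curves\<close>

text \<open>Both sides are iterated integrals of \<open>f s * g r\<close> over the triangle r \<le>
  s. The kernel is bounded and the product measure finite, hence integrability.\<close>

lemma Fubini_triangle_real:
  fixes f g :: "real \<Rightarrow> real"
  assumes f: "bmeas t f" and g: "bmeas t g"
  shows "integral {0..t} (\<lambda>s. f s * integral {0..s} g) = integral {0..t} (\<lambda>s. g s * integral {s..t} f)"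
proof -
  let ?M = "lebesgue_on {0..t}"
  define F where "F = (\<lambda>s r. if r \<le> s then f s * g r else 0)"
  interpret M: finite_measure ?M
    by (rule finite_measure_lebesgue_on) auto
  interpret MM: pair_sigma_finite ?M ?M ..
  interpret MMf: finite_measure "?M \<Otimes>\<^sub>M ?M"
    by (rule finite_measure_pair_measure) unfold_locales
  obtain A where A: "\<forall>s\<in>{0..t}. norm (f s) \<le> A" "A \<ge> 0" using bmeas_bound[OF f] by blast
  obtain B where B: "\<forall>s\<in>{0..t}. norm (g s) \<le> B" "B \<ge> 0" using bmeas_bound[OF g] by blast
  have [measurable]: "f \<in> borel_measurable ?M" "g \<in> borel_measurable ?M" "(\<lambda>s. s) \<in> borel_measurable ?M"
    using f g bmeas_ident[of t] by (auto simp: bmeas_def)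
  \<comment> \<open>The product is one of Lebesgue sigma-algebras on the interval, so the Borel
    measurability of the coordinates that \<open>r \<le> s\<close> calls for is derived from that of
    the identity.\<close>
  have [measurable]: "fst \<in> borel_measurable (?M \<Otimes>\<^sub>M ?M)" "snd \<in> borel_measurable (?M \<Otimes>\<^sub>M ?M)"
    using measurable_compose[OF measurable_fst[of ?M ?M], of "\<lambda>s. s" borel]
      measurable_compose[OF measurable_snd[of ?M ?M], of "\<lambda>s. s" borel] by simp_all
  have Fm: "case_prod F \<in> borel_measurable (?M \<Otimes>\<^sub>M ?M)"
    unfolding F_def case_prod_beta by measurable
  have int: "integrable (?M \<Otimes>\<^sub>M ?M) (case_prod F)"
  proof (rule MMf.integrable_const_bound[of _ "A * B"])
    show "AE z in ?M \<Otimes>\<^sub>M ?M. norm (case_prod F z) \<le> A * B"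
    proof (rule AE_I2)
      fix z assume "z \<in> space (?M \<Otimes>\<^sub>M ?M)"
      then have "fst z \<in> {0..t}" "snd z \<in> {0..t}" by (auto simp: space_pair_measure)
      then have "norm (f (fst z)) * norm (g (snd z)) \<le> A * B" "0 \<le> A * B"
        using A B by (auto intro!: mult_mono)
      then show "norm (case_prod F z) \<le> A * B" by (auto simp: F_def case_prod_unfold abs_mult)
    qed
  qed (rule Fm)
  have Hk: "integral\<^sup>L ?M h = integral {0..t} h" if "bmeas t h" for h :: "real \<Rightarrow> real"
    by (rule lebesgue_integral_eq_integral)
      (use bmeas_absolutely_integrable[OF that] in \<open>auto intro: absolutely_integrable_imp_integrable\<close>)
  have cut: "integrable ?M (\<lambda>r. if r \<in> {a..b} then h r else 0)" if "bmeas t h" for h :: "real \<Rightarrow> real" and a b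
  proof -
    obtain C where C: "\<forall>s\<in>{0..t}. norm (h s) \<le> C" "C \<ge> 0" using bmeas_bound[OF \<open>bmeas t h\<close>] by blast
    have [measurable]: "h \<in> borel_measurable ?M" using that by (simp add: bmeas_def)
    show ?thesis
      by (rule M.integrable_const_bound[of _ C]) (use C in \<open>auto intro!: AE_I2\<close>)
  qed
  have L: "(\<integral>r. F s r \<partial>?M) = f s * integral {0..s} g" if "s \<in> {0..t}" for s
  proof -
    have "(\<integral>r. F s r \<partial>?M) = (\<integral>r. f s * (if r \<in> {0..s} then g r else 0) \<partial>?M)"
      by (rule Bochner_Integration.integral_cong) (auto simp: F_def)
    also have "\<dots> = f s * (\<integral>r. (if r \<in> {0..s} then g r else 0) \<partial>?M)" by simp
    also have "(\<integral>r. (if r \<in> {0..s} then g r else 0) \<partial>?M) = integral {0..t} (\<lambda>r. if r \<in> {0..s} then g r else 0)"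
      by (rule lebesgue_integral_eq_integral[OF cut[OF g]]) auto
    also have "\<dots> = integral ({0..s} \<inter> {0..t}) g" by (rule Henstock_Kurzweil_Integration.integral_restrict_Int)
    also have "{0..s} \<inter> {0..t} = {0..s}" using that by auto
    finally show ?thesis .
  qed
  have R: "(\<integral>s. F s r \<partial>?M) = g r * integral {r..t} f" if "r \<in> {0..t}" for r
  proof -
    have "(\<integral>s. F s r \<partial>?M) = (\<integral>s. g r * (if s \<in> {r..t} then f s else 0) \<partial>?M)"
      by (rule Bochner_Integration.integral_cong) (auto simp: F_def)
    also have "\<dots> = g r * (\<integral>s. (if s \<in> {r..t} then f s else 0) \<partial>?M)" by simp
    also have "(\<integral>s. (if s \<in> {r..t} then f s else 0) \<partial>?M) = integral {0..t} (\<lambda>s. if s \<in> {r..t} then f s else 0)"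
      by (rule lebesgue_integral_eq_integral[OF cut[OF f]]) auto
    also have "\<dots> = integral ({r..t} \<inter> {0..t}) f" by (rule Henstock_Kurzweil_Integration.integral_restrict_Int)
    also have "{r..t} \<inter> {0..t} = {r..t}" using that by auto
    finally show ?thesis .
  qed
  have "integral {0..t} (\<lambda>s. f s * integral {0..s} g) = (\<integral>s. f s * integral {0..s} g \<partial>?M)"
    using bmeas_inner[OF f bmeas_integral[OF g]] by (simp add: Hk)
  also have "\<dots> = (\<integral>s. (\<integral>r. F s r \<partial>?M) \<partial>?M)"
    by (rule Bochner_Integration.integral_cong) (auto simp: L)
  also have "\<dots> = (\<integral>r. (\<integral>s. F s r \<partial>?M) \<partial>?M)"
    by (rule MM.Fubini_integral[OF int, symmetric])
  also have "\<dots> = (\<integral>r. g r * integral {r..t} f \<partial>?M)"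
    by (rule Bochner_Integration.integral_cong) (auto simp: R)
  also have "\<dots> = integral {0..t} (\<lambda>s. g s * integral {s..t} f)"
    using bmeas_inner[OF g bmeas_integral'[OF f]] by (simp add: Hk)
  finally show ?thesis .
qed

lemma integral_inner_left: "integral S (\<lambda>s. f s \<bullet> b) = integral S f \<bullet> b"
  if "f integrable_on S" for f :: "real \<Rightarrow> 'a::euclidean_space"
  by (rule integral_unique) (rule has_integral_linear[OF integrable_integral[OF that] bounded_linear_inner_left, unfolded o_def])

lemma Fubini_triangle_inner:
  fixes f g :: "real \<Rightarrow> 'a::euclidean_space"
  assumes f: "bmeas t f" and g: "bmeas t g"
  shows "integral {0..t} (\<lambda>s. f s \<bullet> integral {0..s} g) = integral {0..t} (\<lambda>s. g s \<bullet> integral {s..t} f)"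
proof -
  have comp: "bmeas t (\<lambda>s. h s \<bullet> b)" if "bmeas t h" for h :: "real \<Rightarrow> 'a" and b
    by (intro bmeas_intros that)
  have "integral {0..t} (\<lambda>s. f s \<bullet> integral {0..s} g)
      = integral {0..t} (\<lambda>s. \<Sum>b\<in>Basis. (f s \<bullet> b) * integral {0..s} (\<lambda>r. g r \<bullet> b))"
  proof (rule Henstock_Kurzweil_Integration.integral_cong)
    fix s assume "s \<in> {0..t}"
    then have "g integrable_on {0..s}" by (intro bmeas_integrable[OF g]) auto
    then show "f s \<bullet> integral {0..s} g = (\<Sum>b\<in>Basis. (f s \<bullet> b) * integral {0..s} (\<lambda>r. g r \<bullet> b))"
      by (subst euclidean_inner) (simp add: integral_inner_left)
  qed
  also have "\<dots> = (\<Sum>b\<in>Basis. integral {0..t} (\<lambda>s. (f s \<bullet> b) * integral {0..s} (\<lambda>r. g r \<bullet> b)))"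
  proof (rule integral_sum)
    fix b :: 'a
    have "bmeas t (\<lambda>s. (f s \<bullet> b) \<bullet> integral {0..s} (\<lambda>r. g r \<bullet> b))"
      by (intro bmeas_inner comp f g bmeas_integral)
    then show "(\<lambda>s. (f s \<bullet> b) * integral {0..s} (\<lambda>r. g r \<bullet> b)) integrable_on {0..t}"
      by (intro bmeas_integrable) auto
  qed simp
  also have "\<dots> = (\<Sum>b\<in>Basis. integral {0..t} (\<lambda>s. (g s \<bullet> b) * integral {s..t} (\<lambda>r. f r \<bullet> b)))"
    by (intro sum.cong refl Fubini_triangle_real comp f g)
  also have "\<dots> = integral {0..t} (\<lambda>s. \<Sum>b\<in>Basis. (g s \<bullet> b) * integral {s..t} (\<lambda>r. f r \<bullet> b))"
  proof (rule integral_sum[symmetric])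
    fix b :: 'a
    have "bmeas t (\<lambda>s. (g s \<bullet> b) \<bullet> integral {s..t} (\<lambda>r. f r \<bullet> b))"
      by (intro bmeas_inner comp f g bmeas_integral')
    then show "(\<lambda>s. (g s \<bullet> b) * integral {s..t} (\<lambda>r. f r \<bullet> b)) integrable_on {0..t}"
      by (intro bmeas_integrable) auto
  qed simp
  also have "\<dots> = integral {0..t} (\<lambda>s. g s \<bullet> integral {s..t} f)"
  proof (rule Henstock_Kurzweil_Integration.integral_cong)
    fix s assume "s \<in> {0..t}"
    then have "f integrable_on {s..t}" by (intro bmeas_integrable[OF f]) auto
    then show "(\<Sum>b\<in>Basis. (g s \<bullet> b) * integral {s..t} (\<lambda>r. f r \<bullet> b)) = g s \<bullet> integral {s..t} f"
      by (subst (2) euclidean_inner) (simp add: integral_inner_left)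
  qed
  finally show ?thesis .
qed

text \<open>Weak derivatives and actions are integrated over the open interval, the calculus of
  integrals runs on the closed one; the end points are negligible.\<close>

lemma LINT_Ioo_eq_integral:
  fixes f :: "real \<Rightarrow> 'a::euclidean_space"
  assumes "f absolutely_integrable_on {a..b}"
  shows "(LINT s:{a<..<b}|lebesgue. f s) = integral {a..b} f"
  using assms unfolding absolutely_integrable_on_Icc_iff_Ioo
  by (simp add: set_lebesgue_integral_eq_integral(2) integral_open_interval_real)

lemma test_function_endpoints:
  assumes "test_function t \<phi> \<phi>'"
  shows "\<phi> 0 = 0" "\<phi> t = 0"
  using assms unfolding test_function_def by (metis greaterThanLessThan_iff less_irrefl subset_iff)+

lemma test_function_integral:
  assumes "test_function t \<phi> \<phi>'" "a \<le> b"
  shows "integral {a..b} \<phi>' = \<phi> b - \<phi> a"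
  using assms unfolding test_function_def
  by (intro integral_unique fundamental_theorem_of_calculus)
     (auto simp: has_real_derivative_iff_has_vector_derivative intro: has_vector_derivative_at_within)

text \<open>The weak derivative identity is the triangle Fubini theorem: a test function vanishes at
  both ends, so the constant y contributes nothing, and the integral of \<open>\<phi>'\<close> from
  s to t is \<open>- \<phi> s\<close>.\<close>

lemma W11_integral_curve:
  fixes v :: "real \<Rightarrow> 'a::euclidean_space"
  assumes v: "bmeas t v"
  shows "W11 t (\<lambda>s. y + integral {0..s} v) v"
  unfolding W11_def
proof (intro conjI allI impI)
  show "continuous_on {0..t} (\<lambda>s. y + integral {0..s} v)"
    by (intro continuous_intros indefinite_integral_continuous_1 bmeas_integrable[OF v]) auto
  show "set_integrable lebesgue {0<..<t} v"
    using bmeas_absolutely_integrable[OF v] by (simp add: absolutely_integrable_on_Icc_iff_Ioo)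
  fix \<phi> \<phi>' assume tf: "test_function t \<phi> \<phi>'"
  have \<phi>'c: "bmeas t \<phi>'"
    using tf by (auto simp: test_function_def intro: bmeas_continuous continuous_on_subset)
  have "continuous_on UNIV \<phi>"
    using tf by (auto simp: test_function_def intro!: continuous_at_imp_continuous_on DERIV_isCont)
  then have \<phi>c: "bmeas t \<phi>" by (auto intro: bmeas_continuous continuous_on_subset)
  have \<xi>: "bmeas t (\<lambda>s. y + integral {0..s} v)"
    by (intro bmeas_intros bmeas_integral v)
  have i1: "bmeas t (\<lambda>s. \<phi>' s *\<^sub>R (y + integral {0..s} v))" by (intro bmeas_intros \<xi> \<phi>'c)
  have i2: "bmeas t (\<lambda>s. \<phi> s *\<^sub>R v s)" by (intro bmeas_intros v \<phi>c)
  have "integral {0..t} (\<lambda>s. \<phi>' s *\<^sub>R (y + integral {0..s} v)) = - integral {0..t} (\<lambda>s. \<phi> s *\<^sub>R v s)"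
  proof (cases "0 \<le> t")
    case True
    show ?thesis
    proof (rule euclidean_eqI)
      fix b :: 'a
      have vb: "bmeas t (\<lambda>s. v s \<bullet> b)" by (intro bmeas_intros v)
      have "integral {0..t} (\<lambda>s. \<phi>' s *\<^sub>R (y + integral {0..s} v)) \<bullet> b
          = integral {0..t} (\<lambda>s. \<phi>' s * (y \<bullet> b) + \<phi>' s * integral {0..s} (\<lambda>r. v r \<bullet> b))"
        unfolding integral_inner_left[OF bmeas_integrable[OF i1 order_refl order_refl], symmetric]
      proof (rule Henstock_Kurzweil_Integration.integral_cong)
        fix s assume "s \<in> {0..t}"
        then have "integral {0..s} v \<bullet> b = integral {0..s} (\<lambda>r. v r \<bullet> b)"
          by (intro integral_inner_left[symmetric] bmeas_integrable[OF v]) auto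
        then show "\<phi>' s *\<^sub>R (y + integral {0..s} v) \<bullet> b = \<phi>' s * (y \<bullet> b) + \<phi>' s * integral {0..s} (\<lambda>r. v r \<bullet> b)"
          by (simp add: inner_add_left distrib_left)
      qed
      also have "\<dots> = integral {0..t} (\<lambda>s. \<phi>' s * (y \<bullet> b)) + integral {0..t} (\<lambda>s. \<phi>' s * integral {0..s} (\<lambda>r. v r \<bullet> b))"
        using bmeas_inner[OF \<phi>'c bmeas_const[of t "y \<bullet> b"]] bmeas_inner[OF \<phi>'c bmeas_integral[OF vb]]
        by (intro integral_add) (auto intro!: bmeas_integrable)
      also have "integral {0..t} (\<lambda>s. \<phi>' s * (y \<bullet> b)) = 0"
        using test_function_integral[OF tf True] test_function_endpoints[OF tf] by simp
      also have "integral {0..t} (\<lambda>s. \<phi>' s * integral {0..s} (\<lambda>r. v r \<bullet> b))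
          = integral {0..t} (\<lambda>s. (v s \<bullet> b) * integral {s..t} \<phi>')"
        by (rule Fubini_triangle_real[OF \<phi>'c vb])
      also have "\<dots> = integral {0..t} (\<lambda>s. - (\<phi> s *\<^sub>R v s \<bullet> b))"
        using test_function_integral[OF tf] test_function_endpoints[OF tf]
        by (intro Henstock_Kurzweil_Integration.integral_cong) auto
      also have "\<dots> = - integral {0..t} (\<lambda>s. \<phi> s *\<^sub>R v s) \<bullet> b"
        by (simp add: integral_inner_left[OF bmeas_integrable[OF i2], symmetric])
      finally show "integral {0..t} (\<lambda>s. \<phi>' s *\<^sub>R (y + integral {0..s} v)) \<bullet> b = - integral {0..t} (\<lambda>s. \<phi> s *\<^sub>R v s) \<bullet> b"
        by simp
    qed
  qed simp
  then show "(LINT s:{0<..<t}|lebesgue. \<phi>' s *\<^sub>R (y + integral {0..s} v)) = - (LINT s:{0<..<t}|lebesgue. \<phi> s *\<^sub>R v s)"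
    using i1 i2 by (simp add: LINT_Ioo_eq_integral bmeas_absolutely_integrable)
qed

section \<open>Sobolev curves as integrals of their weak derivative\<close>

lemma DERIV_max_square: "((\<lambda>u. (max 0 u)\<^sup>2) has_real_derivative 2 * max 0 u) (at u)" for u :: real
proof -
  consider "u < 0" | "u = 0" | "u > 0" by linarith
  then show ?thesis
  proof cases
    case 1
    have "((\<lambda>u. 0) has_real_derivative 0) (at u)" by simp
    then have "((\<lambda>u. (max 0 u)\<^sup>2) has_real_derivative 0) (at u)"
      by (rule has_field_derivative_transform_within_open[of _ _ _ "{..<0}"]) (use 1 in auto)
    then show ?thesis using 1 by simp
  next
    case 2
    have "((\<lambda>h. ((max 0 (0 + h))\<^sup>2 - (max 0 0)\<^sup>2) / h) \<longlongrightarrow> 0) (at (0::real))"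
    proof (rule Lim_null_comparison)
      show "\<forall>\<^sub>F h in at 0. norm (((max 0 (0 + h))\<^sup>2 - (max 0 0)\<^sup>2) / h) \<le> \<bar>h\<bar>" for h :: real
        by (rule always_eventually) (auto simp: max_def power2_eq_square)
      show "((\<lambda>h. \<bar>h\<bar>) \<longlongrightarrow> 0) (at (0::real))" by (auto intro!: tendsto_eq_intros)
    qed
    then show ?thesis using 2 by (simp add: DERIV_def)
  next
    case 3
    have "((\<lambda>u. u\<^sup>2) has_real_derivative 2 * u) (at u)" by (auto intro!: derivative_eq_intros)
    then have "((\<lambda>u. (max 0 u)\<^sup>2) has_real_derivative 2 * u) (at u)"
      by (rule has_field_derivative_transform_within_open[of _ _ _ "{0<..}"]) (use 3 in auto)
    then show ?thesis using 3 by simp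
  qed
qed

text \<open>\<open>step\<close> is a \<open>C\<^sup>1\<close> transition from 0 to 1 on the unit interval and \<open>tent\<close> is its derivative.\<close>

definition step :: "real \<Rightarrow> real" where
  "step u = 2 * (max 0 u)\<^sup>2 - 4 * (max 0 (u - 1/2))\<^sup>2 + 2 * (max 0 (u - 1))\<^sup>2"

definition tent :: "real \<Rightarrow> real" where
  "tent u = 4 * max 0 u - 8 * max 0 (u - 1/2) + 4 * max 0 (u - 1)"

lemma DERIV_step [derivative_intros]:
  "(f has_real_derivative D) (at s) \<Longrightarrow> ((\<lambda>s. step (f s)) has_real_derivative tent (f s) * D) (at s)"
proof -
  have "(step has_real_derivative tent u) (at u)" for u
  proof -
    have *: "((\<lambda>u. (max 0 (u - c))\<^sup>2) has_real_derivative 2 * max 0 (u - c)) (at u)" for c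
    proof -
      have "((\<lambda>u. u - c) has_real_derivative 1) (at u)" by (auto intro!: derivative_eq_intros)
      from DERIV_chain2[OF DERIV_max_square this] show ?thesis by simp
    qed
    show ?thesis unfolding step_def[abs_def] tent_def
      using DERIV_add[OF DERIV_diff[OF DERIV_cmult[OF *[of 0], of 2] DERIV_cmult[OF *[of "1/2"], of 4]]
          DERIV_cmult[OF *[of 1], of 2]] by simp
  qed
  then show "(f has_real_derivative D) (at s) \<Longrightarrow> ((\<lambda>s. step (f s)) has_real_derivative tent (f s) * D) (at s)"
    by (rule DERIV_chain2)
qed

lemma step_eq: "u \<le> 0 \<Longrightarrow> step u = 0" "u \<ge> 1 \<Longrightarrow> step u = 1"
  by (auto simp: step_def max_def power2_eq_square algebra_simps)

lemma step_bound: "\<bar>step u\<bar> \<le> 3"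
proof -
  consider "u \<le> 0" | "u \<ge> 1" | "0 < u" "u < 1" by linarith
  then show ?thesis
  proof cases
    case 3
    define A B where "A = (max 0 u)\<^sup>2" and "B = (max 0 (u - 1/2))\<^sup>2"
    have "0 \<le> A" "0 \<le> B" by (simp_all add: A_def B_def)
    moreover have "A \<le> 1" "B \<le> 1 / 4"
      using 3 power_mono[of "max 0 u" 1 2] power_mono[of "max 0 (u - 1/2)" "1/2" 2]
      by (auto simp: A_def B_def max_def power_divide)
    moreover have "step u = 2 * A - 4 * B"
      using 3 by (simp add: step_def A_def B_def)
    ultimately show ?thesis by linarith
  qed (auto simp: step_eq)
qed

lemma tent_nonneg: "0 \<le> tent u" and tent_eq: "u \<le> 0 \<or> 1 \<le> u \<Longrightarrow> tent u = 0"
  by (auto simp: tent_def max_def)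

lemma tent_continuous: "continuous_on S tent"
  unfolding tent_def by (intro continuous_intros)

lemma tent_kernel_integral:
  assumes "a \<le> b" shows "integral {a..b} (\<lambda>s. n * tent ((s - c) * n)) = step ((b - c) * n) - step ((a - c) * n)"
proof (rule integral_unique, rule fundamental_theorem_of_calculus[OF assms])
  fix s
  have "((\<lambda>s. step ((s - c) * n)) has_real_derivative n * tent ((s - c) * n)) (at s)"
    by (auto intro!: derivative_eq_intros)
  then show "((\<lambda>s. step ((s - c) * n)) has_vector_derivative n * tent ((s - c) * n)) (at s within {a..b})"
    by (simp add: has_real_derivative_iff_has_vector_derivative has_vector_derivative_at_within)
qed

text \<open>The kernel has unit mass and lives on the interval of length 1 / n to the right of
  a.\<close>

lemma tent_approximate_identity:
  fixes \<xi> :: "real \<Rightarrow> 'a::euclidean_space"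
  assumes \<xi>: "continuous_on {0..t} \<xi>" and a: "0 \<le> a" "a < t"
  shows "(\<lambda>n. integral {0..t} (\<lambda>s. (real n * tent ((s - a) * real n)) *\<^sub>R \<xi> s)) \<longlonglongrightarrow> \<xi> a"
proof (rule LIMSEQ_I)
  fix e :: real assume e: "e > 0"
  obtain d where d: "d > 0" "\<And>s. s \<in> {0..t} \<Longrightarrow> dist s a < d \<Longrightarrow> dist (\<xi> s) (\<xi> a) < e / 2"
    using \<xi> a e unfolding continuous_on_iff by (metis atLeastAtMost_iff half_gt_zero less_imp_le)
  \<comment> \<open>From N on, 1 / n is below both d and t - a: the whole mass lies inside the
    interval, where \<xi> is e / 2-close to its value at a.\<close>
  obtain N :: nat where N: "N > 1 / min d (t - a)" using reals_Archimedean2 by blast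
  have "norm (integral {0..t} (\<lambda>s. (real n * tent ((s - a) * real n)) *\<^sub>R \<xi> s) - \<xi> a) < e" if "n \<ge> N" for n
  proof -
    have m: "min d (t - a) > 0" using d a by simp
    have "n > 1 / min d (t - a)" using N that by linarith
    then have n: "min d (t - a) * n > 1" using m by (simp add: field_simps)
    have n0: "real n > 0" using n m by (cases "n = 0") auto
    have nd: "d * n > 1" "(t - a) * n > 1"
      using n n0 by (auto intro: less_le_trans[OF _ mult_right_mono])
    define k where "k = (\<lambda>s. real n * tent ((s - a) * real n))"
    have kc: "continuous_on {0..t} k" unfolding k_def
      by (intro continuous_intros continuous_on_compose2[OF tent_continuous]) auto
    have k1: "integral {0..t} k = 1"
      unfolding k_def using a nd n0 by (subst tent_kernel_integral) (auto simp: step_eq mult_le_0_iff)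
    have "integral {0..t} (\<lambda>s. k s *\<^sub>R \<xi> s) - \<xi> a = integral {0..t} (\<lambda>s. k s *\<^sub>R \<xi> s) - integral {0..t} (\<lambda>s. k s *\<^sub>R \<xi> a)"
      using k1 integral_unique[OF has_integral_scaleR_left[OF integrable_integral[OF integrable_continuous_real[OF kc]]], of "\<xi> a"]
      by simp
    also have "\<dots> = integral {0..t} (\<lambda>s. k s *\<^sub>R \<xi> s - k s *\<^sub>R \<xi> a)"
      by (rule integral_diff[symmetric]) (auto intro!: integrable_continuous_real continuous_intros kc \<xi>)
    also have "norm \<dots> \<le> integral {0..t} (\<lambda>s. k s * (e / 2))"
    proof (rule integral_norm_bound_integral)
      fix s assume s: "s \<in> {0..t}"
      have k0: "k s \<ge> 0" unfolding k_def using tent_nonneg by simp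
      show "norm (k s *\<^sub>R \<xi> s - k s *\<^sub>R \<xi> a) \<le> k s * (e / 2)"
      proof (cases "dist s a < d")
        case True
        then have "norm (\<xi> s - \<xi> a) \<le> e / 2" using d(2)[OF s True] by (simp add: dist_norm)
        have "norm (k s *\<^sub>R \<xi> s - k s *\<^sub>R \<xi> a) = k s * norm (\<xi> s - \<xi> a)"
          using k0 by (simp flip: scaleR_diff_right)
        also have "\<dots> \<le> k s * (e / 2)" by (rule mult_left_mono) fact+
        finally show ?thesis .
      next
        case False
        have "(s - a) * n \<le> 0 \<or> 1 \<le> (s - a) * n"
        proof (cases "s \<le> a")
          case True then show ?thesis using n0 by (simp add: mult_le_0_iff)
        next
          case s: False
          then have "d * n \<le> (s - a) * n" using False n0 by (intro mult_right_mono) (auto simp: dist_real_def)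
          then show ?thesis using nd by linarith
        qed
        then have "k s = 0" unfolding k_def by (simp add: tent_eq)
        then show ?thesis by simp
      qed
    qed (auto intro!: integrable_continuous_real continuous_intros kc \<xi>)
    also have "\<dots> = e / 2" using k1 by simp
    finally show ?thesis using e unfolding k_def by simp
  qed
  then show "\<exists>N. \<forall>n\<ge>N. norm (integral {0..t} (\<lambda>s. (real n * tent ((s - a) * real n)) *\<^sub>R \<xi> s) - \<xi> a) < e"
    by blast
qed

text \<open>Test with C1 approximations of the indicator of (a, b]. Their derivatives are
  differences of approximate identities and tend to \<open>\<xi> a - \<xi> b\<close>; the other side
  converges by domination with \<open>6 * norm (v s)\<close>.\<close>

lemma W11_increment:
  fixes v :: "real \<Rightarrow> 'a::euclidean_space"
  assumes W: "W11 t \<xi> v" and ab: "0 < a" "a < b" "b < t"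
  shows "\<xi> b - \<xi> a = integral {a..b} v"
proof -
  have \<xi>: "continuous_on {0..t} \<xi>" and v: "v absolutely_integrable_on {0..t}"
    using W by (auto simp: W11_def absolutely_integrable_on_Icc_iff_Ioo)
  define \<phi> where "\<phi> = (\<lambda>n s. step ((s - a) * real n) - step ((s - b) * real n))"
  define \<phi>' where "\<phi>' = (\<lambda>n s. real n * tent ((s - a) * real n) - real n * tent ((s - b) * real n))"
  have \<phi>c: "continuous_on S (\<phi> n)" for S n
  proof (rule continuous_at_imp_continuous_on, rule ballI)
    fix s show "isCont (\<phi> n) s" unfolding \<phi>_def
      by (rule DERIV_isCont) (auto intro!: derivative_eq_intros)
  qed
  have \<phi>'c: "continuous_on S (\<phi>' n)" for S n unfolding \<phi>'_def
    by (intro continuous_intros continuous_on_compose2[OF tent_continuous]) auto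
  have \<phi>b: "\<bar>\<phi> n s\<bar> \<le> 6" for n s
    using step_bound[of "(s - a) * real n"] step_bound[of "(s - b) * real n"] unfolding \<phi>_def by linarith
  have vm: "v \<in> borel_measurable (lebesgue_on {0..t})"
    using v by (rule absolutely_integrable_imp_borel_measurable) auto
  have nv: "(\<lambda>s. 6 * norm (v s)) integrable_on {0..t}"
    using v by (auto simp: absolutely_integrable_on_def)
  have \<phi>v: "(\<lambda>s. \<phi> n s *\<^sub>R v s) absolutely_integrable_on {0..t}" for n
  proof (rule measurable_bounded_by_integrable_imp_absolutely_integrable[OF _ _ nv])
    have "\<phi> n \<in> borel_measurable (lebesgue_on {0..t})"
      by (rule continuous_imp_measurable_on_sets_lebesgue[OF \<phi>c]) auto
    then show "(\<lambda>s. \<phi> n s *\<^sub>R v s) \<in> borel_measurable (lebesgue_on {0..t})"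
      using vm by simp
    show "norm (\<phi> n s *\<^sub>R v s) \<le> 6 * norm (v s)" for s using \<phi>b[of n s] by (simp add: mult_right_mono)
  qed auto
  \<comment> \<open>The condition on n keeps the support, contained in [a, b + 1 / n], inside the
    open interval (0, t).\<close>
  have key: "integral {0..t} (\<lambda>s. \<phi>' n s *\<^sub>R \<xi> s) = - integral {0..t} (\<lambda>s. \<phi> n s *\<^sub>R v s)" if n: "real n > 1 / (t - b)" for n
  proof -
    have n0: "real n > 0" using n ab by (meson diff_gt_0_iff_gt order.strict_trans zero_less_divide_1_iff)
    have nb: "b + 1 / n < t" using n n0 ab by (simp add: field_simps)
    have "test_function t (\<phi> n) (\<phi>' n)"
      unfolding test_function_def
    proof (intro conjI exI[of _ "{a..b + 1/n}"] allI impI)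
      show "(\<phi> n has_real_derivative \<phi>' n s) (at s)" for s
        unfolding \<phi>_def \<phi>'_def by (auto intro!: derivative_eq_intros)
      show "{a..b + 1 / real n} \<subseteq> {0<..<t}" using ab nb by auto
      fix s assume "s \<notin> {a..b + 1 / real n}"
      then consider "s < a" | "s > b + 1 / n" by fastforce
      then show "\<phi> n s = 0"
      proof cases
        case 1
        then have "(s - a) * n \<le> 0" "(s - b) * n \<le> 0" using n0 ab by (auto simp: mult_le_0_iff)
        then show ?thesis by (simp add: \<phi>_def step_eq)
      next
        case 2
        then have "(s - b) * n \<ge> 1" using n0 by (simp add: field_simps)
        moreover have "(s - b) * n \<le> (s - a) * n" using n0 ab by (intro mult_right_mono) auto
        ultimately show ?thesis by (simp add: \<phi>_def step_eq)
      qed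
    qed (auto intro: \<phi>'c)
    then have "(LINT s:{0<..<t}|lebesgue. \<phi>' n s *\<^sub>R \<xi> s) = - (LINT s:{0<..<t}|lebesgue. \<phi> n s *\<^sub>R v s)"
      using W unfolding W11_def by blast
    moreover have "(\<lambda>s. \<phi>' n s *\<^sub>R \<xi> s) absolutely_integrable_on {0..t}"
      by (intro bmeas_absolutely_integrable bmeas_continuous continuous_intros \<phi>'c \<xi>)
    ultimately show ?thesis using \<phi>v by (simp add: LINT_Ioo_eq_integral)
  qed
  have A: "(\<lambda>n. integral {0..t} (\<lambda>s. \<phi>' n s *\<^sub>R \<xi> s)) \<longlonglongrightarrow> \<xi> a - \<xi> b"
  proof -
    have "integral {0..t} (\<lambda>s. \<phi>' n s *\<^sub>R \<xi> s) = integral {0..t} (\<lambda>s. (real n * tent ((s - a) * real n)) *\<^sub>R \<xi> s)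
        - integral {0..t} (\<lambda>s. (real n * tent ((s - b) * real n)) *\<^sub>R \<xi> s)" for n
      unfolding \<phi>'_def scaleR_diff_left
      by (intro integral_diff integrable_continuous_real continuous_intros continuous_on_compose2[OF tent_continuous] \<xi>) auto
    then show ?thesis
      using tent_approximate_identity[OF \<xi>, of a] tent_approximate_identity[OF \<xi>, of b] ab
      by (auto intro!: tendsto_diff)
  qed
  have B: "(\<lambda>n. integral {0..t} (\<lambda>s. \<phi> n s *\<^sub>R v s)) \<longlonglongrightarrow> integral {0..t} (\<lambda>s. if s \<in> {a<..b} then v s else 0)"
  proof (rule dominated_convergence(2)[OF _ nv])
    show "(\<lambda>s. \<phi> n s *\<^sub>R v s) integrable_on {0..t}" for n
      using \<phi>v set_lebesgue_integral_eq_integral(1) by blast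
    show "norm (\<phi> n s *\<^sub>R v s) \<le> 6 * norm (v s)" for n s using \<phi>b[of n s] by (simp add: mult_right_mono)
    fix s
    have lim: "(\<lambda>n. step ((s - c) * real n)) \<longlonglongrightarrow> (if c < s then 1 else 0)" for c
    proof (cases "c < s")
      case True
      obtain N :: nat where N: "N > 1 / (s - c)" using reals_Archimedean2 by blast
      have "step ((s - c) * real n) = 1" if "n \<ge> N" for n
      proof -
        have "real n > 1 / (s - c)" using N that by linarith
        then show ?thesis using True by (intro step_eq) (simp add: field_simps)
      qed
      then show ?thesis using True by (auto intro!: tendsto_eventually eventually_sequentiallyI[of N])
    next
      case False
      then have "step ((s - c) * real n) = 0" for n by (intro step_eq) (simp add: mult_le_0_iff)
      then show ?thesis using False by simp
    qed
    have "(\<lambda>n. \<phi> n s) \<longlonglongrightarrow> (if s \<in> {a<..b} then 1 else 0)"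
      using tendsto_diff[OF lim[of a] lim[of b]] ab unfolding \<phi>_def by (auto split: if_splits)
    from tendsto_scaleR[OF this tendsto_const[of "v s"]]
    show "(\<lambda>n. \<phi> n s *\<^sub>R v s) \<longlonglongrightarrow> (if s \<in> {a<..b} then v s else 0)" by (auto split: if_splits)
  qed
  have C: "integral {0..t} (\<lambda>s. if s \<in> {a<..b} then v s else 0) = integral {a..b} v"
  proof -
    have "integral {0..t} (\<lambda>s. if s \<in> {a<..b} then v s else 0) = integral ({a<..b} \<inter> {0..t}) v"
      by (rule Henstock_Kurzweil_Integration.integral_restrict_Int)
    also have "{a<..b} \<inter> {0..t} = {a<..b}" using ab by auto
    also have "integral {a<..b} v = integral {a..b} v"
      by (rule integral_spike_set) (auto intro: negligible_subset[of "{a}"])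
    finally show ?thesis .
  qed
  have D: "\<forall>\<^sub>F n in sequentially. integral {0..t} (\<lambda>s. \<phi>' n s *\<^sub>R \<xi> s) = - integral {0..t} (\<lambda>s. \<phi> n s *\<^sub>R v s)"
    using eventually_gt_at_top[of "nat \<lceil>1 / (t - b)\<rceil>"]
    by eventually_elim (rule key, linarith)
  have "(\<lambda>n. integral {0..t} (\<lambda>s. \<phi>' n s *\<^sub>R \<xi> s)) \<longlonglongrightarrow> - integral {a..b} v"
    by (rule iffD2[OF tendsto_cong[OF D]], rule tendsto_minus[OF B[unfolded C]])
  from LIMSEQ_unique[OF A this] have "- (\<xi> a - \<xi> b) = - (- integral {a..b} v)" by (rule arg_cong)
  then show ?thesis by (simp only: minus_diff_eq minus_minus)
qed

text \<open>The difference between \<xi> and the indefinite integral of v is constant on the open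
  interval by \<open>W11_increment\<close>, and continuity carries the constant to both end
  points.\<close>

lemma W11_eq_integral:
  fixes v :: "real \<Rightarrow> 'a::euclidean_space"
  assumes W: "W11 t \<xi> v" and t: "t > 0" and s: "s \<in> {0..t}"
  shows "\<xi> s = \<xi> 0 + integral {0..s} v"
proof -
  have \<xi>: "continuous_on {0..t} \<xi>" and v: "v integrable_on {0..t}"
    using W set_lebesgue_integral_eq_integral(1)[of "{0..t}" v]
    by (auto simp: W11_def absolutely_integrable_on_Icc_iff_Ioo)
  define F where "F = (\<lambda>s. \<xi> s - integral {0..s} v)"
  have F: "continuous_on {0..t} F" unfolding F_def
    by (intro continuous_intros indefinite_integral_continuous_1 \<xi> v)
  have *: "F a = F b" if "0 < a" "a < b" "b < t" for a b
  proof -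
    have "integral {0..a} v + integral {a..b} v = integral {0..b} v"
      by (rule Henstock_Kurzweil_Integration.integral_combine) (use that v in \<open>auto intro: integrable_on_subinterval\<close>)
    then show ?thesis using W11_increment[OF W that] unfolding F_def by (simp add: algebra_simps)
  qed
  have cl: "closure {0<..<t} = {0..t}" using t by simp
  have mid: "F x = F (t / 2)" if "x \<in> {0<..<t}" for x
  proof (cases x "t / 2" rule: linorder_cases)
    case less
    then show ?thesis using that t by (intro *) auto
  next
    case greater
    then have "F (t / 2) = F x" using that t by (intro *) auto
    then show ?thesis by (rule sym)
  qed (rule arg_cong)
  have "F s = F (t / 2)" if "s \<in> {0..t}" for s
    using continuous_constant_on_closure[of "{0<..<t}" F "F (t / 2)" s] F mid that by (simp only: cl)
  from this[of s] this[of 0] have "F s = F 0" using s t by (metis atLeastAtMost_iff less_imp_le order_refl)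
  then show ?thesis by (simp add: F_def diff_eq_eq add.commute)
qed

section \<open>Reduction to curves with bounded velocity\<close>

text \<open>For integrable integrands the extended-real difference in \<open>action\<close> is the
  ordinary integral, so curves of finite cost can be treated by real calculus.\<close>

lemma signed_nn_integral_eq:
  fixes f :: "real \<Rightarrow> real"
  assumes "set_integrable lebesgue A f"
  shows "enn2ereal (\<integral>\<^sup>+s\<in>A. ennreal (f s) \<partial>lebesgue) - enn2ereal (\<integral>\<^sup>+s\<in>A. ennreal (- f s) \<partial>lebesgue)
    = ereal (LINT s:A|lebesgue. f s)"
proof -
  let ?g = "\<lambda>s. indicat_real A s *\<^sub>R f s"
  have eq: "(\<integral>\<^sup>+s\<in>A. ennreal (f s) \<partial>lebesgue) = (\<integral>\<^sup>+s. ennreal (?g s) \<partial>lebesgue)"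
    "(\<integral>\<^sup>+s\<in>A. ennreal (- f s) \<partial>lebesgue) = (\<integral>\<^sup>+s. ennreal (- ?g s) \<partial>lebesgue)"
    by (auto intro!: nn_integral_cong simp: indicator_def)
  have g: "integrable lebesgue ?g" using assms by (simp add: set_integrable_def)
  then have fin: "(\<integral>\<^sup>+s. ennreal (?g s) \<partial>lebesgue) \<noteq> \<infinity>" "(\<integral>\<^sup>+s. ennreal (- ?g s) \<partial>lebesgue) \<noteq> \<infinity>"
    by (auto simp: real_integrable_def)
  obtain a where a: "(\<integral>\<^sup>+s. ennreal (?g s) \<partial>lebesgue) = ennreal a" "0 \<le> a"
    using fin(1) by (cases "\<integral>\<^sup>+s. ennreal (?g s) \<partial>lebesgue") auto
  obtain b where b: "(\<integral>\<^sup>+s. ennreal (- ?g s) \<partial>lebesgue) = ennreal b" "0 \<le> b"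
    using fin(2) by (cases "\<integral>\<^sup>+s. ennreal (- ?g s) \<partial>lebesgue") auto
  note ab = a b
  have "(LINT s:A|lebesgue. f s) = a - b"
    unfolding set_lebesgue_integral_def using real_lebesgue_integral_def[OF g] ab by simp
  then show ?thesis unfolding eq using ab by (simp add: enn2ereal_ennreal)
qed

text \<open>The lower bound makes the negative part finite on a bounded interval, so a difference
  other than infinity forces the positive part to be finite as well.\<close>

lemma set_integrable_of_signed_nn_integral:
  fixes f :: "real \<Rightarrow> real"
  assumes f: "f \<in> borel_measurable (lebesgue_on {a<..<b})" and lower: "\<And>s. - C \<le> f s" and C: "0 \<le> C"
    and fin: "enn2ereal (\<integral>\<^sup>+s\<in>{a<..<b}. ennreal (f s) \<partial>lebesgue) - enn2ereal (\<integral>\<^sup>+s\<in>{a<..<b}. ennreal (- f s) \<partial>lebesgue) \<noteq> \<infinity>"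
  shows "set_integrable lebesgue {a<..<b} f"
proof -
  let ?A = "{a<..<b}"
  let ?g = "\<lambda>s. indicat_real ?A s *\<^sub>R f s"
  have eq: "(\<integral>\<^sup>+s\<in>?A. ennreal (f s) \<partial>lebesgue) = (\<integral>\<^sup>+s. ennreal (?g s) \<partial>lebesgue)"
    "(\<integral>\<^sup>+s\<in>?A. ennreal (- f s) \<partial>lebesgue) = (\<integral>\<^sup>+s. ennreal (- ?g s) \<partial>lebesgue)"
    by (auto intro!: nn_integral_cong simp: indicator_def)
  have "(\<integral>\<^sup>+s\<in>?A. ennreal (- f s) \<partial>lebesgue) \<le> (\<integral>\<^sup>+s\<in>?A. ennreal C \<partial>lebesgue)"
    using lower by (intro nn_integral_mono) (auto simp: indicator_def minus_le_iff intro!: ennreal_leI)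
  also have "\<dots> = ennreal C * emeasure lebesgue ?A" by (rule nn_integral_cmult_indicator) auto
  also have "\<dots> < \<infinity>" using bounded_set_imp_lmeasurable[of ?A] by (auto simp: ennreal_mult_less_top emeasure_lborel_Ioo fmeasurable_def)
  finally have neg: "(\<integral>\<^sup>+s\<in>?A. ennreal (- f s) \<partial>lebesgue) \<noteq> \<infinity>" by simp
  have pos: "(\<integral>\<^sup>+s\<in>?A. ennreal (f s) \<partial>lebesgue) \<noteq> \<infinity>"
  proof
    assume *: "(\<integral>\<^sup>+s\<in>?A. ennreal (f s) \<partial>lebesgue) = \<infinity>"
    obtain r where r: "(\<integral>\<^sup>+s\<in>?A. ennreal (- f s) \<partial>lebesgue) = ennreal r" "0 \<le> r"
      using neg by (cases "\<integral>\<^sup>+s\<in>?A. ennreal (- f s) \<partial>lebesgue") auto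
    show False using fin unfolding * r using r(2) by (simp add: enn2ereal_ennreal)
  qed
  have "?g \<in> borel_measurable lebesgue"
    using f by (subst (asm) borel_measurable_restrict_space_iff) auto
  then show ?thesis
    using pos neg unfolding eq set_integrable_def real_integrable_def by simp
qed

context hamiltonian
begin

text \<open>The cost is parametrised by starting point and velocity instead of the curve:
  translating a curve or varying its velocity with a free end point is then just a change of
  arguments.\<close>

definition J :: "real \<Rightarrow> (real^'n \<Rightarrow> real) \<Rightarrow> real^'n \<Rightarrow> (real \<Rightarrow> real^'n) \<Rightarrow> real" where
  "J t u y v = integral {0..t} (\<lambda>s. L (y + integral {0..s} v) (v s)) + u y"

text \<open>The level c is an absolute cost and not an excess over the infimum, so that a
  near-minimiser of one problem can be reread as a near-minimiser of another.\<close>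

definition near_min :: "real \<Rightarrow> (real^'n \<Rightarrow> real) \<Rightarrow> real \<Rightarrow> real^'n \<Rightarrow> real \<Rightarrow> real^'n \<Rightarrow> (real \<Rightarrow> real^'n) \<Rightarrow> bool" where
  "near_min t u M x c y v \<longleftrightarrow> bmeas t v \<and> (\<forall>s. norm (v s) \<le> M) \<and> y + integral {0..t} v = x \<and> J t u y v \<le> c"

lemma near_min_mono: "near_min t u M x c y v \<Longrightarrow> c \<le> c' \<Longrightarrow> near_min t u M x c' y v"
  by (auto simp: near_min_def)

lemma near_min_displacement:
  assumes "near_min t u M x c y v" "t > 0"
  shows "norm (y - x) \<le> M * t"
proof -
  have v: "bmeas t v" "\<forall>s. norm (v s) \<le> M" "y + integral {0..t} v = x"
    using assms(1) by (auto simp: near_min_def)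
  have "norm (integral {0..t} v) \<le> integral {0..t} (\<lambda>s. M)"
    using v by (intro integral_norm_bound_integral bmeas_integrable[OF v(1)]) auto
  then have "norm (integral {0..t} v) \<le> M * t" using assms(2) by (simp add: mult.commute)
  moreover have "y - x = - integral {0..t} v" using v(3) by (auto simp: algebra_simps)
  ultimately show ?thesis by simp
qed

lemma bmeas_L: "bmeas t f \<Longrightarrow> bmeas t g \<Longrightarrow> bmeas t (\<lambda>s. L (f s) (g s))"
  using L_continuous by (intro bmeas_compose2[of L]) (auto simp: case_prod_unfold)

lemma bmeas_P: "bmeas t f \<Longrightarrow> bmeas t g \<Longrightarrow> bmeas t (\<lambda>s. P (f s) (g s))"
  using P_continuous by (intro bmeas_compose2[of P]) (auto simp: case_prod_unfold)

lemma action_bmeas: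
  assumes v: "bmeas t v"
  shows "action H t (\<lambda>s. y + integral {0..s} v) v + ereal (u y) = ereal (J t u y v)"
proof -
  have "bmeas t (\<lambda>s. L (y + integral {0..s} v) (v s))"
    by (intro bmeas_L bmeas_intros bmeas_integral v)
  then have "(\<lambda>s. L (y + integral {0..s} v) (v s)) absolutely_integrable_on {0..t}"
    by (rule bmeas_absolutely_integrable)
  then show ?thesis
    unfolding action_def J_def
    by (subst signed_nn_integral_eq) (simp_all add: LINT_Ioo_eq_integral absolutely_integrable_on_Icc_iff_Ioo[symmetric])
qed

lemma action_integrable:
  assumes W: "W11 t \<xi> v" and fin: "action H t \<xi> v \<noteq> \<infinity>"
  shows "(\<lambda>s. L (\<xi> s) (v s)) absolutely_integrable_on {0..t}"
    "action H t \<xi> v = ereal (integral {0..t} (\<lambda>s. L (\<xi> s) (v s)))"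
proof -
  let ?A = "{0<..<t}"
  have "\<xi> \<in> borel_measurable (lebesgue_on ?A)"
    using W unfolding W11_def
    by (intro continuous_imp_measurable_on_sets_lebesgue) (auto intro: continuous_on_subset)
  moreover have "v \<in> borel_measurable (lebesgue_on ?A)"
    using W unfolding W11_def by (intro absolutely_integrable_imp_borel_measurable) auto
  ultimately have "(\<lambda>s. (\<xi> s, v s)) \<in> borel_measurable (lebesgue_on ?A)" by measurable
  from measurable_compose[OF this borel_measurable_continuous_onI[OF L_continuous]]
  have m: "(\<lambda>s. L (\<xi> s) (v s)) \<in> borel_measurable (lebesgue_on ?A)" by simp
  have "set_integrable lebesgue ?A (\<lambda>s. L (\<xi> s) (v s))"
    by (rule set_integrable_of_signed_nn_integral[OF m L_lower C0_nonneg]) (use fin in \<open>simp add: action_def\<close>)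
  then show i: "(\<lambda>s. L (\<xi> s) (v s)) absolutely_integrable_on {0..t}"
    by (simp add: absolutely_integrable_on_Icc_iff_Ioo)
  then show "action H t \<xi> v = ereal (integral {0..t} (\<lambda>s. L (\<xi> s) (v s)))"
    unfolding action_def
    by (subst signed_nn_integral_eq) (simp_all add: LINT_Ioo_eq_integral absolutely_integrable_on_Icc_iff_Ioo[symmetric])
qed

text \<open>Cutting off large velocities (keeping the endpoint) does not increase the cost: the
  superlinear growth of the Lagrangian pays for the displacement of the curve and of its starting point.\<close>

lemma velocity_truncation:
  assumes t: "t > 0" and K: "K \<ge> 0"
  shows "\<exists>M\<ge>0. \<forall>u \<xi> v. K-lipschitz_on UNIV u \<longrightarrow> W11 t \<xi> v \<longrightarrow> action H t \<xi> v \<noteq> \<infinity> \<longrightarrow>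
    (\<exists>y v'. bmeas t v' \<and> (\<forall>s. norm (v' s) \<le> M) \<and> y + integral {0..t} v' = \<xi> t \<and>
       ereal (J t u y v') \<le> action H t \<xi> v + ereal (u (\<xi> 0)))"
proof -
  \<comment> \<open>The price of displacing a curve by one unit: CL along the whole time interval,
    and K for the initial datum.\<close>
  define k where "k = CL * t + K"
  have k: "k \<ge> 0" using t K CL_nonneg by (simp add: k_def)
  obtain C where C: "C \<ge> 0" "\<And>x q. (k + 1) * norm q - C \<le> L x q"
    using L_superlinear[of "k + 1"] k by auto
  \<comment> \<open>Above this threshold, \<open>(k + 1) * norm v - C\<close> exceeds
    \<open>k * norm v + C0\<close>: the Lagrangian at v pays for the displacement and for replacing
    v by velocity 0.\<close>
  define M where "M = C + C0"
  have M: "M \<ge> 0" using C C0_nonneg by (simp add: M_def)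
  have "\<exists>y v'. bmeas t v' \<and> (\<forall>s. norm (v' s) \<le> M) \<and> y + integral {0..t} v' = \<xi> t \<and>
       ereal (J t u y v') \<le> action H t \<xi> v + ereal (u (\<xi> 0))"
    if u: "K-lipschitz_on UNIV u" and W: "W11 t \<xi> v" and fin: "action H t \<xi> v \<noteq> \<infinity>" for u \<xi> v
  proof -
    have v: "v absolutely_integrable_on {0..t}"
      using W by (simp add: W11_def absolutely_integrable_on_Icc_iff_Ioo)
    have vm: "v \<in> borel_measurable (lebesgue_on {0..t})"
      using v by (rule absolutely_integrable_imp_borel_measurable) auto
    define v' where "v' = (\<lambda>s. if norm (v s) \<le> M then v s else 0)"
    \<comment> \<open>The end point is kept, so the removed velocity shifts the starting
      point.\<close>
    define y where "y = \<xi> t - integral {0..t} v'"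
    define \<zeta> where "\<zeta> = (\<lambda>s. y + integral {0..s} v')"
    have v'M: "norm (v' s) \<le> M" for s using M by (simp add: v'_def)
    have v': "bmeas t v'"
      unfolding bmeas_def
    proof
      show "v' \<in> borel_measurable (lebesgue_on {0..t})" unfolding v'_def using vm by measurable
      show "bounded (v' ` {0..t})" using v'M by (auto simp: bounded_iff)
    qed
    have v'i: "v' absolutely_integrable_on {0..t}" by (rule bmeas_absolutely_integrable[OF v'])
    have di: "(\<lambda>s. v s - v' s) absolutely_integrable_on {0..t}" by (rule set_integral_diff(1)[OF v v'i])
    define E where "E = integral {0..t} (\<lambda>s. norm (v s - v' s))"
    have Ei: "(\<lambda>s. norm (v s - v' s)) integrable_on {0..t}"
      using di by (simp add: absolutely_integrable_on_def)
    have vi: "v integrable_on {0..t}" "v' integrable_on {0..t}" "(\<lambda>s. v s - v' s) integrable_on {0..t}"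
      using v v'i di by (simp_all add: absolutely_integrable_on_def)
    have dist: "norm (\<zeta> s - \<xi> s) \<le> E" if s: "s \<in> {0..t}" for s
    proof -
      have sub: "{s..t} \<subseteq> {0..t}" using s by auto
      have c: "integral {0..t} v = integral {0..s} v + integral {s..t} v"
        "integral {0..t} v' = integral {0..s} v' + integral {s..t} v'"
        by (rule Henstock_Kurzweil_Integration.integral_combine[symmetric]; use s vi in auto)+
      have "\<xi> s = \<xi> 0 + integral {0..s} v" "\<xi> t = \<xi> 0 + integral {0..t} v"
        by (rule W11_eq_integral[OF W t]; use s t in auto)+
      then have "\<zeta> s - \<xi> s = \<xi> 0 + integral {0..t} v - integral {0..t} v' + integral {0..s} v' - (\<xi> 0 + integral {0..s} v)"
        by (simp only: \<zeta>_def y_def)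
      also have "\<dots> = integral {s..t} v - integral {s..t} v'"
        unfolding c by simp
      also have "\<dots> = integral {s..t} (\<lambda>s. v s - v' s)"
        by (rule integral_diff[symmetric]; rule integrable_on_subinterval[OF _ sub]; rule vi)
      also have "norm \<dots> \<le> integral {s..t} (\<lambda>s. norm (v s - v' s))"
        by (rule integral_norm_bound_integral) (auto intro: integrable_on_subinterval[OF _ sub] vi Ei)
      also have "\<dots> \<le> E" unfolding E_def
        by (rule integral_subset_le[OF sub]) (auto intro: integrable_on_subinterval[OF _ sub] Ei)
      finally show ?thesis .
    qed
    have E0: "E \<ge> 0" using order_trans[OF norm_ge_zero dist[of 0]] t by simp
    note Li = action_integrable[OF W fin]
    have LI: "(\<lambda>s. L (\<xi> s) (v s)) integrable_on {0..t}" using Li(1) by (simp add: absolutely_integrable_on_def)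
    \<comment> \<open>Integrated over [0, t], the gain k E beats the loss CL E t by exactly K E,
      which then covers the change of the initial datum.\<close>
    have pt: "L (\<zeta> s) (v' s) \<le> L (\<xi> s) (v s) + CL * E - k * norm (v s - v' s)" if s: "s \<in> {0..t}" for s
    proof (cases "norm (v s) \<le> M")
      case True
      have "L (\<zeta> s) (v s) \<le> L (\<xi> s) (v s) + CL * norm (\<zeta> s - \<xi> s)" by (rule L_lipschitz_x)
      also have "CL * norm (\<zeta> s - \<xi> s) \<le> CL * E" using dist[OF s] CL_nonneg by (rule mult_left_mono)
      finally show ?thesis using True by (simp add: v'_def)
    next
      case False
      have "L (\<zeta> s) (v' s) \<le> C0" using L_zero False by (simp add: v'_def)
      moreover have "(k + 1) * norm (v s) - C \<le> L (\<xi> s) (v s)" by (rule C)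
      moreover have "(k + 1) * norm (v s) = k * norm (v s) + norm (v s)" by (simp add: algebra_simps)
      moreover have "0 \<le> CL * E" using CL_nonneg E0 by simp
      ultimately show ?thesis using False by (simp add: v'_def M_def)
    qed
    have "integral {0..t} (\<lambda>s. L (\<zeta> s) (v' s)) \<le> integral {0..t} (\<lambda>s. L (\<xi> s) (v s) + CL * E - k * norm (v s - v' s))"
    proof (rule integral_le)
      show "(\<lambda>s. L (\<zeta> s) (v' s)) integrable_on {0..t}"
        unfolding \<zeta>_def by (intro bmeas_integrable[of t] bmeas_L bmeas_intros bmeas_integral v') auto
      show "(\<lambda>s. L (\<xi> s) (v s) + CL * E - k * norm (v s - v' s)) integrable_on {0..t}"
        using integrable_on_cmult_left[OF Ei, of k] by (intro integrable_diff integrable_add LI integrable_const_ivl) simp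
    qed (rule pt)
    also have "\<dots> = integral {0..t} (\<lambda>s. L (\<xi> s) (v s)) + CL * E * t - k * E"
      using t integrable_on_cmult_left[OF Ei, of k]
      by (simp add: integral_diff integral_add LI integrable_const_ivl integrable_add E_def mult.commute)
    finally have 1: "integral {0..t} (\<lambda>s. L (\<zeta> s) (v' s)) \<le> integral {0..t} (\<lambda>s. L (\<xi> s) (v s)) - K * E"
      by (simp add: k_def algebra_simps)
    have "\<bar>u y - u (\<xi> 0)\<bar> \<le> K * norm (y - \<xi> 0)"
      using lipschitz_onD[OF u, of y "\<xi> 0"] by (simp add: dist_norm)
    also have "\<dots> \<le> K * E" using dist[of 0] t K by (intro mult_left_mono) (auto simp: \<zeta>_def)
    finally have "J t u y v' \<le> integral {0..t} (\<lambda>s. L (\<xi> s) (v s)) + u (\<xi> 0)"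
      using 1 unfolding J_def \<zeta>_def by linarith
    then have "ereal (J t u y v') \<le> action H t \<xi> v + ereal (u (\<xi> 0))" using Li(2) by simp
    then show ?thesis using v' v'M by (intro exI[of _ y] exI[of _ v']) (simp add: y_def)
  qed
  then show ?thesis using M by blast
qed

lemma J_lower:
  assumes "t > 0" "K \<ge> 0" "K-lipschitz_on UNIV u" "bmeas t v" "\<And>s. norm (v s) \<le> M"
  shows "u (y + integral {0..t} v) - K * M * t - C0 * t \<le> J t u y v"
proof -
  have vi: "v integrable_on {0..t}" using assms bmeas_integrable by blast
  have "integral {0..t} (\<lambda>s. - C0) \<le> integral {0..t} (\<lambda>s. L (y + integral {0..s} v) (v s))"
    by (rule integral_le) (auto intro!: bmeas_integrable[of t] bmeas_L bmeas_intros bmeas_integral assms L_lower)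
  then have 1: "- C0 * t \<le> integral {0..t} (\<lambda>s. L (y + integral {0..s} v) (v s))" using assms(1) by (simp add: mult.commute)
  have "norm (integral {0..t} v) \<le> integral {0..t} (\<lambda>s. M)"
    by (rule integral_norm_bound_integral) (auto intro: vi assms)
  then have "norm (integral {0..t} v) \<le> M * t" using assms(1) by (simp add: mult.commute)
  then have "K * norm (integral {0..t} v) \<le> K * (M * t)" using assms(2) by (rule mult_left_mono)
  moreover have "\<bar>u (y + integral {0..t} v) - u y\<bar> \<le> K * norm (integral {0..t} v)"
    using lipschitz_onD[OF assms(3), of "y + integral {0..t} v" y] by (simp add: dist_norm)
  ultimately show ?thesis using 1 unfolding J_def by (simp add: mult.assoc)
qed

text \<open>The order of quantifiers matters: one M serves every datum with Lipschitz constant K,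
  hence all perturbed data at once.\<close>

lemma S_plus_bounds:
  assumes t: "t > 0" and K: "K \<ge> 0"
  shows "\<exists>M\<ge>0. \<forall>u. K-lipschitz_on UNIV u \<longrightarrow>
     (\<forall>y v. bmeas t v \<longrightarrow> S_plus H t u (y + integral {0..t} v) \<le> J t u y v) \<and>
     (\<forall>x e. e > 0 \<longrightarrow> (\<exists>y v. near_min t u M x (S_plus H t u x + e) y v))"
proof -
  obtain M where M: "M \<ge> 0" and trunc: "\<And>u \<xi> v. K-lipschitz_on UNIV u \<Longrightarrow> W11 t \<xi> v \<Longrightarrow> action H t \<xi> v \<noteq> \<infinity> \<Longrightarrow>
    \<exists>y v'. bmeas t v' \<and> (\<forall>s. norm (v' s) \<le> M) \<and> y + integral {0..t} v' = \<xi> t \<and>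
       ereal (J t u y v') \<le> action H t \<xi> v + ereal (u (\<xi> 0))"
    using velocity_truncation[OF t K] by blast
  have main: "(\<forall>y v. bmeas t v \<longrightarrow> S_plus H t u (y + integral {0..t} v) \<le> J t u y v) \<and>
     (\<forall>x e. e > 0 \<longrightarrow> (\<exists>y v. near_min t u M x (S_plus H t u x + e) y v))"
    if u: "K-lipschitz_on UNIV u" for u
  proof -
    define A where "A = (\<lambda>x :: real^'n. {(\<xi>, v). W11 t \<xi> v \<and> \<xi> t = x})"
    define c where "c = (\<lambda>(\<xi>, v). action H t \<xi> v + ereal (u (\<xi> 0)))"
    define I where "I = (\<lambda>x. INF z\<in>A x. c z)"
    have S: "S_plus H t u x = real_of_ereal (I x)" for x
      unfolding S_plus_def I_def A_def c_def by (simp add: case_prod_unfold)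
    have up: "I (y + integral {0..t} v) \<le> ereal (J t u y v)" if v: "bmeas t v" for y v
    proof -
      have "(\<lambda>s. y + integral {0..s} v, v) \<in> A (y + integral {0..t} v)"
        unfolding A_def using W11_integral_curve[OF v] by simp
      then have "I (y + integral {0..t} v) \<le> c (\<lambda>s. y + integral {0..s} v, v)"
        unfolding I_def by (rule INF_lower)
      also have "\<dots> = ereal (J t u y v)"
        using action_bmeas[OF v, of y u] by (simp add: c_def)
      finally show ?thesis .
    qed
    have tr: "\<exists>y v'. bmeas t v' \<and> (\<forall>s. norm (v' s) \<le> M) \<and> y + integral {0..t} v' = x \<and> ereal (J t u y v') \<le> c z"
      if z: "z \<in> A x" "c z \<noteq> \<infinity>" for z x
    proof -
      obtain \<xi> v where zz: "z = (\<xi>, v)" by (cases z)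
      have "W11 t \<xi> v" "\<xi> t = x" using z by (auto simp: A_def zz)
      moreover have "action H t \<xi> v \<noteq> \<infinity>" using z(2) by (auto simp: c_def zz)
      ultimately show ?thesis using trunc[OF u, of \<xi> v] by (simp add: c_def zz)
    qed
    have lo: "ereal (u x - K * M * t - C0 * t) \<le> I x" for x
      unfolding I_def
    proof (rule INF_greatest)
      fix z assume z: "z \<in> A x"
      show "ereal (u x - K * M * t - C0 * t) \<le> c z"
      proof (cases "c z = \<infinity>")
        case False
        then obtain y v' where "bmeas t v'" "\<And>s. norm (v' s) \<le> M" "y + integral {0..t} v' = x" "ereal (J t u y v') \<le> c z"
          using tr[OF z] by blast
        then show ?thesis using J_lower[OF t K u, of v' M y] by (metis ereal_less_eq(3) order_trans)
      qed simp
    qed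
    have up0: "I x \<le> ereal (J t u x (\<lambda>_. 0))" for x
      using up[OF bmeas_const[of t "0"], of x] by simp
    \<comment> \<open>\<open>real_of_ereal\<close> would turn an infinite infimum into 0, so
      finiteness has to be established before \<open>S_plus\<close> can be identified with the
      infimum.\<close>
    have fin: "I x = ereal (S_plus H t u x)" for x
      using lo[of x] up0[of x] unfolding S by (cases "I x") (auto simp: order_antisym_conv)
    show ?thesis
    proof (intro conjI allI impI)
      show "S_plus H t u (y + integral {0..t} v) \<le> J t u y v" if "bmeas t v" for y v
        using up[OF that, of y] unfolding fin by simp
      fix x and e :: real assume "e > 0"
      then have "I x < ereal (S_plus H t u x + e)" by (simp add: fin)
      then obtain z where z: "z \<in> A x" "c z < ereal (S_plus H t u x + e)"
        unfolding I_def by (auto simp: INF_less_iff)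
      then obtain y v where yv: "bmeas t v" "\<And>s. norm (v s) \<le> M" "y + integral {0..t} v = x" "ereal (J t u y v) \<le> c z"
        using tr[OF z(1)] by (metis less_ereal.simps(2) order_less_imp_not_less not_less_iff_gr_or_eq ereal_infty_less(1))
      then have "ereal (J t u y v) \<le> ereal (S_plus H t u x + e)" using z(2) by (metis less_imp_le order_trans)
      then show "\<exists>y v. near_min t u M x (S_plus H t u x + e) y v"
        using yv unfolding near_min_def by auto
    qed
  qed
  then show ?thesis using M by blast
qed

end

section \<open>First variation and stability of characteristics\<close>

text \<open>In the exponentially weighted supremum norm the integral operator has norm at most 1 /
  2, so evaluating the inequality at a maximum point of the weighted function bounds that maximum by
  2 a.\<close>

lemma gronwall_backward:
  fixes g :: "real \<Rightarrow> real"
  assumes g: "continuous_on {0..t} g" and K: "K \<ge> 0" and a: "a \<ge> 0" and t: "t \<ge> 0"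
    and ineq: "\<And>s. s \<in> {0..t} \<Longrightarrow> g s \<le> a + K * integral {s..t} g"
    and s: "s \<in> {0..t}"
  shows "g s \<le> 2 * a * exp ((2 * K + 1) * t)"
proof -
  \<comment> \<open>Chosen to give K / l \<le> 1 / 2; the summand 1 keeps l positive when K =
    0.\<close>
  define l where "l = 2 * K + 1"
  have l: "l > 0" "K / l \<le> 1 / 2" using K by (auto simp: l_def)
  define w where "w = (\<lambda>s. exp (- l * (t - s)) * g s)"
  have "continuous_on {0..t} w" unfolding w_def by (intro continuous_intros g)
  then obtain r where r: "r \<in> {0..t}" "\<And>s. s \<in> {0..t} \<Longrightarrow> w s \<le> w r"
    using continuous_attains_sup[of "{0..t}" w] t by auto
  have gw: "g s = exp (l * (t - s)) * w s" for s
    unfolding w_def by (simp flip: exp_add mult.assoc)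
  have w: "w r \<le> 2 * a"
  proof (cases "w r \<le> 0")
    case False
    have der: "((\<lambda>s. - exp (l * (t - s)) / l) has_vector_derivative exp (l * (t - s))) (at s within {r..t})" for s
      using l by (auto intro!: derivative_eq_intros simp flip: has_real_derivative_iff_has_vector_derivative)
    have I: "((\<lambda>s. exp (l * (t - s))) has_integral (- exp (l * (t - t)) / l - (- exp (l * (t - r)) / l))) {r..t}"
      by (rule fundamental_theorem_of_calculus) (use r der in auto)
    have "integral {r..t} g \<le> integral {r..t} (\<lambda>s. exp (l * (t - s)) * w r)"
    proof (rule integral_le)
      show "g integrable_on {r..t}"
        using r by (intro integrable_continuous_real continuous_on_subset[OF g]) auto
      show "(\<lambda>s. exp (l * (t - s)) * w r) integrable_on {r..t}"
        by (intro integrable_continuous_real continuous_intros)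
      show "g s \<le> exp (l * (t - s)) * w r" if "s \<in> {r..t}" for s
        unfolding gw[of s] using r that by (intro mult_left_mono) auto
    qed
    also have "\<dots> = (exp (l * (t - r)) - 1) / l * w r"
      using integral_unique[OF has_integral_mult_left[OF I, of "w r"]] by (simp add: diff_divide_distrib)
    also have "\<dots> \<le> exp (l * (t - r)) / l * w r"
      using l False by (intro mult_right_mono divide_right_mono) auto
    finally have "K * integral {r..t} g \<le> K * (exp (l * (t - r)) / l * w r)" using K by (rule mult_left_mono)
    also have "\<dots> = K / l * (exp (l * (t - r)) * w r)" by simp
    also have "\<dots> \<le> 1 / 2 * (exp (l * (t - r)) * w r)" using l(2) False by (intro mult_right_mono) auto
    finally have "exp (l * (t - r)) * w r \<le> a + 1 / 2 * (exp (l * (t - r)) * w r)"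
      using ineq[OF r(1)] gw[of r] by linarith
    then have "exp (l * (t - r)) * w r \<le> 2 * a" by linarith
    moreover have "1 * w r \<le> exp (l * (t - r)) * w r" using False l r by (intro mult_right_mono) auto
    ultimately show ?thesis by linarith
  qed (use a in linarith)
  have "g s = exp (l * (t - s)) * w s" by (rule gw)
  also have "\<dots> \<le> exp (l * (t - s)) * (2 * a)" using r(2)[OF s] w by (intro mult_left_mono) auto
  also have "\<dots> \<le> exp (l * t) * (2 * a)" using l s a by (intro mult_right_mono) auto
  finally show ?thesis by (simp add: l_def mult.commute)
qed

context hamiltonian
begin

lemma Hp_continuous: "continuous_on UNIV (\<lambda>z. Hp (fst z) (snd z))"
  and Hx_continuous: "continuous_on UNIV (\<lambda>z. Hx (fst z) (snd z))"
proof -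
  have "isCont (\<lambda>z. Hp (fst z) (snd z)) (x, p) \<and> isCont (\<lambda>z. Hx (fst z) (snd z)) (x, p)" for x p
  proof -
    define R where "R = max (norm x) (norm p) + 1"
    obtain K where "flow_lipschitz Hp Hx R K" using local_lipschitz by blast
    note K = flow_lipschitzD[OF this]
    have "\<forall>\<^sub>F z in at (x, p). dist z (x, p) < 1"
      unfolding eventually_at by (intro exI[of _ 1]) auto
    then have ev: "\<forall>\<^sub>F z in at (x, p). norm (fst z) \<le> R \<and> norm (snd z) \<le> R \<and> norm x \<le> R \<and> norm p \<le> R"
    proof eventually_elim
      case (elim z)
      have "dist (fst z) x < 1" "dist (snd z) p < 1"
        using dist_fst_le[of z "(x, p)"] dist_snd_le[of z "(x, p)"] elim by auto
      then show ?case
        using norm_triangle_ineq2[of "fst z" x] norm_triangle_ineq2[of "snd z" p]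
        by (auto simp: dist_norm R_def)
    qed
    have lim: "((\<lambda>z. K * (norm (fst z - x) + norm (snd z - p))) \<longlongrightarrow> 0) (at (x, p))"
      by (auto intro!: tendsto_eq_intros)
    have "((\<lambda>z. Hp (fst z) (snd z) - Hp x p) \<longlongrightarrow> 0) (at (x, p))" "((\<lambda>z. Hx (fst z) (snd z) - Hx x p) \<longlongrightarrow> 0) (at (x, p))"
      by (rule Lim_null_comparison[OF eventually_mono[OF ev] lim]; use K in blast)+
    then show ?thesis unfolding isCont_def by (auto simp: Lim_null[symmetric])
  qed
  then show "continuous_on UNIV (\<lambda>z. Hp (fst z) (snd z))" "continuous_on UNIV (\<lambda>z. Hx (fst z) (snd z))"
    by (auto intro!: continuous_at_imp_continuous_on)
qed

lemma bmeas_Hp: "bmeas t f \<Longrightarrow> bmeas t g \<Longrightarrow> bmeas t (\<lambda>s. Hp (f s) (g s))"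
  using Hp_continuous by (rule bmeas_compose2)

lemma bmeas_Hx: "bmeas t f \<Longrightarrow> bmeas t g \<Longrightarrow> bmeas t (\<lambda>s. Hx (f s) (g s))"
  using Hx_continuous by (rule bmeas_compose2)

text \<open>First variation of the cost, after moving the variation of the curve onto its velocity
  by Fubini.\<close>

lemma J_perturb:
  "\<exists>C\<ge>0. \<forall>t u y v \<psi>. bmeas t v \<longrightarrow> bmeas t \<psi> \<longrightarrow>
     (\<forall>s\<in>{0..t}. norm (y + integral {0..s} v) \<le> R \<and> norm (y + integral {0..s} v + integral {0..s} \<psi>) \<le> R \<and> norm (v s) \<le> R) \<longrightarrow>
     J t u y (\<lambda>s. v s + \<psi> s) \<le> J t u y v +
       integral {0..t} (\<lambda>s. \<psi> s \<bullet> (P (y + integral {0..s} v) (v s) -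
          integral {s..t} (\<lambda>r. Hx (y + integral {0..r} v) (P (y + integral {0..r} v) (v r))))) +
       C * integral {0..t} (\<lambda>s. (norm (integral {0..s} \<psi>))\<^sup>2 + (norm (\<psi> s))\<^sup>2)"
proof -
  obtain C where C: "C \<ge> 0" "\<And>x h q k. norm x \<le> R \<Longrightarrow> norm (x + h) \<le> R \<Longrightarrow> norm q \<le> R \<Longrightarrow>
     L (x + h) (q + k) \<le> L x q + P x q \<bullet> k - Hx x (P x q) \<bullet> h + C * ((norm h)\<^sup>2 + (norm k)\<^sup>2)"
    using L_semiconcave[of R] by blast
  have "J t u y (\<lambda>s. v s + \<psi> s) \<le> J t u y v +
       integral {0..t} (\<lambda>s. \<psi> s \<bullet> (P (y + integral {0..s} v) (v s) -
          integral {s..t} (\<lambda>r. Hx (y + integral {0..r} v) (P (y + integral {0..r} v) (v r))))) +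
       C * integral {0..t} (\<lambda>s. (norm (integral {0..s} \<psi>))\<^sup>2 + (norm (\<psi> s))\<^sup>2)"
    if v: "bmeas t v" and \<psi>: "bmeas t \<psi>" and
      bd: "\<forall>s\<in>{0..t}. norm (y + integral {0..s} v) \<le> R \<and> norm (y + integral {0..s} v + integral {0..s} \<psi>) \<le> R \<and> norm (v s) \<le> R"
    for t u y v \<psi>
  proof -
    define \<xi> where "\<xi> = (\<lambda>s. y + integral {0..s} v)"
    define \<phi> where "\<phi> = (\<lambda>s. integral {0..s} \<psi>)"
    define p where "p = (\<lambda>s. P (\<xi> s) (v s))"
    define X where "X = (\<lambda>s. Hx (\<xi> s) (p s))"
    have \<xi>: "bmeas t \<xi>" unfolding \<xi>_def by (intro bmeas_intros bmeas_integral v)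
    have \<phi>: "bmeas t \<phi>" unfolding \<phi>_def by (intro bmeas_integral \<psi>)
    have p: "bmeas t p" unfolding p_def by (intro bmeas_P \<xi> v)
    have X: "bmeas t X" unfolding X_def by (intro bmeas_Hx \<xi> p)
    note bm = \<xi> \<phi> p X v \<psi>
    have int: "f integrable_on {0..t}" if "bmeas t f" for f :: "real \<Rightarrow> real" using bmeas_integrable[OF that] by simp
    have sum: "integral {0..s} (\<lambda>s. v s + \<psi> s) = integral {0..s} v + integral {0..s} \<psi>" if "s \<in> {0..t}" for s
      using that by (intro integral_add bmeas_integrable[of t] bm) auto
    have i1: "bmeas t (\<lambda>s. L (\<xi> s) (v s))" by (intro bmeas_L bm)
    have i2: "bmeas t (\<lambda>s. p s \<bullet> \<psi> s)" by (intro bmeas_intros bm)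
    have i3: "bmeas t (\<lambda>s. X s \<bullet> \<phi> s)" by (intro bmeas_intros bm)
    have i4: "bmeas t (\<lambda>s. (norm (\<phi> s))\<^sup>2 + (norm (\<psi> s))\<^sup>2)" by (intro bmeas_intros bm)
    have i5: "bmeas t (\<lambda>s. \<psi> s \<bullet> integral {s..t} X)" by (intro bmeas_intros bmeas_integral' bm)
    have "integral {0..t} (\<lambda>s. L (y + integral {0..s} (\<lambda>s. v s + \<psi> s)) (v s + \<psi> s))
        = integral {0..t} (\<lambda>s. L (\<xi> s + \<phi> s) (v s + \<psi> s))"
      by (intro Henstock_Kurzweil_Integration.integral_cong) (simp add: sum \<xi>_def \<phi>_def add.assoc)
    also have "\<dots> \<le> integral {0..t} (\<lambda>s. L (\<xi> s) (v s) + p s \<bullet> \<psi> s - X s \<bullet> \<phi> s + C * ((norm (\<phi> s))\<^sup>2 + (norm (\<psi> s))\<^sup>2))"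
    proof (rule integral_le)
      show "(\<lambda>s. L (\<xi> s + \<phi> s) (v s + \<psi> s)) integrable_on {0..t}"
        by (intro int bmeas_L bmeas_intros bm)
      have "bmeas t (\<lambda>s. L (\<xi> s) (v s) + p s \<bullet> \<psi> s - X s \<bullet> \<phi> s + C *\<^sub>R ((norm (\<phi> s))\<^sup>2 + (norm (\<psi> s))\<^sup>2))"
        by (intro bmeas_intros bmeas_L bm)
      then show "(\<lambda>s. L (\<xi> s) (v s) + p s \<bullet> \<psi> s - X s \<bullet> \<phi> s + C * ((norm (\<phi> s))\<^sup>2 + (norm (\<psi> s))\<^sup>2)) integrable_on {0..t}"
        by (intro int) simp
      fix s assume "s \<in> {0..t}"
      then show "L (\<xi> s + \<phi> s) (v s + \<psi> s) \<le> L (\<xi> s) (v s) + p s \<bullet> \<psi> s - X s \<bullet> \<phi> s + C * ((norm (\<phi> s))\<^sup>2 + (norm (\<psi> s))\<^sup>2)"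
        unfolding X_def p_def using bd by (intro C) (auto simp: \<xi>_def \<phi>_def)
    qed
    also have "\<dots> = integral {0..t} (\<lambda>s. L (\<xi> s) (v s)) + integral {0..t} (\<lambda>s. p s \<bullet> \<psi> s) - integral {0..t} (\<lambda>s. X s \<bullet> \<phi> s)
        + C * integral {0..t} (\<lambda>s. (norm (\<phi> s))\<^sup>2 + (norm (\<psi> s))\<^sup>2)"
      by (intro integral_unique has_integral_add has_integral_diff has_integral_mult_right integrable_integral int i1 i2 i3 i4)
    also have "integral {0..t} (\<lambda>s. X s \<bullet> \<phi> s) = integral {0..t} (\<lambda>s. \<psi> s \<bullet> integral {s..t} X)"
      unfolding \<phi>_def by (rule Fubini_triangle_inner[OF X \<psi>])
    finally have "J t u y (\<lambda>s. v s + \<psi> s) \<le> J t u y v + (integral {0..t} (\<lambda>s. p s \<bullet> \<psi> s) - integral {0..t} (\<lambda>s. \<psi> s \<bullet> integral {s..t} X))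
        + C * integral {0..t} (\<lambda>s. (norm (\<phi> s))\<^sup>2 + (norm (\<psi> s))\<^sup>2)"
      unfolding J_def \<xi>_def by linarith
    also have "integral {0..t} (\<lambda>s. p s \<bullet> \<psi> s) - integral {0..t} (\<lambda>s. \<psi> s \<bullet> integral {s..t} X)
       = integral {0..t} (\<lambda>s. p s \<bullet> \<psi> s - \<psi> s \<bullet> integral {s..t} X)"
      by (rule integral_diff[symmetric]) (intro int i2 i5)+
    also have "\<dots> = integral {0..t} (\<lambda>s. \<psi> s \<bullet> (p s - integral {s..t} X))"
      by (simp add: inner_diff_right inner_commute)
    finally show ?thesis unfolding p_def X_def \<xi>_def \<phi>_def .
  qed
  then show ?thesis using C(1) by blast
qed

text \<open>Solutions of the characteristic system up to an error in the momentum that is small in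
  \<open>L\<^sup>1\<close>; for \<open>e = 0\<close> and \<open>p = m\<close> this is the integrated system itself.\<close>

definition near_char :: "real \<Rightarrow> real^'n \<Rightarrow> real^'n \<Rightarrow> real \<Rightarrow> real \<Rightarrow>
    (real \<Rightarrow> real^'n) \<Rightarrow> (real \<Rightarrow> real^'n) \<Rightarrow> (real \<Rightarrow> real^'n) \<Rightarrow> bool" where
  "near_char t x q R e \<xi> m p \<longleftrightarrow> bmeas t \<xi> \<and> bmeas t m \<and> bmeas t p \<and>
     (\<forall>s\<in>{0..t}. norm (\<xi> s) \<le> R \<and> norm (m s) \<le> R \<and> norm (p s) \<le> R \<and>
        \<xi> s = x - integral {s..t} (\<lambda>r. Hp (\<xi> r) (p r)) \<and>
        m s = q + integral {s..t} (\<lambda>r. Hx (\<xi> r) (p r))) \<and>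
     integral {0..t} (\<lambda>s. norm (p s - m s)) \<le> e"

lemma near_char_continuous:
  assumes "near_char t x q R e \<xi> m p"
  shows "continuous_on {0..t} \<xi>" "continuous_on {0..t} m"
proof -
  have bm: "bmeas t \<xi>" "bmeas t p" using assms by (auto simp: near_char_def)
  have 1: "continuous_on {0..t} (\<lambda>s. x - integral {s..t} (\<lambda>r. Hp (\<xi> r) (p r)))"
    by (intro continuous_intros indefinite_integral_continuous_1' bmeas_integrable[of t] bmeas_Hp bm) auto
  show "continuous_on {0..t} \<xi>"
    by (rule continuous_on_cong[THEN iffD2, OF refl _ 1]) (use assms in \<open>auto simp: near_char_def\<close>)
  have 2: "continuous_on {0..t} (\<lambda>s. q + integral {s..t} (\<lambda>r. Hx (\<xi> r) (p r)))"
    by (intro continuous_intros indefinite_integral_continuous_1' bmeas_integrable[of t] bmeas_Hx bm) auto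
  show "continuous_on {0..t} m"
    by (rule continuous_on_cong[THEN iffD2, OF refl _ 2]) (use assms in \<open>auto simp: near_char_def\<close>)
qed

lemma near_char_mono: "near_char t x q R e \<xi> m p \<Longrightarrow> R \<le> R' \<Longrightarrow> e \<le> e' \<Longrightarrow> near_char t x q R' e' \<xi> m p"
  unfolding near_char_def by (meson order_trans)

lemma integral_diff_le:
  fixes f g :: "real \<Rightarrow> 'a::euclidean_space"
  assumes "bmeas t f" "bmeas t g" "bmeas t h" "s \<in> {0..t}"
    and "\<And>r. r \<in> {0..t} \<Longrightarrow> norm (f r - g r) \<le> h r"
  shows "norm (integral {s..t} f - integral {s..t} g) \<le> integral {s..t} h"
proof -
  have "integral {s..t} f - integral {s..t} g = integral {s..t} (\<lambda>r. f r - g r)"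
    using assms by (intro integral_diff[symmetric] bmeas_integrable[of t]) auto
  also have "norm \<dots> \<le> integral {s..t} h"
    using assms by (intro integral_norm_bound_integral bmeas_integrable[of t] bmeas_diff) auto
  finally show ?thesis .
qed

lemma integral_tail_le:
  fixes h :: "real \<Rightarrow> real"
  assumes "bmeas t h" "s \<in> {0..t}" "\<And>r. r \<in> {0..t} \<Longrightarrow> 0 \<le> h r"
  shows "integral {s..t} h \<le> integral {0..t} h"
  using assms by (intro integral_subset_le bmeas_integrable[of t]) auto

text \<open>The momenta p are controlled only in L^1, so Gronwall is applied to the distances D of
  the continuous parts \<xi> and m, while the errors E of p against m enter through their integral.
  Small errors will give a Cauchy family, zero errors uniqueness.\<close>

lemma near_char_stable:
  assumes t: "t > 0"
  shows "\<exists>C\<ge>0. \<forall>e1 e2 \<xi>1 m1 p1 \<xi>2 m2 p2. near_char t x q R e1 \<xi>1 m1 p1 \<longrightarrow> near_char t x q R e2 \<xi>2 m2 p2 \<longrightarrow>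
    (\<forall>s\<in>{0..t}. norm (\<xi>1 s - \<xi>2 s) + norm (m1 s - m2 s) \<le> C * (e1 + e2))"
proof -
  obtain K where "flow_lipschitz Hp Hx R K" using local_lipschitz by blast
  note K = flow_lipschitzD[OF this]
  \<comment> \<open>Gronwall with 2 K, since position and momentum contribute K each; the same 2 K
    multiplies the error e1 + e2.\<close>
  define C where "C = 2 * (2 * K) * exp ((2 * (2 * K) + 1) * t)"
  have "norm (\<xi>1 s - \<xi>2 s) + norm (m1 s - m2 s) \<le> C * (e1 + e2)"
    if n1: "near_char t x q R e1 \<xi>1 m1 p1" and n2: "near_char t x q R e2 \<xi>2 m2 p2" and s: "s \<in> {0..t}"
    for e1 e2 \<xi>1 m1 p1 \<xi>2 m2 p2 s
  proof -
    define D where "D = (\<lambda>s. norm (\<xi>1 s - \<xi>2 s) + norm (m1 s - m2 s))"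
    define E where "E = (\<lambda>s. norm (p1 s - m1 s) + norm (p2 s - m2 s))"
    have bm: "bmeas t \<xi>1" "bmeas t m1" "bmeas t p1" "bmeas t \<xi>2" "bmeas t m2" "bmeas t p2"
      using n1 n2 by (auto simp: near_char_def)
    have D: "bmeas t D" and E: "bmeas t E" unfolding D_def E_def by (intro bmeas_intros bm)+
    have KDE: "bmeas t (\<lambda>s. K * (D s + E s))"
      using bmeas_scaleR[OF bmeas_const[of t K] bmeas_add[OF D E]] by simp
    have Ei: "integral {0..t} E \<le> e1 + e2"
    proof -
      have "integral {0..t} E = integral {0..t} (\<lambda>s. norm (p1 s - m1 s)) + integral {0..t} (\<lambda>s. norm (p2 s - m2 s))"
        unfolding E_def by (intro integral_add bmeas_integrable[of t] bmeas_intros bm) auto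
      then show ?thesis using n1 n2 by (simp add: near_char_def)
    qed
    have Dc: "continuous_on {0..t} D" unfolding D_def
      by (intro continuous_intros near_char_continuous[OF n1] near_char_continuous[OF n2])
    have ineq: "D r \<le> 2 * K * (e1 + e2) + 2 * K * integral {r..t} D" if r: "r \<in> {0..t}" for r
    proof -
      have pw: "norm (Hp (\<xi>1 z) (p1 z) - Hp (\<xi>2 z) (p2 z)) \<le> K * (D z + E z)"
        "norm (Hx (\<xi>1 z) (p1 z) - Hx (\<xi>2 z) (p2 z)) \<le> K * (D z + E z)" if "z \<in> {0..t}" for z
      proof -
        have "norm (p1 z - p2 z) = norm ((p1 z - m1 z) + (m1 z - m2 z) + (m2 z - p2 z))" by simp
        also have "\<dots> \<le> norm (p1 z - m1 z) + norm (m1 z - m2 z) + norm (m2 z - p2 z)"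
          by (intro norm_triangle_le add_right_mono norm_triangle_ineq)
        finally have "norm (\<xi>1 z - \<xi>2 z) + norm (p1 z - p2 z) \<le> D z + E z"
          unfolding D_def E_def by (simp add: norm_minus_commute)
        then have le: "K * (norm (\<xi>1 z - \<xi>2 z) + norm (p1 z - p2 z)) \<le> K * (D z + E z)"
          using K(1) by (rule mult_left_mono)
        have "norm (\<xi>1 z) \<le> R" "norm (\<xi>2 z) \<le> R" "norm (p1 z) \<le> R" "norm (p2 z) \<le> R"
          using n1 n2 that unfolding near_char_def by blast+
        from K(2)[OF this] le
        show "norm (Hp (\<xi>1 z) (p1 z) - Hp (\<xi>2 z) (p2 z)) \<le> K * (D z + E z)"
          "norm (Hx (\<xi>1 z) (p1 z) - Hx (\<xi>2 z) (p2 z)) \<le> K * (D z + E z)" by linarith+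
      qed
      have eqs: "\<xi>1 r = x - integral {r..t} (\<lambda>r. Hp (\<xi>1 r) (p1 r))" "m1 r = q + integral {r..t} (\<lambda>r. Hx (\<xi>1 r) (p1 r))"
        "\<xi>2 r = x - integral {r..t} (\<lambda>r. Hp (\<xi>2 r) (p2 r))" "m2 r = q + integral {r..t} (\<lambda>r. Hx (\<xi>2 r) (p2 r))"
        using n1 n2 r unfolding near_char_def by blast+
      have "norm (\<xi>1 r - \<xi>2 r) \<le> integral {r..t} (\<lambda>s. K * (D s + E s))"
        unfolding eqs(1,3)
        using integral_diff_le[OF bmeas_Hp[OF bm(1,3)] bmeas_Hp[OF bm(4,6)] KDE r pw(1)]
        by (simp add: norm_minus_commute)
      moreover have "norm (m1 r - m2 r) \<le> integral {r..t} (\<lambda>s. K * (D s + E s))"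
        unfolding eqs(2,4)
        using integral_diff_le[OF bmeas_Hx[OF bm(1,3)] bmeas_Hx[OF bm(4,6)] KDE r pw(2)] by simp
      moreover have "integral {r..t} (\<lambda>s. K * (D s + E s)) = K * (integral {r..t} D + integral {r..t} E)"
      proof -
        have "integral {r..t} (\<lambda>s. K * (D s + E s)) = K * integral {r..t} (\<lambda>s. D s + E s)" by simp
        also have "integral {r..t} (\<lambda>s. D s + E s) = integral {r..t} D + integral {r..t} E"
          using r by (intro integral_add bmeas_integrable[of t] D E) auto
        finally show ?thesis .
      qed
      moreover have "K * integral {r..t} E \<le> K * (e1 + e2)"
      proof (rule mult_left_mono[OF _ K(1)])
        have "integral {r..t} E \<le> integral {0..t} E"
          by (rule integral_tail_le[OF E r]) (simp add: E_def)
        then show "integral {r..t} E \<le> e1 + e2" using Ei by linarith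
      qed
      ultimately show ?thesis using D_def[THEN fun_cong, of r] by (simp add: distrib_left)
    qed
    have "0 \<le> e1 + e2"
    proof -
      have "E integrable_on {0..t}" by (rule bmeas_integrable[OF E]) auto
      then have "0 \<le> integral {0..t} E" by (rule integral_nonneg) (simp add: E_def)
      then show ?thesis using Ei by linarith
    qed
    then have "D s \<le> 2 * (2 * K * (e1 + e2)) * exp ((2 * (2 * K) + 1) * t)"
      using t K(1) by (intro gronwall_backward[OF Dc _ _ _ ineq s]) auto
    also have "\<dots> = C * (e1 + e2)" by (simp add: C_def algebra_simps)
    finally show ?thesis by (simp add: D_def)
  qed
  moreover have "C \<ge> 0" using K by (simp add: C_def)
  ultimately show ?thesis by blast
qed

end

lemma div_mult_less: "d / (2 * (b + 1)) * b < d" if "0 \<le> b" "0 < d" for b d :: real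
proof -
  have "d * b < d * (2 * (b + 1))" using that by (intro mult_strict_left_mono) auto
  then show ?thesis using that by (simp add: pos_divide_less_eq)
qed

context hamiltonian
begin

text \<open>Since the end point of the perturbed curve is free, differentiability of the value function
  at the end point lets us test with \<open>\<psi> = - \<epsilon> (p - m)\<close>: the momentum of a near-minimiser is
  \<open>L\<^sup>1\<close>-close to the solution \<open>m\<close> of the linear adjoint equation.\<close>

lemma near_minimiser_near_char:
  assumes t: "t > 0" and M: "M \<ge> 0" and U: "GDERIV U x :> q"
    and upper: "\<And>y v. bmeas t v \<Longrightarrow> U (y + integral {0..t} v) \<le> J t u y v"
  shows "\<exists>R\<ge>0. \<forall>e>0. \<exists>\<eta>>0. \<forall>y v. near_min t u M x (U x + \<eta>) y v \<longrightarrow> (\<exists>m p. near_char t x q R e (\<lambda>s. y + integral {0..s} v) m p)"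
proof -
  obtain Pb where Pb: "Pb \<ge> 0" "\<And>x q. norm q \<le> M \<Longrightarrow> norm (P x q) \<le> Pb" using P_bound by blast
  define mb where "mb = norm q + CL * t"
  have mb: "mb \<ge> 0" using CL_nonneg t by (simp add: mb_def)
  define B where "B = Pb + mb"
  have B: "B \<ge> 0" using Pb mb by (simp add: B_def)
  \<comment> \<open>Large enough for the curve, the perturbed curve, the velocity and both p and m:
    B bounds \<open>norm (p s - m s)\<close>, so the variation moves the curve by at most B
    t.\<close>
  define R where "R = norm x + M * t + B * t + B + M"
  have Bt: "B * t \<ge> 0" "M * t \<ge> 0" using B M t by auto
  have R: "R \<ge> 0" using Bt B M by (simp add: R_def)
  obtain C where C: "C \<ge> 0" and pert: "\<And>u y v \<psi>. bmeas t v \<Longrightarrow> bmeas t \<psi> \<Longrightarrow>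
     (\<forall>s\<in>{0..t}. norm (y + integral {0..s} v) \<le> R \<and> norm (y + integral {0..s} v + integral {0..s} \<psi>) \<le> R \<and> norm (v s) \<le> R) \<Longrightarrow>
     J t u y (\<lambda>s. v s + \<psi> s) \<le> J t u y v +
       integral {0..t} (\<lambda>s. \<psi> s \<bullet> (P (y + integral {0..s} v) (v s) -
          integral {s..t} (\<lambda>r. Hx (y + integral {0..r} v) (P (y + integral {0..r} v) (v r))))) +
       C * integral {0..t} (\<lambda>s. (norm (integral {0..s} \<psi>))\<^sup>2 + (norm (\<psi> s))\<^sup>2)"
    using J_perturb[of R] by blast
  define C2 where "C2 = C * (((B * t)\<^sup>2 + B\<^sup>2) * t)"
  have C2: "C2 \<ge> 0" using C t by (simp add: C2_def)
  have "\<exists>\<eta>>0. \<forall>y v. near_min t u M x (U x + \<eta>) y v \<longrightarrow> (\<exists>m p. near_char t x q R e (\<lambda>s. y + integral {0..s} v) m p)" if e: "e > 0" for e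
  proof -
    \<comment> \<open>Weight for passing from L^2 to L^1: if the squared norm is at most
      \<open>e2 = e * c\<close>, the pointwise bound
      \<open>a \<le> a\<^sup>2 / (2 * c) + c / 2\<close> integrates to e / 2 + e / 2.\<close>
    define c where "c = e / t"
    have c: "c > 0" using e t by (simp add: c_def)
    define e2 where "e2 = e * c"
    have e2: "e2 > 0" using e c by (simp add: e2_def)
    \<comment> \<open>Three errors have to stay below \<open>\<epsilon> * e2 / 3\<close> each: the
      excess \<eta>, the remainder in the derivative of U (controlled by \<rho>), and the quadratic
      term of the variation.\<close>
    define \<rho> where "\<rho> = e2 / (3 * (B * t + 1))"
    have \<rho>: "\<rho> > 0" using e2 Bt by (simp add: \<rho>_def)
    obtain d where d: "d > 0" "\<And>h. norm h < d \<Longrightarrow> norm (U (x + h) - U x - h \<bullet> q) \<le> \<rho> * norm h"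
    proof -
      have "\<exists>d>0. \<forall>y. norm (y - x) < d \<longrightarrow> norm (U y - U x - (y - x) \<bullet> q) \<le> \<rho> * norm (y - x)"
        using U \<rho> unfolding gderiv_def has_derivative_at_alt by blast
      then obtain d where "d > 0" "\<And>y. norm (y - x) < d \<Longrightarrow> norm (U y - U x - (y - x) \<bullet> q) \<le> \<rho> * norm (y - x)" by blast
      from this(1) this(2)[of "x + h" for h] show ?thesis by (intro that[of d]) auto
    qed
    \<comment> \<open>The three constraints keep the perturbed curve within R, the new end point
      within the range d of the first-order expansion, and the quadratic term below its
      share.\<close>
    define \<epsilon> where "\<epsilon> = min 1 (min (d / (2 * (B * t + 1))) (e2 / (3 * (C2 + 1))))"
    have \<epsilon>: "\<epsilon> > 0" "\<epsilon> \<le> 1" using d e2 Bt C2 by (auto simp: \<epsilon>_def)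
    have \<epsilon>d: "\<epsilon> * (B * t) < d"
    proof -
      have "\<epsilon> * (B * t) \<le> d / (2 * (B * t + 1)) * (B * t)" using Bt by (intro mult_right_mono) (auto simp: \<epsilon>_def)
      also have "\<dots> < d" using Bt(1) d(1) by (rule div_mult_less)
      finally show ?thesis .
    qed
    have \<epsilon>C: "C2 * \<epsilon> \<le> e2 / 3"
    proof -
      have "C2 * \<epsilon> \<le> C2 * (e2 / (3 * (C2 + 1)))" using C2 by (intro mult_left_mono) (auto simp: \<epsilon>_def)
      also have "\<dots> \<le> e2 / 3" using C2 e2 by (simp add: field_simps)
      finally show ?thesis .
    qed
    define \<eta> where "\<eta> = \<epsilon> * (e2 / 3)"
    have \<eta>: "\<eta> > 0" using \<epsilon> e2 by (simp add: \<eta>_def)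
    have "\<exists>m p. near_char t x q R e (\<lambda>s. y + integral {0..s} v) m p"
      if v: "bmeas t v" and vM: "\<And>s. norm (v s) \<le> M" and endp: "y + integral {0..t} v = x" and
        min: "J t u y v \<le> U x + \<eta>" for y v
    proof -
      define \<xi> where "\<xi> = (\<lambda>s. y + integral {0..s} v)"
      define p where "p = (\<lambda>s. P (\<xi> s) (v s))"
      define X where "X = (\<lambda>s. Hx (\<xi> s) (p s))"
      define m where "m = (\<lambda>s. q + integral {s..t} X)"
      define \<psi> where "\<psi> = (\<lambda>s. (- \<epsilon>) *\<^sub>R (p s - m s))"
      define h where "h = integral {0..t} \<psi>"
      have \<xi>: "bmeas t \<xi>" unfolding \<xi>_def by (intro bmeas_intros bmeas_integral v)
      have p: "bmeas t p" unfolding p_def by (intro bmeas_P \<xi> v)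
      have X: "bmeas t X" unfolding X_def by (intro bmeas_Hx \<xi> p)
      have m: "bmeas t m" unfolding m_def by (intro bmeas_intros bmeas_integral' X)
      have \<psi>: "bmeas t \<psi>" unfolding \<psi>_def by (intro bmeas_intros p m)
      have pm: "bmeas t (\<lambda>s. norm (p s - m s))" by (intro bmeas_intros p m)
      have pm2: "bmeas t (\<lambda>s. (norm (p s - m s))\<^sup>2)" by (intro bmeas_intros p m)
      have split: "x = \<xi> s + integral {s..t} v" if "s \<in> {0..t}" for s
      proof -
        have "integral {0..s} v + integral {s..t} v = integral {0..t} v"
          by (rule Henstock_Kurzweil_Integration.integral_combine) (use that in \<open>auto intro: bmeas_integrable[OF v]\<close>)
        then show ?thesis using endp by (simp add: \<xi>_def add.assoc)
      qed
      have \<xi>b: "norm (\<xi> s) \<le> norm x + M * t" if s: "s \<in> {0..t}" for s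
      proof -
        have "norm (integral {s..t} v) \<le> integral {s..t} (\<lambda>s. M)"
          using s by (intro integral_norm_bound_integral bmeas_integrable[OF v] vM) auto
        also have "\<dots> \<le> M * t" using s M by (simp add: mult.commute mult_left_mono)
        finally have "norm (integral {s..t} v) \<le> M * t" .
        moreover have "norm (\<xi> s) \<le> norm x + norm (integral {s..t} v)"
          using norm_triangle_ineq4[of x "integral {s..t} v"] split[OF s] by simp
        ultimately show ?thesis by linarith
      qed
      have pb: "norm (p s) \<le> Pb" for s unfolding p_def using vM by (rule Pb)
      have mbd: "norm (m s) \<le> mb" if s: "s \<in> {0..t}" for s
      proof -
        have "norm (integral {s..t} X) \<le> integral {s..t} (\<lambda>s. CL)"
          using s by (intro integral_norm_bound_integral bmeas_integrable[OF X]) (auto simp: X_def Hx_bound)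
        also have "\<dots> \<le> CL * t" using s CL_nonneg by (simp add: mult.commute mult_left_mono)
        finally show ?thesis unfolding m_def mb_def using norm_triangle_ineq[of q "integral {s..t} X"] by linarith
      qed
      have pmb: "norm (p s - m s) \<le> B" if "s \<in> {0..t}" for s
        using norm_triangle_ineq4[of "p s" "m s"] pb[of s] mbd[OF that] by (simp add: B_def)
      have \<psi>b: "norm (\<psi> s) \<le> \<epsilon> * B" if "s \<in> {0..t}" for s
        unfolding \<psi>_def using pmb[OF that] \<epsilon> by (simp add: mult_left_mono)
      have \<phi>b: "norm (integral {0..s} \<psi>) \<le> \<epsilon> * (B * t)" if s: "s \<in> {0..t}" for s
      proof -
        have "norm (integral {0..s} \<psi>) \<le> integral {0..s} (\<lambda>s. \<epsilon> * B)"
          using s by (intro integral_norm_bound_integral bmeas_integrable[OF \<psi>] \<psi>b) auto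
        also have "\<dots> = s * (\<epsilon> * B)" using s by simp
        also have "\<dots> \<le> t * (\<epsilon> * B)" using s \<epsilon> B by (intro mult_right_mono) auto
        finally show ?thesis by (simp add: mult_ac)
      qed
      have \<epsilon>Bt: "\<epsilon> * (B * t) \<le> B * t" using \<epsilon> Bt by (intro mult_left_le_one_le) auto
      have hyp: "\<forall>s\<in>{0..t}. norm (y + integral {0..s} v) \<le> R \<and> norm (y + integral {0..s} v + integral {0..s} \<psi>) \<le> R \<and> norm (v s) \<le> R"
      proof (intro ballI conjI)
        fix s assume s: "s \<in> {0..t}"
        show "norm (y + integral {0..s} v) \<le> R" using \<xi>b[OF s] Bt B M unfolding R_def \<xi>_def by linarith
        show "norm (y + integral {0..s} v + integral {0..s} \<psi>) \<le> R"
          using \<xi>b[OF s] \<phi>b[OF s] \<epsilon>Bt norm_triangle_ineq[of "\<xi> s" "integral {0..s} \<psi>"] B M unfolding R_def \<xi>_def by linarith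
        show "norm (v s) \<le> R" using vM[of s] Bt B norm_ge_zero[of x] unfolding R_def by linarith
      qed
      define Q where "Q = integral {0..t} (\<lambda>s. (norm (p s - m s))\<^sup>2)"
      \<comment> \<open>Here the terminal value q of m pays off: it contributes
        \<open>h \<bullet> q\<close>, which cancels against the linear part of
        \<open>U (x + h) - U x\<close> and leaves only \<open>- \<epsilon> * Q\<close>.\<close>
      have lin: "integral {0..t} (\<lambda>s. \<psi> s \<bullet> (p s - integral {s..t} X)) = h \<bullet> q - \<epsilon> * Q"
      proof -
        have "integral {0..t} (\<lambda>s. \<psi> s \<bullet> (p s - integral {s..t} X)) = integral {0..t} (\<lambda>s. \<psi> s \<bullet> q - \<epsilon> * (norm (p s - m s))\<^sup>2)"
        proof (rule Henstock_Kurzweil_Integration.integral_cong)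
          fix s
          have "p s - integral {s..t} X = (p s - m s) + q" by (simp add: m_def)
          then have "\<psi> s \<bullet> (p s - integral {s..t} X) = \<psi> s \<bullet> (p s - m s) + \<psi> s \<bullet> q" by (simp only: inner_add_right)
          then show "\<psi> s \<bullet> (p s - integral {s..t} X) = \<psi> s \<bullet> q - \<epsilon> * (norm (p s - m s))\<^sup>2"
            by (simp add: \<psi>_def power2_norm_eq_inner)
        qed
        also have "\<dots> = integral {0..t} (\<lambda>s. \<psi> s \<bullet> q) - \<epsilon> * Q" unfolding Q_def
          by (intro integral_unique has_integral_diff has_integral_mult_right integrable_integral bmeas_integrable[of t] bmeas_intros \<psi> p m) auto
        also have "integral {0..t} (\<lambda>s. \<psi> s \<bullet> q) = h \<bullet> q" unfolding h_def
          by (rule integral_inner_left) (rule bmeas_integrable[OF \<psi>]; simp)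
        finally show ?thesis .
      qed
      have quad: "C * integral {0..t} (\<lambda>s. (norm (integral {0..s} \<psi>))\<^sup>2 + (norm (\<psi> s))\<^sup>2) \<le> C2 * \<epsilon>\<^sup>2"
      proof -
        have "integral {0..t} (\<lambda>s. (norm (integral {0..s} \<psi>))\<^sup>2 + (norm (\<psi> s))\<^sup>2) \<le> integral {0..t} (\<lambda>s. (\<epsilon> * (B * t))\<^sup>2 + (\<epsilon> * B)\<^sup>2)"
          by (rule integral_le) (use \<phi>b \<psi>b in \<open>auto intro!: bmeas_integrable[of t] bmeas_intros bmeas_integral \<psi> add_mono power_mono\<close>)
        also have "\<dots> = ((B * t)\<^sup>2 + B\<^sup>2) * t * \<epsilon>\<^sup>2" using t by (simp add: power_mult_distrib algebra_simps)
        finally have "C * integral {0..t} (\<lambda>s. (norm (integral {0..s} \<psi>))\<^sup>2 + (norm (\<psi> s))\<^sup>2) \<le> C * (((B * t)\<^sup>2 + B\<^sup>2) * t * \<epsilon>\<^sup>2)"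
          using C by (rule mult_left_mono)
        then show ?thesis by (simp add: C2_def mult_ac)
      qed
      have "J t u y (\<lambda>s. v s + \<psi> s) \<le> J t u y v + (h \<bullet> q - \<epsilon> * Q) + C2 * \<epsilon>\<^sup>2"
        using pert[OF v \<psi> hyp, of u] quad lin unfolding p_def X_def \<xi>_def by linarith
      moreover have "U (x + h) \<le> J t u y (\<lambda>s. v s + \<psi> s)"
      proof -
        have "integral {0..t} (\<lambda>s. v s + \<psi> s) = integral {0..t} v + h" unfolding h_def
          by (intro integral_add bmeas_integrable[OF v] bmeas_integrable[OF \<psi>]) auto
        then have "x + h = y + integral {0..t} (\<lambda>s. v s + \<psi> s)" using endp by (simp add: add.assoc)
        then show ?thesis using upper[OF bmeas_add[OF v \<psi>], of y] by simp
      qed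
      moreover have hb: "norm h \<le> \<epsilon> * (B * t)" unfolding h_def using \<phi>b[of t] t by simp
      have "\<bar>U (x + h) - U x - h \<bullet> q\<bar> \<le> \<rho> * norm h" using d(2)[of h] hb \<epsilon>d by simp
      moreover have "\<rho> * norm h \<le> \<epsilon> * (e2 / 3)"
      proof -
        have "\<rho> * norm h \<le> \<rho> * (\<epsilon> * (B * t))" using \<rho> hb by (intro mult_left_mono) auto
        also have "\<dots> = \<epsilon> * (\<rho> * (B * t))" by simp
        also have "\<rho> * (B * t) \<le> e2 / 3" using e2 Bt by (simp add: \<rho>_def field_simps)
        finally show ?thesis using \<epsilon> by simp
      qed
      ultimately have "\<epsilon> * Q \<le> \<eta> + \<epsilon> * (e2 / 3) + C2 * \<epsilon>\<^sup>2" using min by linarith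
      also have "C2 * \<epsilon>\<^sup>2 = \<epsilon> * (C2 * \<epsilon>)" by (simp add: power2_eq_square)
      also have "\<epsilon> * (C2 * \<epsilon>) \<le> \<epsilon> * (e2 / 3)" using \<epsilon>C \<epsilon> by (intro mult_left_mono) auto
      finally have "\<epsilon> * Q \<le> \<epsilon> * e2" by (simp add: \<eta>_def)
      then have Q: "Q \<le> e2" using \<epsilon> by simp
      have "integral {0..t} (\<lambda>s. norm (p s - m s)) \<le> integral {0..t} (\<lambda>s. (norm (p s - m s))\<^sup>2 / (2 * c) + c / 2)"
      proof (rule integral_le)
        have "bmeas t (\<lambda>s. (1 / (2 * c)) *\<^sub>R (norm (p s - m s))\<^sup>2 + c / 2)" by (intro bmeas_intros p m)
        then show "(\<lambda>s. (norm (p s - m s))\<^sup>2 / (2 * c) + c / 2) integrable_on {0..t}"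
          using bmeas_integrable by fastforce
        fix s
        show "norm (p s - m s) \<le> (norm (p s - m s))\<^sup>2 / (2 * c) + c / 2"
          using c sum_squares_bound[of "norm (p s - m s)" c] by (simp add: field_simps power2_eq_square)
      qed (rule bmeas_integrable[OF pm]; simp)
      also have "\<dots> = Q / (2 * c) + t * (c / 2)" unfolding Q_def
        using t has_integral_const_real[of "c / 2" 0 t]
        by (intro integral_unique has_integral_add has_integral_divide integrable_integral bmeas_integrable[OF pm2]) auto
      also have "\<dots> \<le> e2 / (2 * c) + t * (c / 2)" using Q c by (simp add: divide_right_mono)
      also have "\<dots> = e" using c t unfolding e2_def by (simp add: c_def)
      finally have est: "integral {0..t} (\<lambda>s. norm (p s - m s)) \<le> e" .
      have "near_char t x q R e \<xi> m p"
        unfolding near_char_def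
      proof (intro conjI ballI \<xi> m p est)
        fix s assume s: "s \<in> {0..t}"
        show "norm (\<xi> s) \<le> R" using \<xi>b[OF s] Bt B M unfolding R_def by linarith
        show "norm (m s) \<le> R" using mbd[OF s] Bt Pb M norm_ge_zero[of x] unfolding R_def B_def by linarith
        show "norm (p s) \<le> R" using pb[of s] Bt mb M norm_ge_zero[of x] unfolding R_def B_def by linarith
        show "\<xi> s = x - integral {s..t} (\<lambda>r. Hp (\<xi> r) (p r))"
          using split[OF s] by (simp add: p_def)
        show "m s = q + integral {s..t} (\<lambda>r. Hx (\<xi> r) (p r))" by (simp add: m_def X_def)
      qed
      then show ?thesis unfolding \<xi>_def by blast
    qed
    then show ?thesis using \<eta> unfolding near_min_def by blast
  qed
  then show ?thesis using R by blast
qed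

end

section \<open>From approximate to exact characteristics\<close>

lemma C1_interval_continuous: "continuous_on {a..b} \<gamma>" if "C1_interval a b \<gamma>"
proof -
  obtain \<gamma>' where "\<forall>s\<in>{a..b}. (\<gamma> has_vector_derivative \<gamma>' s) (at s within {a..b})"
    using \<open>C1_interval a b \<gamma>\<close> unfolding C1_interval_def by blast
  then show ?thesis
    unfolding continuous_on_eq_continuous_within by (meson has_vector_derivative_continuous)
qed

context hamiltonian
begin

lemma Hp_eq: "H_p H x p = Hp x p" and Hx_eq: "H_x H x p = Hx x p"
  by (auto intro: grad_eqI GDERIV_p GDERIV_x)

text \<open>By stability the approximate solutions are uniformly Cauchy in \<xi> and m, and the
  error of the momentum disappears in L^1. That R is independent of e is essential: it provides one
  Lipschitz constant for the whole family.\<close>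

lemma near_char_limit:
  assumes t: "t > 0" and ex: "\<And>e. e > 0 \<Longrightarrow> \<exists>\<xi> m p. near_char t x q R e \<xi> m p"
  shows "\<exists>\<xi> m. near_char t x q R 0 \<xi> m m"
proof -
  define e where "e = (\<lambda>k::nat. 1 / real (Suc k))"
  have e: "e k > 0" for k by (simp add: e_def)
  have e0: "e \<longlonglongrightarrow> 0" unfolding e_def by (rule LIMSEQ_Suc[OF lim_1_over_n])
  have "\<exists>\<xi> m p. near_char t x q R (e k) \<xi> m p" for k using ex[OF e] .
  then obtain \<xi>k mk pk where nc: "\<And>k. near_char t x q R (e k) (\<xi>k k) (mk k) (pk k)" by metis
  obtain C where C: "C \<ge> 0" and st: "\<And>j k s. s \<in> {0..t} \<Longrightarrow> norm (\<xi>k j s - \<xi>k k s) + norm (mk j s - mk k s) \<le> C * (e j + e k)"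
    using near_char_stable[OF t, of x q R] nc by meson
  have Cauchy: "uniformly_Cauchy_on {0..t} \<xi>k \<and> uniformly_Cauchy_on {0..t} mk"
  proof -
    have "\<exists>N. \<forall>s\<in>{0..t}. \<forall>j\<ge>N. \<forall>k\<ge>N. norm (\<xi>k j s - \<xi>k k s) + norm (mk j s - mk k s) < d" if d: "d > 0" for d
    proof -
      have "d / (2 * (C + 1)) > 0" using d C by simp
      from order_tendstoD(2)[OF e0 this] obtain N where N: "\<And>j. j \<ge> N \<Longrightarrow> e j < d / (2 * (C + 1))"
        unfolding eventually_sequentially by blast
      have "norm (\<xi>k j s - \<xi>k k s) + norm (mk j s - mk k s) < d" if "s \<in> {0..t}" "j \<ge> N" "k \<ge> N" for s j k
      proof -
        have "C * (e j + e k) \<le> (C + 1) * (e j + e k)" using e[of j] e[of k] by (intro mult_right_mono) auto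
        also have "\<dots> < (C + 1) * (2 * (d / (2 * (C + 1))))"
          using N[OF that(2)] N[OF that(3)] C by (intro mult_strict_left_mono) auto
        also have "\<dots> = d" using C by (simp add: field_simps)
        finally show ?thesis using st[OF that(1), of j k] by linarith
      qed
      then show ?thesis by blast
    qed
    note * = this
    show ?thesis unfolding uniformly_Cauchy_on_def dist_norm
    proof (intro conjI allI impI)
      fix d :: real assume "d > 0"
      then obtain N where N: "\<And>s j k. s \<in> {0..t} \<Longrightarrow> j \<ge> N \<Longrightarrow> k \<ge> N \<Longrightarrow> norm (\<xi>k j s - \<xi>k k s) + norm (mk j s - mk k s) < d"
        using * by blast
      show "\<exists>N. \<forall>s\<in>{0..t}. \<forall>j\<ge>N. \<forall>k\<ge>N. norm (\<xi>k j s - \<xi>k k s) < d"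
        using N by (intro exI[of _ N] ballI allI impI) (smt (verit) norm_ge_zero)
      show "\<exists>N. \<forall>s\<in>{0..t}. \<forall>j\<ge>N. \<forall>k\<ge>N. norm (mk j s - mk k s) < d"
        using N by (intro exI[of _ N] ballI allI impI) (smt (verit) norm_ge_zero)
    qed
  qed
  obtain \<xi> m where \<xi>: "uniform_limit {0..t} \<xi>k \<xi> sequentially" and m: "uniform_limit {0..t} mk m sequentially"
    using Cauchy Cauchy_uniformly_convergent unfolding uniformly_convergent_on_def by blast
  have pl: "(\<lambda>k. \<xi>k k s) \<longlonglongrightarrow> \<xi> s" "(\<lambda>k. mk k s) \<longlonglongrightarrow> m s" if "s \<in> {0..t}" for s
    using tendsto_uniform_limitI[OF \<xi> that] tendsto_uniform_limitI[OF m that] by auto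
  have c\<xi>: "continuous_on {0..t} \<xi>"
    by (rule uniform_limit_theorem[OF _ \<xi>]) (auto intro!: always_eventually near_char_continuous(1)[OF nc])
  have cm: "continuous_on {0..t} m"
    by (rule uniform_limit_theorem[OF _ m]) (auto intro!: always_eventually near_char_continuous(2)[OF nc])
  have bm: "bmeas t \<xi>" "bmeas t m" "bmeas t (\<xi>k k)" "bmeas t (mk k)" "bmeas t (pk k)" for k
    using c\<xi> cm nc[of k] by (auto intro: bmeas_continuous simp: near_char_def)
  have nb: "norm (\<xi>k k s) \<le> R" "norm (mk k s) \<le> R" "norm (pk k s) \<le> R" if "s \<in> {0..t}" for s k
    using nc[of k] that unfolding near_char_def by blast+
  have lb: "norm (\<xi> s) \<le> R" "norm (m s) \<le> R" if "s \<in> {0..t}" for s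
    by (rule Lim_bounded[OF tendsto_norm[OF pl(1)[OF that]], of 0]; use nb that in blast)
       (rule Lim_bounded[OF tendsto_norm[OF pl(2)[OF that]], of 0]; use nb that in blast)
  have dl: "norm (\<xi>k k s - \<xi> s) + norm (mk k s - m s) \<le> C * e k" if s: "s \<in> {0..t}" for s k
  proof (rule LIMSEQ_le)
    show "(\<lambda>j. norm (\<xi>k k s - \<xi>k j s) + norm (mk k s - mk j s)) \<longlonglongrightarrow> norm (\<xi>k k s - \<xi> s) + norm (mk k s - m s)"
      by (intro tendsto_intros pl s)
    show "(\<lambda>j. C * (e k + e j)) \<longlonglongrightarrow> C * e k" using e0 by (auto intro!: tendsto_eq_intros)
    show "\<exists>N. \<forall>n\<ge>N. norm (\<xi>k k s - \<xi>k n s) + norm (mk k s - mk n s) \<le> C * (e k + e n)" using st[OF s] by blast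
  qed
  obtain K where "flow_lipschitz Hp Hx R K" using local_lipschitz by blast
  note K = flow_lipschitzD[OF this]
  have dom: "bmeas t (\<lambda>r. K * (C * e k + norm (pk k r - mk k r)))" for k
  proof -
    have "bmeas t (\<lambda>r. K *\<^sub>R (C * e k + norm (pk k r - mk k r)))" by (intro bmeas_intros bm)
    then show ?thesis by simp
  qed
  \<comment> \<open>No uniform convergence of the momenta \<open>pk\<close> is known, so they are
    compared with the limit m through \<open>mk\<close>; the difference of \<open>pk\<close> and
    \<open>mk\<close> becomes small only after integration, in \<open>tail\<close>.\<close>
  have pw: "norm (Hp (\<xi>k k r) (pk k r) - Hp (\<xi> r) (m r)) \<le> K * (C * e k + norm (pk k r - mk k r))"
     "norm (Hx (\<xi>k k r) (pk k r) - Hx (\<xi> r) (m r)) \<le> K * (C * e k + norm (pk k r - mk k r))" if r: "r \<in> {0..t}" for r k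
  proof -
    have "norm (pk k r - m r) \<le> norm (pk k r - mk k r) + norm (mk k r - m r)"
      using norm_triangle_ineq[of "pk k r - mk k r" "mk k r - m r"] by simp
    then have "norm (\<xi>k k r - \<xi> r) + norm (pk k r - m r) \<le> C * e k + norm (pk k r - mk k r)"
      using dl[OF r, of k] by linarith
    then have "K * (norm (\<xi>k k r - \<xi> r) + norm (pk k r - m r)) \<le> K * (C * e k + norm (pk k r - mk k r))"
      using K(1) by (rule mult_left_mono)
    with K(2)[OF nb(1)[OF r, of k] lb(1)[OF r] nb(3)[OF r, of k] lb(2)[OF r]]
    show "norm (Hp (\<xi>k k r) (pk k r) - Hp (\<xi> r) (m r)) \<le> K * (C * e k + norm (pk k r - mk k r))"
     "norm (Hx (\<xi>k k r) (pk k r) - Hx (\<xi> r) (m r)) \<le> K * (C * e k + norm (pk k r - mk k r))" by linarith+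
  qed
  have tail: "integral {s..t} (\<lambda>r. K * (C * e k + norm (pk k r - mk k r))) \<le> K * (C * t + 1) * e k" if s: "s \<in> {0..t}" for s k
  proof -
    have "integral {s..t} (\<lambda>r. K * (C * e k + norm (pk k r - mk k r))) \<le> integral {0..t} (\<lambda>r. K * (C * e k + norm (pk k r - mk k r)))"
      by (rule integral_tail_le[OF dom s]) (use K C e[of k] in auto)
    also have "\<dots> = K * integral {0..t} (\<lambda>r. C * e k + norm (pk k r - mk k r))" by simp
    also have "integral {0..t} (\<lambda>r. C * e k + norm (pk k r - mk k r)) = t * (C * e k) + integral {0..t} (\<lambda>r. norm (pk k r - mk k r))"
      using t by (subst integral_add) (auto intro!: bmeas_integrable[of t] bmeas_intros bm)
    also have "K * \<dots> \<le> K * (t * (C * e k) + e k)"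
      using nc[of k] K(1) by (intro mult_left_mono add_left_mono) (auto simp: near_char_def)
    also have "\<dots> = K * (C * t + 1) * e k" by (simp add: algebra_simps)
    finally show ?thesis .
  qed
  have small: "z = 0" if "\<And>k. norm z \<le> c * e k" for z :: "real^'n" and c
  proof -
    have "norm z \<le> c * 0"
      by (rule LIMSEQ_le_const[OF tendsto_mult_left[OF e0, of c]]) (use that in blast)
    then show ?thesis by simp
  qed
  have "near_char t x q R 0 \<xi> m m"
    unfolding near_char_def
  proof (intro conjI ballI bm)
    fix s assume s: "s \<in> {0..t}"
    show "norm (\<xi> s) \<le> R" "norm (m s) \<le> R" "norm (m s) \<le> R" using lb[OF s] by auto
    have eqs: "\<xi>k k s = x - integral {s..t} (\<lambda>r. Hp (\<xi>k k r) (pk k r))" "mk k s = q + integral {s..t} (\<lambda>r. Hx (\<xi>k k r) (pk k r))" for k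
      using nc[of k] s unfolding near_char_def by blast+
    have d: "norm (\<xi>k k s - \<xi> s) \<le> C * e k" "norm (mk k s - m s) \<le> C * e k" for k
      using dl[OF s, of k] norm_ge_zero[of "\<xi>k k s - \<xi> s"] norm_ge_zero[of "mk k s - m s"] by linarith+
    have "\<xi> s - (x - integral {s..t} (\<lambda>r. Hp (\<xi> r) (m r))) = 0"
    proof (rule small)
      fix k
      have "\<xi> s - (x - integral {s..t} (\<lambda>r. Hp (\<xi> r) (m r)))
          = - (\<xi>k k s - \<xi> s) - (integral {s..t} (\<lambda>r. Hp (\<xi>k k r) (pk k r)) - integral {s..t} (\<lambda>r. Hp (\<xi> r) (m r)))"
        using eqs(1)[of k] by simp
      also have "norm \<dots> \<le> norm (\<xi>k k s - \<xi> s) + norm (integral {s..t} (\<lambda>r. Hp (\<xi>k k r) (pk k r)) - integral {s..t} (\<lambda>r. Hp (\<xi> r) (m r)))"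
        using norm_triangle_ineq4[of "- (\<xi>k k s - \<xi> s)"] by (simp only: norm_minus_cancel)
      also have "\<dots> \<le> C * e k + K * (C * t + 1) * e k"
        using d(1)[of k] integral_diff_le[OF bmeas_Hp[OF bm(3,5)] bmeas_Hp[OF bm(1,2)] dom s pw(1), of k] tail[OF s, of k] by linarith
      finally show "norm (\<xi> s - (x - integral {s..t} (\<lambda>r. Hp (\<xi> r) (m r)))) \<le> (C + K * (C * t + 1)) * e k"
        by (simp only: distrib_right)
    qed
    then show "\<xi> s = x - integral {s..t} (\<lambda>r. Hp (\<xi> r) (m r))" by simp
    have "m s - (q + integral {s..t} (\<lambda>r. Hx (\<xi> r) (m r))) = 0"
    proof (rule small)
      fix k
      have "m s - (q + integral {s..t} (\<lambda>r. Hx (\<xi> r) (m r)))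
          = - (mk k s - m s) + (integral {s..t} (\<lambda>r. Hx (\<xi>k k r) (pk k r)) - integral {s..t} (\<lambda>r. Hx (\<xi> r) (m r)))"
        using eqs(2)[of k] by simp
      also have "norm \<dots> \<le> norm (mk k s - m s) + norm (integral {s..t} (\<lambda>r. Hx (\<xi>k k r) (pk k r)) - integral {s..t} (\<lambda>r. Hx (\<xi> r) (m r)))"
        using norm_triangle_ineq[of "- (mk k s - m s)"] by (simp only: norm_minus_cancel)
      also have "\<dots> \<le> C * e k + K * (C * t + 1) * e k"
        using d(2)[of k] integral_diff_le[OF bmeas_Hx[OF bm(3,5)] bmeas_Hx[OF bm(1,2)] dom s pw(2), of k] tail[OF s, of k] by linarith
      finally show "norm (m s - (q + integral {s..t} (\<lambda>r. Hx (\<xi> r) (m r)))) \<le> (C + K * (C * t + 1)) * e k"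
        by (simp only: distrib_right)
    qed
    then show "m s = q + integral {s..t} (\<lambda>r. Hx (\<xi> r) (m r))" by simp
  qed simp
  then show ?thesis by blast
qed

lemma backward_characteristic_of_near_char:
  assumes t: "t > 0" and nc: "near_char t x q R 0 \<xi> m m"
  shows "backward_characteristic H t x q (restrict \<xi> {0..t}, restrict m {0..t})"
proof -
  have c: "continuous_on {0..t} \<xi>" "continuous_on {0..t} m" by (rule near_char_continuous[OF nc])+
  have cp: "continuous_on {0..t} (\<lambda>s. Hp (\<xi> s) (m s))" "continuous_on {0..t} (\<lambda>s. Hx (\<xi> s) (m s))"
    using continuous_on_compose2[OF Hp_continuous, of "{0..t}" "\<lambda>s. (\<xi> s, m s)"]
      continuous_on_compose2[OF Hx_continuous, of "{0..t}" "\<lambda>s. (\<xi> s, m s)"] c by (auto intro: continuous_intros)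
  have eqs: "restrict \<xi> {0..t} s = x - integral {s..t} (\<lambda>r. Hp (\<xi> r) (m r))"
    "restrict m {0..t} s = q + integral {s..t} (\<lambda>r. Hx (\<xi> r) (m r))" if "s \<in> {0..t}" for s
    using nc that unfolding near_char_def by auto
  have d1: "(restrict \<xi> {0..t} has_vector_derivative Hp (\<xi> s) (m s)) (at s within {0..t})" if s: "s \<in> {0..t}" for s
  proof (rule has_vector_derivative_transform[OF s eqs(1)])
    show "((\<lambda>s. x - integral {s..t} (\<lambda>r. Hp (\<xi> r) (m r))) has_vector_derivative Hp (\<xi> s) (m s)) (at s within {0..t})"
      using integral_has_vector_derivative'[OF cp(1) s] by (auto intro!: derivative_eq_intros)
  qed
  have d2: "(restrict m {0..t} has_vector_derivative - Hx (\<xi> s) (m s)) (at s within {0..t})" if s: "s \<in> {0..t}" for s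
  proof (rule has_vector_derivative_transform[OF s eqs(2)])
    show "((\<lambda>s. q + integral {s..t} (\<lambda>r. Hx (\<xi> r) (m r))) has_vector_derivative - Hx (\<xi> s) (m s)) (at s within {0..t})"
      using integral_has_vector_derivative'[OF cp(2) s] by (auto intro!: derivative_eq_intros)
  qed
  show ?thesis
    unfolding backward_characteristic_def case_prod_conv Hp_eq Hx_eq
  proof (intro conjI ballI)
    show "C1_interval 0 t (restrict \<xi> {0..t})" unfolding C1_interval_def using cp d1 by blast
    show "C1_interval 0 t (restrict m {0..t})" unfolding C1_interval_def
      by (rule exI[of _ "\<lambda>s. - Hx (\<xi> s) (m s)"]) (use cp d2 in \<open>auto intro: continuous_intros\<close>)
    show "restrict \<xi> {0..t} t = x" "restrict m {0..t} t = q" using eqs[of t] t by auto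
    fix s assume s: "s \<in> {0<..<t}"
    then show "(restrict \<xi> {0..t} has_vector_derivative Hp (restrict \<xi> {0..t} s) (restrict m {0..t} s)) (at s)"
      "(restrict m {0..t} has_vector_derivative - Hx (restrict \<xi> {0..t} s) (restrict m {0..t} s)) (at s)"
      using d1[of s] d2[of s] at_within_Icc_at[of 0 s t] by auto
  qed auto
qed

lemma near_char_of_backward_characteristic:
  assumes t: "t > 0" and bc: "backward_characteristic H t x q (\<xi>, m)"
  shows "\<exists>R. near_char t x q R 0 \<xi> m m"
proof -
  have c: "continuous_on {0..t} \<xi>" "continuous_on {0..t} m"
    using bc unfolding backward_characteristic_def by (auto intro: C1_interval_continuous)
  have d: "(\<xi> has_vector_derivative Hp (\<xi> s) (m s)) (at s)" "(m has_vector_derivative - Hx (\<xi> s) (m s)) (at s)" if "s \<in> {0<..<t}" for s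
    using bc that unfolding backward_characteristic_def by (auto simp: Hp_eq Hx_eq)
  have e: "\<xi> t = x" "m t = q" using bc unfolding backward_characteristic_def by auto
  have bm: "bmeas t \<xi>" "bmeas t m" using c by (auto intro: bmeas_continuous)
  obtain R1 R2 where R: "\<forall>s\<in>{0..t}. norm (\<xi> s) \<le> R1" "\<forall>s\<in>{0..t}. norm (m s) \<le> R2"
    using bmeas_bound[OF bm(1)] bmeas_bound[OF bm(2)] by blast
  have "near_char t x q (max R1 R2) 0 \<xi> m m"
    unfolding near_char_def
  proof (intro conjI ballI bm)
    fix s assume s: "s \<in> {0..t}"
    show "norm (\<xi> s) \<le> max R1 R2" "norm (m s) \<le> max R1 R2" "norm (m s) \<le> max R1 R2" using R s by (auto simp: le_max_iff_disj)
    \<comment> \<open>The equations hold on the open interval only; continuity up to the end points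
      allows the interior form of the fundamental theorem.\<close>
    have "((\<lambda>r. Hp (\<xi> r) (m r)) has_integral (\<xi> t - \<xi> s)) {s..t}"
      by (rule fundamental_theorem_of_calculus_interior) (use s d c in \<open>auto intro: continuous_on_subset\<close>)
    then show "\<xi> s = x - integral {s..t} (\<lambda>r. Hp (\<xi> r) (m r))" using e by (simp add: integral_unique)
    have "((\<lambda>r. - Hx (\<xi> r) (m r)) has_integral (m t - m s)) {s..t}"
      by (rule fundamental_theorem_of_calculus_interior) (use s d c in \<open>auto intro: continuous_on_subset\<close>)
    from has_integral_neg[OF this] show "m s = q + integral {s..t} (\<lambda>r. Hx (\<xi> r) (m r))"
      using e by (simp add: integral_unique)
  qed simp
  then show ?thesis by blast
qed

text \<open>Stability with both errors equal to 0, after enlarging the two radii to a common one;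
  extensionality turns agreement on [0, t] into equality of functions.\<close>

lemma backward_characteristic_unique:
  assumes t: "t > 0" and b1: "backward_characteristic H t x q z1" and b2: "backward_characteristic H t x q z2"
  shows "z1 = z2"
proof -
  obtain \<xi>1 m1 \<xi>2 m2 where z: "z1 = (\<xi>1, m1)" "z2 = (\<xi>2, m2)" by (metis prod.exhaust)
  obtain R1 R2 where "near_char t x q R1 0 \<xi>1 m1 m1" "near_char t x q R2 0 \<xi>2 m2 m2"
    using near_char_of_backward_characteristic[OF t] b1 b2 unfolding z by blast
  then have n: "near_char t x q (max R1 R2) 0 \<xi>1 m1 m1" "near_char t x q (max R1 R2) 0 \<xi>2 m2 m2"
    by (auto intro: near_char_mono)
  have eq: "\<xi>1 s = \<xi>2 s \<and> m1 s = m2 s" if "s \<in> {0..t}" for s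
  proof -
    obtain C where "\<And>e1 e2 \<xi>1 m1 p1 \<xi>2 m2 p2 s. near_char t x q (max R1 R2) e1 \<xi>1 m1 p1 \<Longrightarrow>
        near_char t x q (max R1 R2) e2 \<xi>2 m2 p2 \<Longrightarrow> s \<in> {0..t} \<Longrightarrow>
        norm (\<xi>1 s - \<xi>2 s) + norm (m1 s - m2 s) \<le> C * (e1 + e2)"
      using near_char_stable[OF t, of x q "max R1 R2"] by blast
    from this[OF n that] have "norm (\<xi>1 s - \<xi>2 s) + norm (m1 s - m2 s) \<le> 0" by simp
    then have "norm (\<xi>1 s - \<xi>2 s) = 0 \<and> norm (m1 s - m2 s) = 0"
      by (smt (verit) norm_ge_zero)
    then show ?thesis by simp
  qed
  have "\<xi>1 \<in> extensional {0..t}" "\<xi>2 \<in> extensional {0..t}" "m1 \<in> extensional {0..t}" "m2 \<in> extensional {0..t}"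
    using b1 b2 unfolding z backward_characteristic_def by auto
  then show ?thesis unfolding z using eq by (auto intro: extensionalityI)
qed

text \<open>Near-minimisers with velocity bound M produce the characteristic; those with an
  arbitrary bound M' are then compared with it by stability. The two bounds are kept apart because
  the perturbed problem comes with its own.\<close>

lemma characteristic_selection:
  assumes t: "t > 0" and M: "M \<ge> 0" and U: "GDERIV U x :> q"
    and upper: "\<And>y v. bmeas t v \<Longrightarrow> U (y + integral {0..t} v) \<le> J t u y v"
    and near: "\<And>e. e > 0 \<Longrightarrow> \<exists>y v. near_min t u M x (U x + e) y v"
  shows "\<exists>!z. backward_characteristic H t x q z"
    and "M' \<ge> 0 \<Longrightarrow> e > 0 \<Longrightarrow> \<exists>\<eta>>0. \<forall>y v. near_min t u M' x (U x + \<eta>) y v \<longrightarrow> norm (y - fst (THE z. backward_characteristic H t x q z) 0) \<le> e"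
proof -
  obtain R where R: "\<And>e. e > 0 \<Longrightarrow> \<exists>\<eta>>0. \<forall>y v. near_min t u M x (U x + \<eta>) y v \<longrightarrow> (\<exists>m p. near_char t x q R e (\<lambda>s. y + integral {0..s} v) m p)"
    using near_minimiser_near_char[OF t M U upper] by blast
  have "\<exists>\<xi> m p. near_char t x q R e \<xi> m p" if "e > 0" for e
    using R[OF that] near by meson
  from near_char_limit[OF t this] obtain \<xi> m where nc: "near_char t x q R 0 \<xi> m m" by blast
  let ?z = "(restrict \<xi> {0..t}, restrict m {0..t})"
  have bc: "backward_characteristic H t x q ?z" by (rule backward_characteristic_of_near_char[OF t nc])
  then show ex1: "\<exists>!z. backward_characteristic H t x q z"
    using backward_characteristic_unique[OF t] by blast
  have the: "(THE z. backward_characteristic H t x q z) = ?z"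
    by (rule the1_equality[OF ex1 bc])
  assume M': "M' \<ge> 0" and e: "e > 0"
  obtain R' where R': "\<And>e. e > 0 \<Longrightarrow> \<exists>\<eta>>0. \<forall>y v. near_min t u M' x (U x + \<eta>) y v \<longrightarrow> (\<exists>m p. near_char t x q R' e (\<lambda>s. y + integral {0..s} v) m p)"
    using near_minimiser_near_char[OF t M' U upper] by blast
  obtain C where C: "C \<ge> 0" "\<And>e1 e2 \<xi>1 m1 p1 \<xi>2 m2 p2 s. near_char t x q (max R R') e1 \<xi>1 m1 p1 \<Longrightarrow> near_char t x q (max R R') e2 \<xi>2 m2 p2 \<Longrightarrow>
    s \<in> {0..t} \<Longrightarrow> norm (\<xi>1 s - \<xi>2 s) + norm (m1 s - m2 s) \<le> C * (e1 + e2)"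
    using near_char_stable[OF t, of x q "max R R'"] by blast
  have "e / (C + 1) > 0" using e C by simp
  from R'[OF this] obtain \<eta> where \<eta>: "\<eta> > 0" "\<And>y v. near_min t u M' x (U x + \<eta>) y v \<Longrightarrow> (\<exists>m p. near_char t x q R' (e / (C + 1)) (\<lambda>s. y + integral {0..s} v) m p)" by blast
  have "norm (y - fst (THE z. backward_characteristic H t x q z) 0) \<le> e"
    if hyp: "near_min t u M' x (U x + \<eta>) y v" for y v
  proof -
    obtain m1 p1 where n1: "near_char t x q R' (e / (C + 1)) (\<lambda>s. y + integral {0..s} v) m1 p1" using \<eta>(2)[OF hyp] by blast
    have "norm ((y + integral {0..0} v) - \<xi> 0) + norm (m1 0 - m 0) \<le> C * (e / (C + 1) + 0)"
      by (rule C(2)[OF near_char_mono[OF n1] near_char_mono[OF nc]]) (use t in auto)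
    then have "norm (y - \<xi> 0) + norm (m1 0 - m 0) \<le> C * (e / (C + 1) + 0)" by simp
    also have "\<dots> \<le> e" using C(1) e by (simp add: field_simps)
    finally have "norm (y - \<xi> 0) \<le> e" using norm_ge_zero[of "m1 0 - m 0"] by linarith
    then show ?thesis unfolding the using t by simp
  qed
  then show "\<exists>\<eta>>0. \<forall>y v. near_min t u M' x (U x + \<eta>) y v \<longrightarrow> norm (y - fst (THE z. backward_characteristic H t x q z) 0) \<le> e"
    using \<eta>(1) by blast
qed

end

section \<open>Almost everywhere differentiability of semiconcave functions\<close>

text \<open>The hypothesis \<open>support\<close> below says that \<^term>\<open>f\<close> has supporting hyperplanes, i.e. is locally
  convex. On a line the supporting slopes are monotone, hence continuous off a countable set.\<close>

lemma second_difference_null: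
  fixes f :: "'a::euclidean_space \<Rightarrow> real" and G :: "'a \<Rightarrow> 'a"
  assumes f: "continuous_on UNIV f"
    and support: "\<And>x h. x \<in> ball 0 R \<Longrightarrow> norm h \<le> 1 \<Longrightarrow> f x + G x \<bullet> h \<le> f (x + h)"
    and b: "b \<in> Basis"
  shows "{x \<in> ball 0 R. \<not> (\<lambda>n. (f (x + (1 / real (Suc n)) *\<^sub>R b) + f (x - (1 / real (Suc n)) *\<^sub>R b) - 2 * f x) * real (Suc n)) \<longlonglongrightarrow> 0} \<in> null_sets lborel"
proof -
  define \<Delta> where "\<Delta> = (\<lambda>n x. (f (x + (1 / real (Suc n)) *\<^sub>R b) + f (x - (1 / real (Suc n)) *\<^sub>R b) - 2 * f x) * real (Suc n))"
  define N where "N = {x \<in> ball 0 R. \<not> (\<lambda>n. \<Delta> n x) \<longlonglongrightarrow> 0}"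
  have nb: "norm b = 1" "b \<bullet> b = 1" using b by (auto simp: norm_eq_sqrt_inner inner_same_Basis)
  have [measurable]: "\<Delta> n \<in> borel_measurable borel" for n
    unfolding \<Delta>_def
    by (intro borel_measurable_continuous_onI continuous_intros continuous_on_compose2[OF f]) auto
  \<comment> \<open>Only step sizes 1 / (n + 1) are used, which makes the exceptional set Borel;
    convexity later fills in the intermediate step sizes.\<close>
  have [measurable]: "N \<in> sets borel"
    unfolding N_def by measurable
  \<comment> \<open>On each segment parallel to b the exceptional parameters are discontinuities of
    a monotone slope, hence countable.\<close>
  have slice: "{s \<in> {0<..<1}. y + s *\<^sub>R b \<in> N} \<in> null_sets lborel" for y
  proof -
    define A where "A = {s \<in> {0<..<1}. y + s *\<^sub>R b \<in> ball 0 R}"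
    define g where "g = (\<lambda>s. G (y + s *\<^sub>R b) \<bullet> b)"
    have A: "open A"
    proof -
      have "open ((\<lambda>s. y + s *\<^sub>R b) -` ball 0 R)" by (intro open_vimage continuous_intros) auto
      then have "open ({0<..<1} \<inter> (\<lambda>s. y + s *\<^sub>R b) -` ball 0 R)" by (intro open_Int) auto
      then show ?thesis by (simp add: A_def vimage_def Int_def)
    qed
    have sup: "f (y + s *\<^sub>R b) + (r - s) * g s \<le> f (y + r *\<^sub>R b)" if "s \<in> A" "\<bar>r - s\<bar> \<le> 1" for s r
    proof -
      have "norm ((r - s) *\<^sub>R b) \<le> 1" using that nb by simp
      from support[OF _ this, of "y + s *\<^sub>R b"] that
      have "f (y + s *\<^sub>R b) + G (y + s *\<^sub>R b) \<bullet> ((r - s) *\<^sub>R b) \<le> f (y + s *\<^sub>R b + (r - s) *\<^sub>R b)"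
        by (simp add: A_def)
      moreover have "y + s *\<^sub>R b + (r - s) *\<^sub>R b = y + r *\<^sub>R b" by (simp add: algebra_simps)
      ultimately show ?thesis by (simp add: g_def)
    qed
    have "mono_on A g"
    proof (rule mono_onI)
      fix r s assume rs: "r \<in> A" "s \<in> A" "r \<le> s"
      then have "\<bar>r - s\<bar> \<le> 1" "\<bar>s - r\<bar> \<le> 1" by (auto simp: A_def)
      from sup[OF rs(2) this(1)] sup[OF rs(1) this(2)]
      have "0 \<le> (s - r) * (g s - g r)" by (simp add: algebra_simps)
      then show "g r \<le> g s" using rs(3) by (cases "r = s") (auto simp: zero_le_mult_iff)
    qed
    then have "countable {s \<in> A. \<not> isCont g s}" by (rule mono_on_ctble_discont_open[OF A])
    \<comment> \<open>Supporting lines at s and at s + e, s - e squeeze the second difference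
      quotient between 0 and \<open>g (s + e n) - g (s - e n)\<close>, which vanishes at continuity
      points of the slope g.\<close>
    moreover have "{s \<in> {0<..<1}. y + s *\<^sub>R b \<in> N} \<subseteq> {s \<in> A. \<not> isCont g s}"
    proof safe
      fix s assume s: "s \<in> {0<..<1}" "y + s *\<^sub>R b \<in> N"
      then show sA: "s \<in> A" by (auto simp: N_def A_def)
      assume cont: "isCont g s"
      obtain d where d: "d > 0" "\<And>r. \<bar>r - s\<bar> < d \<Longrightarrow> r \<in> A"
        using A sA unfolding open_dist dist_real_def by blast
      define e where "e = (\<lambda>n. 1 / real (Suc n))"
      have e0: "e \<longlonglongrightarrow> 0" unfolding e_def by (rule LIMSEQ_Suc[OF lim_1_over_n])
      have ep: "0 < e n" "e n \<le> 1" for n by (auto simp: e_def)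
      have "(\<lambda>n. g (s + e n)) \<longlonglongrightarrow> g s" "(\<lambda>n. g (s - e n)) \<longlonglongrightarrow> g s"
        by (rule isCont_tendsto_compose[OF cont]; use e0 in \<open>auto intro!: tendsto_eq_intros\<close>)+
      then have lim: "(\<lambda>n. g (s + e n) - g (s - e n)) \<longlonglongrightarrow> 0" using tendsto_diff by fastforce
      have "\<forall>\<^sub>F n in sequentially. e n < d" using e0 d(1) by (rule order_tendstoD)
      then have "\<forall>\<^sub>F n in sequentially. norm (\<Delta> n (y + s *\<^sub>R b)) \<le> g (s + e n) - g (s - e n)"
      proof eventually_elim
        case (elim n)
        have m: "s + e n \<in> A" "s - e n \<in> A" using elim ep[of n] by (auto intro!: d(2))
        have D: "\<Delta> n (y + s *\<^sub>R b) = (f (y + (s + e n) *\<^sub>R b) + f (y + (s - e n) *\<^sub>R b) - 2 * f (y + s *\<^sub>R b)) / e n"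
          by (simp add: \<Delta>_def e_def algebra_simps)
        have 1: "f (y + (s + e n) *\<^sub>R b) - e n * g (s + e n) \<le> f (y + s *\<^sub>R b)"
          using sup[OF m(1), of s] ep[of n] by simp
        have 2: "f (y + (s - e n) *\<^sub>R b) + e n * g (s - e n) \<le> f (y + s *\<^sub>R b)"
          using sup[OF m(2), of s] ep[of n] by simp
        have 3: "f (y + s *\<^sub>R b) + e n * g s \<le> f (y + (s + e n) *\<^sub>R b)"
          using sup[OF sA, of "s + e n"] ep[of n] by simp
        have 4: "f (y + s *\<^sub>R b) - e n * g s \<le> f (y + (s - e n) *\<^sub>R b)"
          using sup[OF sA, of "s - e n"] ep[of n] by simp
        have "0 \<le> \<Delta> n (y + s *\<^sub>R b)" unfolding D using 3 4 ep[of n] by (intro divide_nonneg_pos) linarith+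
        moreover have "\<Delta> n (y + s *\<^sub>R b) \<le> g (s + e n) - g (s - e n)"
        proof -
          have "f (y + (s + e n) *\<^sub>R b) + f (y + (s - e n) *\<^sub>R b) - 2 * f (y + s *\<^sub>R b) \<le> (g (s + e n) - g (s - e n)) * e n"
          proof -
            have "(g (s + e n) - g (s - e n)) * e n = e n * g (s + e n) - e n * g (s - e n)" by (simp add: algebra_simps)
            then show ?thesis using 1 2 by linarith
          qed
          then show ?thesis unfolding D using ep[of n] by (simp add: pos_divide_le_eq)
        qed
        ultimately show ?case by simp
      qed
      then have "(\<lambda>n. \<Delta> n (y + s *\<^sub>R b)) \<longlonglongrightarrow> 0" using lim by (rule Lim_null_comparison)
      then show False using s by (simp add: N_def)
    qed
    ultimately show ?thesis by (meson countable_imp_null_set_lborel countable_subset)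
  qed
  \<comment> \<open>By translation invariance the measure of N is the average over s in (0, 1) of
    its translates by s b; exchanging the integrals turns this average into an integral over slices,
    without splitting off a coordinate.\<close>
  have "emeasure lborel N = (\<integral>\<^sup>+s. indicator {0<..<1::real} s * emeasure lborel N \<partial>lborel)"
    by (subst nn_integral_multc) auto
  also have "\<dots> = (\<integral>\<^sup>+s. (\<integral>\<^sup>+y. indicator {0<..<1} s * indicator N (y + s *\<^sub>R b) \<partial>lborel) \<partial>lborel)"
  proof (rule nn_integral_cong)
    fix s :: real
    have "emeasure lborel N = (\<integral>\<^sup>+y. indicator N y \<partial>distr lborel borel ((+) (s *\<^sub>R b)))"
      by (simp add: lborel_distr_plus)
    also have "\<dots> = (\<integral>\<^sup>+y. indicator N (s *\<^sub>R b + y) \<partial>lborel)"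
      by (rule nn_integral_distr) auto
    finally have "emeasure lborel N = (\<integral>\<^sup>+y. indicator N (y + s *\<^sub>R b) \<partial>lborel)" by (simp add: add.commute)
    then show "indicator {0<..<1} s * emeasure lborel N = (\<integral>\<^sup>+y. indicator {0<..<1} s * indicator N (y + s *\<^sub>R b) \<partial>lborel)"
      by (simp add: nn_integral_cmult)
  qed
  also have "\<dots> = (\<integral>\<^sup>+y. (\<integral>\<^sup>+s. indicator {0<..<1} s * indicator N (y + s *\<^sub>R b) \<partial>lborel) \<partial>lborel)"
    by (rule lborel_pair.Fubini'[symmetric]) measurable
  also have "\<dots> = (\<integral>\<^sup>+y. 0 \<partial>(lborel :: 'a measure))"
  proof (rule nn_integral_cong)
    fix y
    have "(\<integral>\<^sup>+s. indicator {0<..<1} s * indicator N (y + s *\<^sub>R b) \<partial>lborel)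
        = (\<integral>\<^sup>+s. indicator {s \<in> {0<..<1}. y + s *\<^sub>R b \<in> N} s \<partial>lborel)"
      by (intro nn_integral_cong) (auto simp: indicator_def)
    also have "\<dots> = emeasure lborel {s \<in> {0<..<1}. y + s *\<^sub>R b \<in> N}"
      using slice[of y] by (intro nn_integral_indicator) auto
    also have "\<dots> = 0" using slice[of y] by auto
    finally show "(\<integral>\<^sup>+s. indicator {0<..<1} s * indicator N (y + s *\<^sub>R b) \<partial>lborel) = 0" .
  qed
  finally have "emeasure lborel N = 0" by simp
  then have "N \<in> null_sets lborel" by auto
  then show ?thesis unfolding N_def \<Delta>_def .
qed

text \<open>The excess a over the supporting plane at x is nonnegative and locally convex, and its
  sum at the two points r b and - r b is the second difference. Smallness along the axes spreads to
  all directions, because h is the mean of the points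
  \<open>(N * (h \<bullet> b)) *\<^sub>R b\<close> over the N basis vectors.\<close>

lemma second_difference_differentiable:
  fixes f :: "'a::euclidean_space \<Rightarrow> real" and G :: "'a \<Rightarrow> 'a"
  assumes support: "\<And>x h. x \<in> ball 0 R \<Longrightarrow> norm h \<le> 1 \<Longrightarrow> f x + G x \<bullet> h \<le> f (x + h)"
    and x: "x \<in> ball 0 R"
    and lim: "\<And>b. b \<in> Basis \<Longrightarrow> (\<lambda>n. (f (x + (1 / real (Suc n)) *\<^sub>R b) + f (x - (1 / real (Suc n)) *\<^sub>R b) - 2 * f x) * real (Suc n)) \<longlonglongrightarrow> 0"
  shows "(f has_derivative (\<lambda>h. h \<bullet> G x)) (at x)"
proof -
  define N where "N = real DIM('a)"
  have N: "N \<ge> 1" unfolding N_def using DIM_positive by (simp add: Suc_leI)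
  define a where "a = (\<lambda>k. f (x + k) - f x - G x \<bullet> k)"
  have a0: "a k \<ge> 0" if "norm k \<le> 1" for k using support[OF x that] by (simp add: a_def)
  obtain d where d: "d > 0" "\<And>k. norm k < d \<Longrightarrow> x + k \<in> ball 0 R"
  proof -
    have "open (ball (0::'a) R)" by simp
    then obtain d where "d > 0" "\<And>z. dist z x < d \<Longrightarrow> z \<in> ball 0 R" using x unfolding open_dist by blast
    from this(1) this(2)[of "x + k" for k] show ?thesis by (intro that[of d]) (auto simp: dist_norm)
  qed
  \<comment> \<open>Convexity of a along rays from x, read off from the supporting plane at the
    intermediate point.\<close>
  have conv: "a (l *\<^sub>R k) \<le> l * a k" if l: "0 \<le> l" "l \<le> 1" and k: "norm k < min d 1" for l k
  proof -
    have lk: "norm (l *\<^sub>R k) \<le> norm k" "norm ((1 - l) *\<^sub>R k) \<le> norm k"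
      using l by (auto simp: mult_left_le_one_le)
    let ?z = "x + l *\<^sub>R k"
    have z: "?z \<in> ball 0 R" using lk k by (intro d(2)) auto
    have "f ?z + G ?z \<bullet> ((1 - l) *\<^sub>R k) \<le> f (?z + (1 - l) *\<^sub>R k)" by (rule support[OF z]) (use lk k in auto)
    moreover have "?z + (1 - l) *\<^sub>R k = x + k" by (simp add: algebra_simps)
    ultimately have 1: "f ?z + (1 - l) * (G ?z \<bullet> k) \<le> f (x + k)" by simp
    have "f ?z + G ?z \<bullet> (- l *\<^sub>R k) \<le> f (?z + (- l *\<^sub>R k))" by (rule support[OF z]) (use lk k in auto)
    then have 2: "f ?z - l * (G ?z \<bullet> k) \<le> f x" by simp
    have "l * (f ?z + (1 - l) * (G ?z \<bullet> k)) + (1 - l) * (f ?z - l * (G ?z \<bullet> k)) \<le> l * f (x + k) + (1 - l) * f x"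
      using 1 2 l by (intro add_mono mult_left_mono) auto
    then have "f ?z \<le> l * f (x + k) + (1 - l) * f x" by (simp add: algebra_simps)
    then show ?thesis by (simp add: a_def algebra_simps)
  qed
  show ?thesis
    unfolding has_derivative_at_alt
  proof (intro conjI allI impI)
    show "bounded_linear (\<lambda>h. h \<bullet> G x)" by (rule bounded_linear_inner_left)
    fix e :: real assume e: "e > 0"
    define e' where "e' = e / N"
    have e': "e' > 0" using e N by (simp add: e'_def)
    have ev: "\<forall>\<^sub>F n in sequentially. \<forall>b\<in>Basis. (f (x + (1 / real (Suc n)) *\<^sub>R b) + f (x - (1 / real (Suc n)) *\<^sub>R b) - 2 * f x) * real (Suc n) < e'"
      by (intro eventually_ball_finite finite_Basis ballI) (rule order_tendstoD(2)[OF lim e'])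
    have "\<forall>\<^sub>F n in sequentially. 1 / real (Suc n) < min d 1"
      by (rule order_tendstoD(2)[OF LIMSEQ_Suc[OF lim_1_over_n]]) (use d in auto)
    with ev have "\<forall>\<^sub>F n in sequentially. (\<forall>b\<in>Basis. (f (x + (1 / real (Suc n)) *\<^sub>R b) + f (x - (1 / real (Suc n)) *\<^sub>R b) - 2 * f x) * real (Suc n) < e') \<and> 1 / real (Suc n) < min d 1"
      by (rule eventually_conj)
    then obtain n where n: "\<And>b. b \<in> Basis \<Longrightarrow> (f (x + (1 / real (Suc n)) *\<^sub>R b) + f (x - (1 / real (Suc n)) *\<^sub>R b) - 2 * f x) * real (Suc n) < e'"
      "1 / real (Suc n) < min d 1" unfolding eventually_sequentially by blast
    define r where "r = 1 / real (Suc n)"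
    have r: "r > 0" "r < d" "r < 1" using n(2) by (auto simp: r_def)
    have ab: "a (s *\<^sub>R b) \<le> e' * \<bar>s\<bar>" if b: "b \<in> Basis" and s: "\<bar>s\<bar> \<le> r" for b s
    proof -
      have nr: "norm (r *\<^sub>R b) = r" "norm (- (r *\<^sub>R b)) = r" using b r by auto
      have sum: "a (r *\<^sub>R b) + a (- (r *\<^sub>R b)) \<le> e' * r"
      proof -
        have "(f (x + r *\<^sub>R b) + f (x - r *\<^sub>R b) - 2 * f x) * real (Suc n) < e'" using n(1)[OF b] by (simp only: r_def)
        then have "f (x + r *\<^sub>R b) + f (x - r *\<^sub>R b) - 2 * f x < e' * r" by (simp add: r_def field_simps)
        then show ?thesis by (simp add: a_def)
      qed
      have p: "a (r *\<^sub>R b) \<le> e' * r" "a (- (r *\<^sub>R b)) \<le> e' * r"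
        using sum a0[of "r *\<^sub>R b"] a0[of "- (r *\<^sub>R b)"] nr r by auto
      show ?thesis
      proof (cases "s \<ge> 0")
        case True
        have "a (s *\<^sub>R b) = a ((s / r) *\<^sub>R (r *\<^sub>R b))" using r by simp
        also have "\<dots> \<le> (s / r) * a (r *\<^sub>R b)" using True s r nr by (intro conv) auto
        also have "\<dots> \<le> (s / r) * (e' * r)" using True r p by (intro mult_left_mono) auto
        finally show ?thesis using True r by (simp add: mult.commute)
      next
        case False
        have sr: "0 \<le> - s / r" "- s / r \<le> 1" using False s r(1) by (auto simp: field_simps)
        have "a (s *\<^sub>R b) = a ((- s / r) *\<^sub>R (- (r *\<^sub>R b)))" using r by simp
        also have "a ((- s / r) *\<^sub>R (- (r *\<^sub>R b))) \<le> (- s / r) * a (- (r *\<^sub>R b))" using sr r nr by (intro conv) auto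
        also have "\<dots> \<le> (- s / r) * (e' * r)" using sr(1) p(2) by (intro mult_left_mono)
        finally show ?thesis using False r by (simp add: mult.commute)
      qed
    qed
    \<comment> \<open>The radius r / (2 N) keeps the stretched axis points within r, where
      \<open>ab\<close> applies, and their differences to h within norm 1, as \<open>support\<close>
      demands.\<close>
    have main: "a h \<le> e * norm h" if h: "norm h < r / (2 * N)" for h
    proof -
      have hN: "N * norm h < r / 2" using h N by (simp add: field_simps)
      have hle: "norm h \<le> N * norm h" using mult_right_mono[OF N, of "norm h"] by simp
      have z: "x + h \<in> ball 0 R" using hN hle r by (intro d(2)) auto
      have comp: "\<bar>N * (h \<bullet> b)\<bar> \<le> N * norm h" if "b \<in> Basis" for b
        using Basis_le_norm[OF that, of h] N by (simp add: abs_mult mult_left_mono)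
      \<comment> \<open>Jensen's inequality is run by hand with the supporting plane at x + h:
        summed over the basis, its linear terms cancel because the displacements from h add up to
        0.\<close>
      have each: "f (x + h) + G (x + h) \<bullet> ((N * (h \<bullet> b)) *\<^sub>R b - h) \<le> f x + G x \<bullet> ((N * (h \<bullet> b)) *\<^sub>R b) + e' * (N * norm h)"
        if b: "b \<in> Basis" for b
      proof -
        have "norm ((N * (h \<bullet> b)) *\<^sub>R b - h) \<le> 1"
          using norm_triangle_ineq4[of "(N * (h \<bullet> b)) *\<^sub>R b" h] comp[OF b] hN hle r b by auto
        then have "f (x + h) + G (x + h) \<bullet> ((N * (h \<bullet> b)) *\<^sub>R b - h) \<le> f (x + h + ((N * (h \<bullet> b)) *\<^sub>R b - h))"
          by (rule support[OF z])
        also have "x + h + ((N * (h \<bullet> b)) *\<^sub>R b - h) = x + (N * (h \<bullet> b)) *\<^sub>R b" by simp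
        also have "f (x + (N * (h \<bullet> b)) *\<^sub>R b) = f x + G x \<bullet> ((N * (h \<bullet> b)) *\<^sub>R b) + a ((N * (h \<bullet> b)) *\<^sub>R b)"
          by (simp add: a_def)
        also have "a ((N * (h \<bullet> b)) *\<^sub>R b) \<le> e' * \<bar>N * (h \<bullet> b)\<bar>"
          by (rule ab[OF b]) (use comp[OF b] hN r in linarith)
        also have "e' * \<bar>N * (h \<bullet> b)\<bar> \<le> e' * (N * norm h)" using comp[OF b] e' by (intro mult_left_mono) auto
        finally show ?thesis by simp
      qed
      have rep: "(\<Sum>b\<in>Basis. (N * (h \<bullet> b)) *\<^sub>R b) = N *\<^sub>R h"
        using euclidean_representation[of h] by (simp flip: scaleR_scaleR scaleR_sum_right)
      have "(\<Sum>b\<in>(Basis::'a set). f (x + h) + G (x + h) \<bullet> ((N * (h \<bullet> b)) *\<^sub>R b - h))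
          \<le> (\<Sum>b\<in>(Basis::'a set). f x + G x \<bullet> ((N * (h \<bullet> b)) *\<^sub>R b) + e' * (N * norm h))"
        by (rule sum_mono) (rule each)
      also have "(\<Sum>b\<in>(Basis::'a set). f (x + h) + G (x + h) \<bullet> ((N * (h \<bullet> b)) *\<^sub>R b - h)) = N * f (x + h)"
      proof -
        have "(\<Sum>b\<in>(Basis::'a set). G (x + h) \<bullet> ((N * (h \<bullet> b)) *\<^sub>R b - h)) = G (x + h) \<bullet> (\<Sum>b\<in>(Basis::'a set). (N * (h \<bullet> b)) *\<^sub>R b - h)"
          by (rule inner_sum_right[symmetric])
        also have "(\<Sum>b\<in>(Basis::'a set). (N * (h \<bullet> b)) *\<^sub>R b - h) = 0"
          unfolding sum_subtractf rep by (simp add: N_def sum_constant_scaleR)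
        finally have "(\<Sum>b\<in>(Basis::'a set). G (x + h) \<bullet> ((N * (h \<bullet> b)) *\<^sub>R b - h)) = 0" by simp
        then show ?thesis unfolding sum.distrib by (simp add: N_def)
      qed
      also have "(\<Sum>b\<in>(Basis::'a set). f x + G x \<bullet> ((N * (h \<bullet> b)) *\<^sub>R b) + e' * (N * norm h)) = N * f x + N * (G x \<bullet> h) + N * (e' * (N * norm h))"
      proof -
        have "(\<Sum>b\<in>(Basis::'a set). G x \<bullet> ((N * (h \<bullet> b)) *\<^sub>R b)) = G x \<bullet> (\<Sum>b\<in>(Basis::'a set). (N * (h \<bullet> b)) *\<^sub>R b)"
          by (rule inner_sum_right[symmetric])
        also have "\<dots> = N * (G x \<bullet> h)" unfolding rep by simp
        finally show ?thesis unfolding sum.distrib by (simp only: sum_constant N_def)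
      qed
      finally have "N * f (x + h) \<le> N * (f x + G x \<bullet> h + e' * (N * norm h))" by (simp only: distrib_left)
      then have "f (x + h) \<le> f x + G x \<bullet> h + e' * (N * norm h)" using N by simp
      moreover have "e' * (N * norm h) = e * norm h" using N by (simp add: e'_def)
      ultimately show ?thesis by (simp add: a_def)
    qed
    show "\<exists>d>0. \<forall>y. norm (y - x) < d \<longrightarrow> norm (f y - f x - (y - x) \<bullet> G x) \<le> e * norm (y - x)"
    proof (intro exI[of _ "r / (2 * N)"] conjI allI impI)
      show "r / (2 * N) > 0" using r N by simp
      fix y assume y: "norm (y - x) < r / (2 * N)"
      have "r / (2 * N) \<le> 1" using r N by (simp add: field_simps)
      then have "0 \<le> a (y - x)" using y by (intro a0) linarith
      then show "norm (f y - f x - (y - x) \<bullet> G x) \<le> e * norm (y - x)"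
        using main[OF y] by (simp add: a_def inner_commute)
    qed
  qed
qed

text \<open>On each ball, \<open>C * (y \<bullet> y) - u y\<close> has supporting planes and differs
  from - u by a smooth function. As C depends on the ball, countably many balls are used.\<close>

lemma semiconcave_AE_differentiable:
  fixes u :: "'a::euclidean_space \<Rightarrow> real"
  assumes u: "continuous_on UNIV u"
    and sc: "\<And>R. \<exists>C. \<forall>x. norm x \<le> R \<longrightarrow> (\<exists>g. \<forall>h. norm h \<le> 1 \<longrightarrow> u (x + h) \<le> u x + g \<bullet> h + C * (norm h)\<^sup>2)"
  shows "AE x in lebesgue. u differentiable (at x)"
proof -
  have "AE x in lborel. x \<in> ball 0 (real n) \<longrightarrow> u differentiable (at x)" for n
  proof -
    let ?B = "ball (0::'a) (real n)"
    obtain C where "\<And>x. norm x \<le> real n \<Longrightarrow> \<exists>g. \<forall>h. norm h \<le> 1 \<longrightarrow> u (x + h) \<le> u x + g \<bullet> h + C * (norm h)\<^sup>2"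
      using sc by blast
    then obtain g where g: "\<And>x h. norm x \<le> real n \<Longrightarrow> norm h \<le> 1 \<Longrightarrow> u (x + h) \<le> u x + g x \<bullet> h + C * (norm h)\<^sup>2"
      by metis
    define f where "f = (\<lambda>y. C * (y \<bullet> y) - u y)"
    define G where "G = (\<lambda>x. (2 * C) *\<^sub>R x - g x)"
    have fc: "continuous_on UNIV f" unfolding f_def by (intro continuous_intros u)
    have support: "f x + G x \<bullet> h \<le> f (x + h)" if "x \<in> ?B" "norm h \<le> 1" for x h
    proof -
      have "C * ((x + h) \<bullet> (x + h)) = C * (x \<bullet> x) + (2 * C) * (x \<bullet> h) + C * (norm h)\<^sup>2"
        by (simp add: power2_norm_eq_inner inner_add_left inner_add_right inner_commute algebra_simps)
      then show ?thesis using g[of x h] that by (simp add: f_def G_def inner_diff_left)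
    qed
    have "AE x in lborel. \<forall>b\<in>Basis. x \<notin> {x \<in> ?B. \<not> (\<lambda>k. (f (x + (1 / real (Suc k)) *\<^sub>R b) + f (x - (1 / real (Suc k)) *\<^sub>R b) - 2 * f x) * real (Suc k)) \<longlonglongrightarrow> 0}"
      by (intro AE_finite_allI finite_Basis AE_not_in second_difference_null[OF fc support])
    then show ?thesis
    proof eventually_elim
      case (elim x)
      show ?case
      proof
        assume x: "x \<in> ?B"
        have "(f has_derivative (\<lambda>h. h \<bullet> G x)) (at x)"
          by (rule second_difference_differentiable[OF support x]) (use elim x in blast)+
        then have "((\<lambda>y. C * (y \<bullet> y) - f y) has_derivative (\<lambda>h. C * (x \<bullet> h + h \<bullet> x) - h \<bullet> G x)) (at x)"
          by (intro has_derivative_diff has_derivative_mult_right has_derivative_inner has_derivative_ident)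
        then show "u differentiable (at x)" by (auto simp: f_def differentiable_def)
      qed
    qed
  qed
  then have "AE x in lborel. \<forall>n. x \<in> ball 0 (real n) \<longrightarrow> u differentiable (at x)"
    unfolding AE_all_countable by blast
  then have "AE x in lborel. u differentiable (at x)"
  proof eventually_elim
    case (elim x)
    obtain n :: nat where "norm x < real n" using reals_Archimedean2 by blast
    then show ?case using elim by auto
  qed
  then show ?thesis by (rule AE_completion)
qed

section \<open>The value function and its difference quotients\<close>

lemma set_integrable_continuous_compact:
  fixes f :: "'a::euclidean_space \<Rightarrow> real"
  assumes "compact K" "continuous_on K f"
  shows "set_integrable lebesgue K f"
proof -
  have "integrable lborel (\<lambda>x. indicator K x *\<^sub>R f x)"
    using assms by (rule borel_integrable_compact)
  then show ?thesis
    unfolding set_integrable_def by (subst integrable_completion) auto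
qed

context hamiltonian
begin

section \<open>Lipschitz and semiconcavity bounds for the value function\<close>

lemma S_plus_upper:
  assumes "t > 0" "K-lipschitz_on UNIV u" "bmeas t v"
  shows "S_plus H t u (y + integral {0..t} v) \<le> J t u y v"
  using S_plus_bounds[OF assms(1) lipschitz_on_nonneg[OF assms(2)]] assms(2,3) by blast

lemma S_plus_near_minimiser:
  assumes "t > 0" "K \<ge> 0"
  obtains M where "M \<ge> 0" "\<And>u x e. K-lipschitz_on UNIV u \<Longrightarrow> e > 0 \<Longrightarrow>
    \<exists>y v. near_min t u M x (S_plus H t u x + e) y v"
  using S_plus_bounds[OF assms] by blast

text \<open>Translating a whole near-minimiser by h costs at most \<open>CL * t * norm h\<close>
  along the curve and \<open>K * norm h\<close> at its start.\<close>

lemma S_plus_lipschitz: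
  assumes t: "t > 0" and u: "K-lipschitz_on UNIV u"
  shows "(CL * t + K)-lipschitz_on UNIV (S_plus H t u)"
proof -
  have K: "K \<ge> 0" by (rule lipschitz_on_nonneg[OF u])
  obtain M where M: "\<And>u x e. K-lipschitz_on UNIV u \<Longrightarrow> e > 0 \<Longrightarrow>
    \<exists>y v. near_min t u M x (S_plus H t u x + e) y v"
    using S_plus_near_minimiser[OF t K] by metis
  have le: "S_plus H t u (x + h) \<le> S_plus H t u x + (CL * t + K) * norm h" for x h
  proof (rule field_le_epsilon)
    fix e :: real assume "e > 0"
    then obtain y v where v: "bmeas t v" "y + integral {0..t} v = x" "J t u y v \<le> S_plus H t u x + e"
      using M[OF u] unfolding near_min_def by blast
    have xh: "x + h = (y + h) + integral {0..t} v" using v(2) by (simp add: add_ac)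
    have i: "bmeas t (\<lambda>s. L (z + integral {0..s} v) (v s))" for z
      by (intro bmeas_L bmeas_intros bmeas_integral v)
    have "integral {0..t} (\<lambda>s. L ((y + h) + integral {0..s} v) (v s))
        \<le> integral {0..t} (\<lambda>s. L (y + integral {0..s} v) (v s) + CL * norm h)"
    proof (rule integral_le)
      show "(\<lambda>s. L ((y + h) + integral {0..s} v) (v s)) integrable_on {0..t}"
        by (rule bmeas_integrable[OF i]) auto
      show "(\<lambda>s. L (y + integral {0..s} v) (v s) + CL * norm h) integrable_on {0..t}"
        by (rule bmeas_integrable[of t]) (intro bmeas_add i bmeas_const, auto)
      show "L ((y + h) + integral {0..s} v) (v s) \<le> L (y + integral {0..s} v) (v s) + CL * norm h" for s
        using L_lipschitz_x[of "(y + h) + integral {0..s} v" "v s" "y + integral {0..s} v"] by (simp add: algebra_simps)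
    qed
    also have "\<dots> = integral {0..t} (\<lambda>s. L (y + integral {0..s} v) (v s)) + CL * norm h * t"
      using t bmeas_integrable[OF i] by (subst integral_add) auto
    finally have 1: "integral {0..t} (\<lambda>s. L ((y + h) + integral {0..s} v) (v s)) \<le> integral {0..t} (\<lambda>s. L (y + integral {0..s} v) (v s)) + CL * norm h * t" .
    have "u (y + h) \<le> u y + K * norm h"
      using lipschitz_onD[OF u, of "y + h" y] by (simp add: dist_norm abs_le_iff)
    then have "J t u (y + h) v \<le> J t u y v + (CL * t + K) * norm h"
      using 1 unfolding J_def by (simp add: algebra_simps)
    then show "S_plus H t u (x + h) \<le> S_plus H t u x + (CL * t + K) * norm h + e"
      using S_plus_upper[OF t u v(1), of "y + h"] v(3) unfolding xh by linarith
  qed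
  show ?thesis
  proof (rule lipschitz_onI)
    fix x y :: "real^'n"
    show "dist (S_plus H t u x) (S_plus H t u y) \<le> (CL * t + K) * dist x y"
      using le[of x "y - x"] le[of y "x - y"] by (simp add: dist_norm abs_le_iff norm_minus_commute)
  qed (use CL_nonneg t K in auto)
qed

text \<open>The variation \<open>\<phi> s = (s / t) h\<close> fixes the starting point and moves the end point by \<open>h\<close>.\<close>

lemma S_plus_semiconcave:
  assumes t: "t > 0" and u: "K-lipschitz_on UNIV u"
  shows "\<exists>C. \<forall>x. norm x \<le> R \<longrightarrow> (\<exists>g. \<forall>h. norm h \<le> 1 \<longrightarrow>
    S_plus H t u (x + h) \<le> S_plus H t u x + g \<bullet> h + C * (norm h)\<^sup>2)"
proof -
  have K: "K \<ge> 0" by (rule lipschitz_on_nonneg[OF u])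
  obtain M where M: "M \<ge> 0" and near: "\<And>u x e. K-lipschitz_on UNIV u \<Longrightarrow> e > 0 \<Longrightarrow>
    \<exists>y v. near_min t u M x (S_plus H t u x + e) y v"
    using S_plus_near_minimiser[OF t K] by metis
  obtain Pb where Pb: "Pb \<ge> 0" "\<And>x q. norm q \<le> M \<Longrightarrow> norm (P x q) \<le> Pb" using P_bound by blast
  define B where "B = Pb + CL * t"
  define R' where "R' = \<bar>R\<bar> + M * t + M + 1"
  obtain C where C: "C \<ge> 0" and pert: "\<And>u y v \<psi>. bmeas t v \<Longrightarrow> bmeas t \<psi> \<Longrightarrow>
     (\<forall>s\<in>{0..t}. norm (y + integral {0..s} v) \<le> R' \<and> norm (y + integral {0..s} v + integral {0..s} \<psi>) \<le> R' \<and> norm (v s) \<le> R') \<Longrightarrow>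
     J t u y (\<lambda>s. v s + \<psi> s) \<le> J t u y v +
       integral {0..t} (\<lambda>s. \<psi> s \<bullet> (P (y + integral {0..s} v) (v s) -
          integral {s..t} (\<lambda>r. Hx (y + integral {0..r} v) (P (y + integral {0..r} v) (v r))))) +
       C * integral {0..t} (\<lambda>s. (norm (integral {0..s} \<psi>))\<^sup>2 + (norm (\<psi> s))\<^sup>2)"
    using J_perturb[of R'] by blast
  define C' where "C' = C * ((1 + (1 / t)\<^sup>2) * t)"
  have approx: "\<exists>g\<in>cball 0 B. \<forall>h. norm h \<le> 1 \<longrightarrow> S_plus H t u (x + h) \<le> S_plus H t u x + e + g \<bullet> h + C' * (norm h)\<^sup>2"
    if x: "norm x \<le> R" and e: "e > 0" for x e
  proof -
    obtain y v where v: "bmeas t v" and vM: "\<And>s. norm (v s) \<le> M" and endp: "y + integral {0..t} v = x" and min: "J t u y v \<le> S_plus H t u x + e"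
      using near[OF u e, of x] unfolding near_min_def by blast
    define \<xi> where "\<xi> = (\<lambda>s. y + integral {0..s} v)"
    define p where "p = (\<lambda>s. P (\<xi> s) (v s))"
    define X where "X = (\<lambda>s. Hx (\<xi> s) (p s))"
    define Z where "Z = (\<lambda>s. p s - integral {s..t} X)"
    \<comment> \<open>The variation has constant velocity h / t, so the first variation is h paired
      with the time average of Z.\<close>
    define g where "g = (1 / t) *\<^sub>R integral {0..t} Z"
    have \<xi>: "bmeas t \<xi>" unfolding \<xi>_def by (intro bmeas_intros bmeas_integral v)
    have p: "bmeas t p" unfolding p_def by (intro bmeas_P \<xi> v)
    have X: "bmeas t X" unfolding X_def by (intro bmeas_Hx \<xi> p)
    have Z: "bmeas t Z" unfolding Z_def by (intro bmeas_intros bmeas_integral' p X)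
    have Zb: "norm (Z s) \<le> B" if s: "s \<in> {0..t}" for s
    proof -
      have "norm (integral {s..t} X) \<le> integral {s..t} (\<lambda>s. CL)"
        using s by (intro integral_norm_bound_integral bmeas_integrable[OF X]) (auto simp: X_def Hx_bound)
      also have "\<dots> \<le> CL * t" using s CL_nonneg by (simp add: mult.commute mult_left_mono)
      finally show ?thesis using norm_triangle_ineq4[of "p s" "integral {s..t} X"] Pb(2)[OF vM, of "\<xi> s" s]
        unfolding Z_def B_def p_def by linarith
    qed
    have "norm (integral {0..t} Z) \<le> integral {0..t} (\<lambda>s. B)"
      by (intro integral_norm_bound_integral bmeas_integrable[OF Z] Zb) auto
    then have gB: "g \<in> cball 0 B" using t by (simp add: g_def divide_le_eq mult.commute)
    have \<xi>b: "norm (\<xi> s) \<le> norm x + M * t" if s: "s \<in> {0..t}" for s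
    proof -
      have "integral {0..s} v + integral {s..t} v = integral {0..t} v"
        by (rule Henstock_Kurzweil_Integration.integral_combine) (use s in \<open>auto intro: bmeas_integrable[OF v]\<close>)
      then have split: "x = \<xi> s + integral {s..t} v" using endp by (simp add: \<xi>_def add.assoc)
      have "norm (integral {s..t} v) \<le> integral {s..t} (\<lambda>s. M)"
        using s by (intro integral_norm_bound_integral bmeas_integrable[OF v] vM) auto
      also have "\<dots> \<le> M * t" using s M by (simp add: mult.commute mult_left_mono)
      finally have "norm (integral {s..t} v) \<le> M * t" .
      moreover have "norm (\<xi> s) \<le> norm x + norm (integral {s..t} v)"
        using norm_triangle_ineq4[of x "integral {s..t} v"] split by simp
      ultimately show ?thesis by linarith
    qed
    have "S_plus H t u (x + h) \<le> S_plus H t u x + e + g \<bullet> h + C' * (norm h)\<^sup>2" if h: "norm h \<le> 1" for h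
    proof -
      define \<psi> where "\<psi> = (\<lambda>s::real. (1 / t) *\<^sub>R h)"
      have \<psi>: "bmeas t \<psi>" unfolding \<psi>_def by (rule bmeas_const)
      have \<phi>: "integral {0..s} \<psi> = (s / t) *\<^sub>R h" if "s \<in> {0..t}" for s
        using that by (simp add: \<psi>_def)
      have \<phi>b: "norm (integral {0..s} \<psi>) \<le> norm h" if s: "s \<in> {0..t}" for s
      proof -
        have "\<bar>s / t\<bar> * norm h \<le> 1 * norm h" using s t by (intro mult_right_mono) auto
        then show ?thesis unfolding \<phi>[OF s] by simp
      qed
      have hyp: "\<forall>s\<in>{0..t}. norm (y + integral {0..s} v) \<le> R' \<and> norm (y + integral {0..s} v + integral {0..s} \<psi>) \<le> R' \<and> norm (v s) \<le> R'"
      proof (intro ballI conjI)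
        fix s assume s: "s \<in> {0..t}"
        show "norm (y + integral {0..s} v) \<le> R'" using \<xi>b[OF s] x M unfolding R'_def \<xi>_def by linarith
        show "norm (y + integral {0..s} v + integral {0..s} \<psi>) \<le> R'"
          using \<xi>b[OF s] \<phi>b[OF s] h norm_triangle_ineq[of "\<xi> s" "integral {0..s} \<psi>"] x M unfolding R'_def \<xi>_def by linarith
        have "0 \<le> M * t" using M t by simp
        then show "norm (v s) \<le> R'" using vM[of s] unfolding R'_def by linarith
      qed
      have 1: "integral {0..t} (\<lambda>s. \<psi> s \<bullet> Z s) = g \<bullet> h"
      proof -
        have "integral {0..t} (\<lambda>s. Z s \<bullet> ((1 / t) *\<^sub>R h)) = integral {0..t} Z \<bullet> ((1 / t) *\<^sub>R h)"
          by (rule integral_inner_left) (rule bmeas_integrable[OF Z]; simp)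
        then show ?thesis by (simp add: \<psi>_def g_def inner_commute)
      qed
      have "integral {0..t} (\<lambda>s. (norm (integral {0..s} \<psi>))\<^sup>2 + (norm (\<psi> s))\<^sup>2) \<le> integral {0..t} (\<lambda>s. (norm h)\<^sup>2 + ((1 / t) * norm h)\<^sup>2)"
      proof (rule integral_le)
        show "(\<lambda>s. (norm (integral {0..s} \<psi>))\<^sup>2 + (norm (\<psi> s))\<^sup>2) integrable_on {0..t}"
          by (rule bmeas_integrable[of t]) (intro bmeas_intros bmeas_integral \<psi>, auto)
        show "(norm (integral {0..s} \<psi>))\<^sup>2 + (norm (\<psi> s))\<^sup>2 \<le> (norm h)\<^sup>2 + ((1 / t) * norm h)\<^sup>2" if "s \<in> {0..t}" for s
          using \<phi>b[OF that] t by (intro add_mono power_mono) (auto simp: \<psi>_def)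
      qed auto
      also have "\<dots> = ((1 + (1 / t)\<^sup>2) * t) * (norm h)\<^sup>2" using t by (simp only: power_mult_distrib) (simp add: algebra_simps)
      finally have "C * integral {0..t} (\<lambda>s. (norm (integral {0..s} \<psi>))\<^sup>2 + (norm (\<psi> s))\<^sup>2) \<le> C * (((1 + (1 / t)\<^sup>2) * t) * (norm h)\<^sup>2)"
        using C by (rule mult_left_mono)
      also have "\<dots> = C' * (norm h)\<^sup>2" by (simp only: C'_def mult.assoc)
      finally have 2: "C * integral {0..t} (\<lambda>s. (norm (integral {0..s} \<psi>))\<^sup>2 + (norm (\<psi> s))\<^sup>2) \<le> C' * (norm h)\<^sup>2" .
      have "integral {0..t} (\<lambda>s. v s + \<psi> s) = integral {0..t} v + integral {0..t} \<psi>"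
        by (intro integral_add bmeas_integrable[OF v] bmeas_integrable[OF \<psi>]) auto
      then have "x + h = y + integral {0..t} (\<lambda>s. v s + \<psi> s)" using endp \<phi>[of t] t by (simp add: add.assoc)
      then have "S_plus H t u (x + h) \<le> J t u y (\<lambda>s. v s + \<psi> s)"
        using S_plus_upper[OF t u bmeas_add[OF v \<psi>], of y] by simp
      also have "\<dots> \<le> J t u y v + g \<bullet> h + C' * (norm h)\<^sup>2"
        using pert[OF v \<psi> hyp, of u] 1 2 unfolding Z_def p_def X_def \<xi>_def by linarith
      finally show ?thesis using min by linarith
    qed
    then show ?thesis using gB by blast
  qed
  have "\<exists>g. \<forall>h. norm h \<le> 1 \<longrightarrow> S_plus H t u (x + h) \<le> S_plus H t u x + g \<bullet> h + C' * (norm h)\<^sup>2" if x: "norm x \<le> R" for x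
  proof -
    define e where "e = (\<lambda>n::nat. 1 / real (Suc n))"
    have e0: "e \<longlonglongrightarrow> 0" unfolding e_def by (rule LIMSEQ_Suc[OF lim_1_over_n])
    have "\<exists>g\<in>cball 0 B. \<forall>h. norm h \<le> 1 \<longrightarrow> S_plus H t u (x + h) \<le> S_plus H t u x + e n + g \<bullet> h + C' * (norm h)\<^sup>2" for n
      by (rule approx[OF x]) (simp add: e_def)
    then obtain g where g: "\<And>n. g n \<in> cball 0 B" "\<And>n h. norm h \<le> 1 \<Longrightarrow> S_plus H t u (x + h) \<le> S_plus H t u x + e n + g n \<bullet> h + C' * (norm h)\<^sup>2"
      by metis
    \<comment> \<open>Each near-minimiser gives a supergradient up to the error e n only. The bound
      B on their norms does not depend on the error, so compactness provides an exact supergradient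
      in the limit.\<close>
    obtain l r where lr: "strict_mono r" "(g \<circ> r) \<longlonglongrightarrow> l"
      using compact_cball[of "0::real^'n" B] g(1) unfolding compact_def by metis
    have "S_plus H t u (x + h) \<le> S_plus H t u x + l \<bullet> h + C' * (norm h)\<^sup>2" if h: "norm h \<le> 1" for h
    proof (rule LIMSEQ_le_const)
      have "(\<lambda>n. S_plus H t u x + (e \<circ> r) n + (g \<circ> r) n \<bullet> h + C' * (norm h)\<^sup>2) \<longlonglongrightarrow> S_plus H t u x + 0 + l \<bullet> h + C' * (norm h)\<^sup>2"
        by (intro tendsto_intros LIMSEQ_subseq_LIMSEQ[OF e0] lr)
      then show "(\<lambda>n. S_plus H t u x + e (r n) + g (r n) \<bullet> h + C' * (norm h)\<^sup>2) \<longlonglongrightarrow> S_plus H t u x + l \<bullet> h + C' * (norm h)\<^sup>2"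
        by (simp add: o_def)
    qed (use g(2)[OF h] in blast)
    then show ?thesis by blast
  qed
  then show ?thesis by blast
qed

lemma S_plus_AE_differentiable:
  assumes "t > 0" "K-lipschitz_on UNIV u"
  shows "AE x in lebesgue. S_plus H t u differentiable (at x)"
  using S_plus_lipschitz[OF assms] S_plus_semiconcave[OF assms]
  by (intro semiconcave_AE_differentiable lipschitz_on_continuous_on) blast+

lemma backward_characteristic_ex1:
  assumes t: "t > 0" and u: "K-lipschitz_on UNIV u" and d: "S_plus H t u differentiable (at x)"
  shows "\<exists>!z. backward_characteristic H t x (grad (S_plus H t u) x) z"
proof -
  obtain M where "M \<ge> 0" "\<And>u x e. K-lipschitz_on UNIV u \<Longrightarrow> e > 0 \<Longrightarrow>
    \<exists>y v. near_min t u M x (S_plus H t u x + e) y v"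
    using S_plus_near_minimiser[OF t lipschitz_on_nonneg[OF u]] by metis
  then show ?thesis
    using characteristic_selection(1)[OF t _ GDERIV_grad[OF d] S_plus_upper[OF t u]] u by blast
qed

section \<open>Difference quotients in the initial datum\<close>

lemma lipschitz_perturbed:
  fixes u w :: "real^'n \<Rightarrow> real"
  assumes "K-lipschitz_on UNIV u" "K'-lipschitz_on UNIV w" "0 \<le> \<delta>" "\<delta> \<le> c"
  shows "(K + c * K')-lipschitz_on UNIV (\<lambda>y. u y + \<delta> * w y)"
proof (rule lipschitz_onI)
  fix x y :: "real^'n"
  have "\<bar>(u x + \<delta> * w x) - (u y + \<delta> * w y)\<bar> \<le> \<bar>u x - u y\<bar> + \<delta> * \<bar>w x - w y\<bar>"
  proof -
    have "(u x + \<delta> * w x) - (u y + \<delta> * w y) = (u x - u y) + \<delta> * (w x - w y)" by (simp add: algebra_simps)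
    then show ?thesis using abs_triangle_ineq[of "u x - u y" "\<delta> * (w x - w y)"] assms(3) by (simp only: abs_mult abs_of_nonneg)
  qed
  also have "\<dots> \<le> K * dist x y + c * (K' * dist x y)"
    using lipschitz_onD[OF assms(1), of x y] lipschitz_onD[OF assms(2), of x y] assms(3,4)
    by (intro add_mono mult_mono) (auto simp: dist_real_def)
  finally show "dist (u x + \<delta> * w x) (u y + \<delta> * w y) \<le> (K + c * K') * dist x y"
    by (simp add: dist_real_def algebra_simps)
qed (use lipschitz_on_nonneg[OF assms(1)] lipschitz_on_nonneg[OF assms(2)] assms in auto)

abbreviation quot :: "real \<Rightarrow> (real^'n \<Rightarrow> real) \<Rightarrow> (real^'n \<Rightarrow> real) \<Rightarrow> real \<Rightarrow> real^'n \<Rightarrow> real" where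
  "quot t u w \<delta> x \<equiv> (S_plus H t (\<lambda>y. u y + \<delta> * w y) x - S_plus H t u x) / \<delta>"

lemma J_perturbed: "J t (\<lambda>y. u y + \<delta> * w y) y v = J t u y v + \<delta> * w y"
  by (simp add: J_def)

text \<open>The difference quotient lies between the values of \<open>w\<close> at the starting points of two
  near-minimisers of the unperturbed problem.\<close>

lemma quotient_sandwich:
  assumes t: "t > 0" and u: "K-lipschitz_on UNIV u" and w: "K'-lipschitz_on UNIV w"
  obtains M where "M \<ge> 0" "\<And>x \<delta> \<eta>. 0 < \<delta> \<Longrightarrow> \<delta> \<le> 1 \<Longrightarrow> 0 < \<eta> \<Longrightarrow>
    \<exists>y1 v1 y2 v2. near_min t u M x (S_plus H t u x + \<delta> * \<eta>) y1 v1 \<and>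
       near_min t u M x (S_plus H t u x + \<delta> * (2 * \<eta> + 2 * K' * M * t)) y2 v2 \<and>
       w y2 - \<eta> \<le> quot t u w \<delta> x \<and>
       quot t u w \<delta> x \<le> w y1 + \<eta>"
proof -
  have K: "K \<ge> 0" "K' \<ge> 0" using u w by (auto dest: lipschitz_on_nonneg)
  then have KK: "K + 1 * K' \<ge> 0" by simp
  obtain M where M: "M \<ge> 0" and near: "\<And>u x e. (K + 1 * K')-lipschitz_on UNIV u \<Longrightarrow> e > 0 \<Longrightarrow>
    \<exists>y v. near_min t u M x (S_plus H t u x + e) y v"
    using S_plus_near_minimiser[OF t KK] by metis
  show ?thesis
  proof (rule that[OF M])
    fix x :: "real^'n" and \<delta> \<eta> :: real assume d: "0 < \<delta>" "\<delta> \<le> 1" and \<eta>: "0 < \<eta>"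
    let ?u = "\<lambda>y. u y + \<delta> * w y"
    have u': "(K + 1 * K')-lipschitz_on UNIV ?u" by (rule lipschitz_perturbed[OF u w]) (use d in auto)
    have u'': "(K + 1 * K')-lipschitz_on UNIV u" by (rule lipschitz_on_le[OF u]) (use K in auto)
    \<comment> \<open>The excess is taken proportional to \<delta>, so that it becomes \<eta> after
      division by \<delta>.\<close>
    have e: "\<delta> * \<eta> > 0" using d \<eta> by simp
    obtain y1 v1 where n1: "near_min t u M x (S_plus H t u x + \<delta> * \<eta>) y1 v1" using near[OF u'' e] by blast
    obtain y2 v2 where m2: "near_min t ?u M x (S_plus H t ?u x + \<delta> * \<eta>) y2 v2" using near[OF u' e] by blast
    have 1: "bmeas t v1" "\<forall>s. norm (v1 s) \<le> M" "y1 + integral {0..t} v1 = x" "J t u y1 v1 \<le> S_plus H t u x + \<delta> * \<eta>"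
      using n1 unfolding near_min_def by blast+
    have 2: "bmeas t v2" "\<forall>s. norm (v2 s) \<le> M" "y2 + integral {0..t} v2 = x" "J t ?u y2 v2 \<le> S_plus H t ?u x + \<delta> * \<eta>"
      using m2 unfolding near_min_def by blast+
    have up: "S_plus H t ?u x \<le> J t u y1 v1 + \<delta> * w y1"
      using S_plus_upper[OF t u' 1(1), of y1] unfolding 1(3) J_perturbed .
    have lo: "S_plus H t u x \<le> J t u y2 v2" using S_plus_upper[OF t u 2(1), of y2] unfolding 2(3) .
    note 24 = 2(4)[unfolded J_perturbed]
    \<comment> \<open>Testing the perturbed value with the first curve and reading the
      near-minimality of the second without its \<delta> w term leaves \<delta> times
      \<open>w y1 - w y2\<close>. Both starting points lie within M t of x, whence the constant
      \<open>2 * K' * M * t\<close>.\<close>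
    have "w y1 - w y2 \<le> K' * norm (y1 - y2)"
      using lipschitz_onD[OF w, of y1 y2] by (simp add: dist_norm abs_le_iff)
    also have "norm (y1 - y2) \<le> 2 * (M * t)"
      using near_min_displacement[OF n1 t] near_min_displacement[OF m2 t] norm_triangle_ineq4[of "y1 - x" "y2 - x"] by simp
    finally have "w y1 - w y2 \<le> K' * (2 * (M * t))" using K by (simp add: mult_left_mono)
    then have "\<delta> * (w y1 - w y2) \<le> \<delta> * (K' * (2 * (M * t)))" using d by (intro mult_left_mono) auto
    then have "J t u y2 v2 \<le> S_plus H t u x + \<delta> * (2 * \<eta> + 2 * K' * M * t)"
      using 24 up 1(4) by (simp add: algebra_simps)
    then have n2: "near_min t u M x (S_plus H t u x + \<delta> * (2 * \<eta> + 2 * K' * M * t)) y2 v2"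
      using 2 by (simp add: near_min_def)
    have q1: "(S_plus H t ?u x - S_plus H t u x) / \<delta> \<le> w y1 + \<eta>"
    proof -
      have "S_plus H t ?u x - S_plus H t u x \<le> (w y1 + \<eta>) * \<delta>" using up 1(4) by (simp add: algebra_simps)
      then show ?thesis using d by (simp add: pos_divide_le_eq)
    qed
    have q2: "w y2 - \<eta> \<le> (S_plus H t ?u x - S_plus H t u x) / \<delta>"
    proof -
      have "(w y2 - \<eta>) * \<delta> \<le> S_plus H t ?u x - S_plus H t u x" using lo 24 by (simp add: algebra_simps)
      then show ?thesis using d by (simp add: pos_le_divide_eq)
    qed
    show "\<exists>y1 v1 y2 v2. near_min t u M x (S_plus H t u x + \<delta> * \<eta>) y1 v1 \<and>
       near_min t u M x (S_plus H t u x + \<delta> * (2 * \<eta> + 2 * K' * M * t)) y2 v2 \<and>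
       w y2 - \<eta> \<le> quot t u w \<delta> x \<and>
       quot t u w \<delta> x \<le> w y1 + \<eta>"
      by (rule exI[of _ y1], rule exI[of _ v1], rule exI[of _ y2], rule exI[of _ v2])
         (intro conjI n1 n2 q1 q2)
  qed
qed

text \<open>The bracketing starting points lie within M t of x and w is Lipschitz. The bound holds
  at every x and uniformly in \<delta>, as domination requires.\<close>

lemma quotient_bound:
  assumes t: "t > 0" and u: "K-lipschitz_on UNIV u" and w: "K'-lipschitz_on UNIV w"
  shows "\<exists>B. \<forall>x \<delta>. 0 < \<delta> \<longrightarrow> \<delta> \<le> 1 \<longrightarrow>
    \<bar>quot t u w \<delta> x\<bar> \<le> \<bar>w x\<bar> + B"
proof -
  have K': "K' \<ge> 0" using w by (rule lipschitz_on_nonneg)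
  obtain M where "M \<ge> 0" and S: "\<And>x \<delta> \<eta>. 0 < \<delta> \<Longrightarrow> \<delta> \<le> 1 \<Longrightarrow> 0 < \<eta> \<Longrightarrow>
    \<exists>y1 v1 y2 v2. near_min t u M x (S_plus H t u x + \<delta> * \<eta>) y1 v1 \<and>
       near_min t u M x (S_plus H t u x + \<delta> * (2 * \<eta> + 2 * K' * M * t)) y2 v2 \<and>
       w y2 - \<eta> \<le> quot t u w \<delta> x \<and>
       quot t u w \<delta> x \<le> w y1 + \<eta>"
    by (rule quotient_sandwich[OF t u w]) (rule that; assumption)
  have "\<bar>quot t u w \<delta> x\<bar> \<le> \<bar>w x\<bar> + (K' * (M * t) + 1)"
    if d: "0 < \<delta>" "\<delta> \<le> 1" for x \<delta>
  proof -
    obtain y1 v1 y2 v2 c1 c2 where n: "near_min t u M x c1 y1 v1" "near_min t u M x c2 y2 v2"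
      and q: "w y2 - 1 \<le> quot t u w \<delta> x" "quot t u w \<delta> x \<le> w y1 + 1"
      using S[OF d zero_less_one, of x] by blast
    have "\<bar>w z - w x\<bar> \<le> K' * (M * t)" if "norm (z - x) \<le> M * t" for z
      using lipschitz_onD[OF w, of z x] mult_left_mono[OF that K'] by (simp add: dist_norm)
    from this[OF near_min_displacement[OF n(1) t]] this[OF near_min_displacement[OF n(2) t]] q show ?thesis by linarith
  qed
  then show ?thesis by blast
qed

text \<open>Both bracketing curves have an excess proportional to \<delta> for the unperturbed
  problem, so their starting points converge to the foot of the characteristic through x.\<close>

lemma quotient_tendsto:
  assumes t: "t > 0" and u: "K-lipschitz_on UNIV u" and w: "K'-lipschitz_on UNIV w"
    and d: "S_plus H t u differentiable (at x)"
  shows "((\<lambda>\<delta>. quot t u w \<delta> x) \<longlongrightarrow> dS_plus H t u w x) (at_right 0)"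
proof (rule tendstoI)
  fix \<epsilon> :: real assume \<epsilon>: "\<epsilon> > 0"
  have K': "K' \<ge> 0" using w by (rule lipschitz_on_nonneg)
  define z where "z = fst (THE z. backward_characteristic H t x (grad (S_plus H t u) x) z) 0"
  have dS: "dS_plus H t u w x = w z" using d by (simp add: dS_plus_def z_def)
  obtain M where M: "M \<ge> 0" and S: "\<And>x \<delta> \<eta>. 0 < \<delta> \<Longrightarrow> \<delta> \<le> 1 \<Longrightarrow> 0 < \<eta> \<Longrightarrow>
    \<exists>y1 v1 y2 v2. near_min t u M x (S_plus H t u x + \<delta> * \<eta>) y1 v1 \<and>
       near_min t u M x (S_plus H t u x + \<delta> * (2 * \<eta> + 2 * K' * M * t)) y2 v2 \<and>
       w y2 - \<eta> \<le> quot t u w \<delta> x \<and>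
       quot t u w \<delta> x \<le> w y1 + \<eta>"
    by (rule quotient_sandwich[OF t u w]) (rule that; assumption)
  \<comment> \<open>M0 bounds the velocities of the near-minimisers that produce the characteristic;
    M belongs to the curves of the sandwich, which are to be compared with it.\<close>
  obtain M0 where M0: "M0 \<ge> 0" "\<And>u x e. K-lipschitz_on UNIV u \<Longrightarrow> e > 0 \<Longrightarrow>
    \<exists>y v. near_min t u M0 x (S_plus H t u x + e) y v"
    using S_plus_near_minimiser[OF t lipschitz_on_nonneg[OF u]] by metis
  define e where "e = (\<epsilon> / 4) / (K' + 1)"
  have e: "e > 0" using \<epsilon> K' by (simp add: e_def)
  define \<eta> where "\<eta> = \<epsilon> / 4"
  have \<eta>: "\<eta> > 0" using \<epsilon> by (simp add: \<eta>_def)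
  obtain \<eta>0 where \<eta>0: "\<eta>0 > 0" and close: "\<And>y v. near_min t u M x (S_plus H t u x + \<eta>0) y v \<Longrightarrow> norm (y - z) \<le> e"
    using characteristic_selection(2)[OF t M0(1) GDERIV_grad[OF d] S_plus_upper[OF t u] M0(2)[OF u] M e]
    unfolding z_def by blast
  \<comment> \<open>\<delta> D is the larger of the two excesses in the sandwich, so \<delta> <
    \<eta>0 / D brings both starting points within e of z.\<close>
  define D where "D = 2 * \<eta> + 2 * K' * M * t"
  have D: "D > 0" using \<eta> K' M t by (simp add: D_def add_pos_nonneg)
  have wz: "\<bar>w y - w z\<bar> \<le> \<epsilon> / 4" if "norm (y - z) \<le> e" for y
  proof -
    have "\<bar>w y - w z\<bar> \<le> K' * norm (y - z)" using lipschitz_onD[OF w, of y z] by (simp add: dist_norm)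
    also have "\<dots> \<le> (K' + 1) * e" using that K' by (intro mult_mono) auto
    also have "\<dots> = \<epsilon> / 4"
    proof -
      have "K' + 1 \<noteq> 0" using K' by linarith
      from nonzero_mult_div_cancel_left[OF this, of "\<epsilon> / 4"] show ?thesis
        unfolding e_def by (simp only: times_divide_eq_right)
    qed
    finally show ?thesis .
  qed
  have "\<forall>\<^sub>F \<delta> in at_right 0. \<delta> < min 1 (\<eta>0 / D)"
    using \<eta>0 D by (intro eventually_at_rightI[of 0 "min 1 (\<eta>0 / D)"]) auto
  moreover have "\<forall>\<^sub>F \<delta> in at_right (0::real). \<delta> > 0" by (simp add: eventually_at_right_less)
  ultimately show "\<forall>\<^sub>F \<delta> in at_right 0. dist (quot t u w \<delta> x) (dS_plus H t u w x) < \<epsilon>"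
  proof eventually_elim
    case (elim \<delta>)
    then have \<delta>D: "\<delta> * D \<le> \<eta>0" using D by (simp add: pos_less_divide_eq)
    have "\<delta> * \<eta> \<le> \<delta> * D" using elim \<eta> K' M t by (intro mult_left_mono) (auto simp: D_def)
    with \<delta>D have \<delta>\<eta>: "\<delta> * \<eta> \<le> \<eta>0" by linarith
    obtain y1 v1 y2 v2 where y1: "near_min t u M x (S_plus H t u x + \<delta> * \<eta>) y1 v1"
      and y2: "near_min t u M x (S_plus H t u x + \<delta> * D) y2 v2"
      and q: "w y2 - \<eta> \<le> quot t u w \<delta> x" "quot t u w \<delta> x \<le> w y1 + \<eta>"
      using S[of \<delta> \<eta> x] elim \<eta> unfolding D_def by auto
    have "norm (y1 - z) \<le> e" by (rule close[OF near_min_mono[OF y1]]) (use \<delta>\<eta> in simp)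
    moreover have "norm (y2 - z) \<le> e" by (rule close[OF near_min_mono[OF y2]]) (use \<delta>D in simp)
    ultimately have "\<bar>w y1 - w z\<bar> \<le> \<epsilon> / 4" "\<bar>w y2 - w z\<bar> \<le> \<epsilon> / 4" using wz by blast+
    then have "\<bar>quot t u w \<delta> x - w z\<bar> \<le> \<epsilon> / 2" using q unfolding \<eta>_def by linarith
    then show ?case using \<epsilon> unfolding dS dist_real_def by linarith
  qed
qed

lemma quotient_continuous:
  assumes t: "t > 0" and u: "K-lipschitz_on UNIV u" and w: "K'-lipschitz_on UNIV w" and d: "0 \<le> \<delta>"
  shows "continuous_on S (\<lambda>x. quot t u w \<delta> x)"
proof -
  have c: "continuous_on S (S_plus H t u)" if "K-lipschitz_on UNIV u" for u K
    using lipschitz_on_continuous_on[OF S_plus_lipschitz[OF t that]] by (rule continuous_on_subset) simp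
  show ?thesis
    unfolding divide_inverse
    by (intro continuous_intros c[OF u] c[OF lipschitz_perturbed[OF u w d order_refl]])
qed

lemma dS_plus_bound:
  assumes t: "t > 0" and u: "K-lipschitz_on UNIV u" and w: "K'-lipschitz_on UNIV w"
    and B: "\<And>x \<delta>. 0 < \<delta> \<Longrightarrow> \<delta> \<le> 1 \<Longrightarrow> \<bar>quot t u w \<delta> x\<bar> \<le> \<bar>w x\<bar> + B"
  shows "\<bar>dS_plus H t u w x\<bar> \<le> \<bar>w x\<bar> + B"
proof (cases "S_plus H t u differentiable (at x)")
  case True
  have "((\<lambda>\<delta>. \<bar>quot t u w \<delta> x\<bar>) \<longlongrightarrow> \<bar>dS_plus H t u w x\<bar>) (at_right 0)"
    by (intro tendsto_rabs quotient_tendsto[OF t u w True])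
  moreover have "\<forall>\<^sub>F \<delta> in at_right 0. \<bar>quot t u w \<delta> x\<bar> \<le> \<bar>w x\<bar> + B"
    using B by (intro eventually_at_rightI[of 0 1]) auto
  ultimately show ?thesis by (rule tendsto_upperbound) simp
next
  case False
  \<comment> \<open>Off the differentiability set the default value is 0, so the bound only has to
    be nonnegative; at \<delta> = 1 it dominates an absolute value.\<close>
  have "0 \<le> \<bar>w x\<bar> + B" using B[of 1 x] by linarith
  then show ?thesis using False by (simp add: dS_plus_def)
qed

text \<open>The set of differentiability points is Lebesgue measurable because its complement is
  null and the measure is complete. Cut off to this set, the continuous difference quotients along
  \<delta> = 1 / (n + 1) converge everywhere, the default value 0 matching the cut-off.\<close>

lemma dS_plus_measurable:
  assumes t: "t > 0" and u: "K-lipschitz_on UNIV u" and w: "K'-lipschitz_on UNIV w"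
  shows "dS_plus H t u w \<in> borel_measurable lebesgue"
proof -
  define D where "D = {x. S_plus H t u differentiable (at x)}"
  define Q where "Q = (\<lambda>n::nat. \<lambda>x. (S_plus H t (\<lambda>y. u y + (1 / real (Suc n)) * w y) x - S_plus H t u x) / (1 / real (Suc n)))"
  have AE: "AE x in lebesgue. \<not> \<not> S_plus H t u differentiable (at x)"
    using S_plus_AE_differentiable[OF t u] by simp
  have "Measurable.pred lebesgue (\<lambda>x. \<not> S_plus H t u differentiable (at x))"
    by (rule sets_completion_AE) (use AE in \<open>simp only: AE_completion_iff\<close>)
  then have "{x \<in> space lebesgue. \<not> \<not> S_plus H t u differentiable (at x)} \<in> sets lebesgue"
    by measurable
  then have D: "D \<in> sets lebesgue" by (simp add: D_def)
  show ?thesis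
  proof (rule borel_measurable_LIMSEQ_real)
    show "(\<lambda>x. if x \<in> D then Q n x else 0) \<in> borel_measurable lebesgue" for n
    proof (rule borel_measurable_if_I[OF _ D])
      show "Q n \<in> borel_measurable (lebesgue_on D)"
        unfolding Q_def by (rule continuous_imp_measurable_on_sets_lebesgue[OF quotient_continuous[OF t u w] D]) simp
    qed
    fix x
    show "(\<lambda>n. if x \<in> D then Q n x else 0) \<longlonglongrightarrow> dS_plus H t u w x"
    proof (cases "x \<in> D")
      case True
      have "(\<lambda>n. 1 / real (Suc n)) \<longlonglongrightarrow> 0" by (rule LIMSEQ_Suc[OF lim_1_over_n])
      then have "filterlim (\<lambda>n. 1 / real (Suc n)) (at_right 0) sequentially"
        unfolding filterlim_at by auto
      from filterlim_compose[OF quotient_tendsto[OF t u w] this, of x] True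
      have "(\<lambda>n. Q n x) \<longlonglongrightarrow> dS_plus H t u w x" unfolding Q_def D_def by blast
      then show ?thesis using True by simp
    qed (simp add: D_def dS_plus_def)
  qed
qed

lemma quotient_tendsto_L1_loc:
  assumes t: "t > 0" and u: "K-lipschitz_on UNIV u" and w: "K'-lipschitz_on UNIV w"
  shows "Linf_loc (dS_plus H t u w)"
    and "tendsto_L1_loc (\<lambda>\<delta> x. quot t u w \<delta> x) (dS_plus H t u w) (at_right 0)"
proof -
  let ?Q = "\<lambda>\<delta> x. quot t u w \<delta> x"
  let ?g = "dS_plus H t u w"
  obtain B where B: "\<And>x \<delta>. 0 < \<delta> \<Longrightarrow> \<delta> \<le> 1 \<Longrightarrow> \<bar>?Q \<delta> x\<bar> \<le> \<bar>w x\<bar> + B"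
    using quotient_bound[OF t u w] by blast
  have gB: "\<bar>?g x\<bar> \<le> \<bar>w x\<bar> + B" for x by (rule dS_plus_bound[OF t u w B])
  have gm [measurable]: "?g \<in> borel_measurable lebesgue" by (rule dS_plus_measurable[OF t u w])
  have wc: "continuous_on S w" for S
    using lipschitz_on_continuous_on[OF w] by (rule continuous_on_subset) simp
  show "Linf_loc ?g"
    unfolding Linf_loc_def
  proof (intro conjI gm allI impI)
    fix C :: "(real^'n) set" assume "compact C"
    then have "bounded (w ` C)" by (intro compact_imp_bounded compact_continuous_image wc)
    then obtain b where b: "\<And>x. x \<in> C \<Longrightarrow> \<bar>w x\<bar> \<le> b" by (auto simp: bounded_iff)
    show "\<exists>M. AE x in lebesgue. x \<in> C \<longrightarrow> \<bar>?g x\<bar> \<le> M"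
    proof (intro exI[of _ "b + B"] AE_I2 impI)
      fix x assume "x \<in> C"
      then show "\<bar>?g x\<bar> \<le> b + B" using b[of x] gB[of x] by linarith
    qed
  qed
  have dom: "set_integrable lebesgue C (\<lambda>x. \<bar>w x\<bar> + B)" if "compact C" for C :: "(real^'n) set"
    using that by (intro set_integrable_continuous_compact continuous_intros wc)
  have Csets: "C \<in> sets lebesgue" if "compact C" for C :: "(real^'n) set"
    using that by (simp add: compact_imp_closed)
  have g1: "L1_loc ?g"
    unfolding L1_loc_def
  proof (intro allI impI)
    fix C :: "(real^'n) set" assume C: "compact C"
    have [measurable]: "C \<in> sets lebesgue" by (rule Csets[OF C])
    show "set_integrable lebesgue C ?g"
    proof (rule set_integrable_bound[OF dom[OF C]])
      show "set_borel_measurable lebesgue C ?g" unfolding set_borel_measurable_def by measurable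
      show "AE x in lebesgue. x \<in> C \<longrightarrow> norm (?g x) \<le> norm (\<bar>w x\<bar> + B)"
      proof (intro AE_I2 impI)
        fix x show "norm (?g x) \<le> norm (\<bar>w x\<bar> + B)" using gB[of x] by simp
      qed
    qed
  qed
  have Qm: "?Q \<delta> \<in> borel_measurable lebesgue" if "0 \<le> \<delta>" for \<delta>
    using continuous_imp_measurable_on_sets_lebesgue[OF quotient_continuous[OF t u w that, of UNIV]]
    by (simp add: lebesgue_on_UNIV_eq)
  have conv: "((\<lambda>\<delta>. LINT x:C|lebesgue. \<bar>?Q \<delta> x - ?g x\<bar>) \<longlongrightarrow> 0) (at_right 0)" if C: "compact C" for C
  proof -
    have [measurable]: "C \<in> sets lebesgue" by (rule Csets[OF C])
    \<comment> \<open>Restricting to (0, 1) reduces the limit to sequences all of whose members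
      satisfy \<delta> \<le> 1, so that the dominating function applies from the first term
      on.\<close>
    have ar: "at_right (0::real) = at 0 within {0<..<1}"
      by (rule at_within_nhd[of _ "{..<1}"]) auto
    have "(\<lambda>i. LINT x:C|lebesgue. \<bar>?Q (X i) x - ?g x\<bar>) \<longlonglongrightarrow> 0"
      if X: "\<forall>i. X i \<in> {0<..<1} - {0}" "X \<longlonglongrightarrow> 0" for X :: "nat \<Rightarrow> real"
    proof -
      have Xp: "0 < X i" "X i \<le> 1" for i using X(1) by (auto simp: less_imp_le)
      have fl: "filterlim X (at_right 0) sequentially"
        unfolding filterlim_at using X(2) Xp(1) by (auto simp: less_imp_neq[OF Xp(1), symmetric])
      have "(\<lambda>i. LINT x|lebesgue. indicator C x *\<^sub>R \<bar>?Q (X i) x - ?g x\<bar>) \<longlonglongrightarrow> (LINT x|(lebesgue :: (real^'n) measure). (0::real))"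
      proof (rule integral_dominated_convergence[where w = "\<lambda>x. 2 * (indicator C x *\<^sub>R (\<bar>w x\<bar> + B))"])
        show "(\<lambda>x. indicator C x *\<^sub>R \<bar>?Q (X i) x - ?g x\<bar>) \<in> borel_measurable lebesgue" for i
          using Qm[OF less_imp_le[OF Xp(1)], of i] by measurable
        show "integrable lebesgue (\<lambda>x. 2 * (indicator C x *\<^sub>R (\<bar>w x\<bar> + B)))"
          using dom[OF C] unfolding set_integrable_def by (rule integrable_mult_right)
        show "AE x in lebesgue. (\<lambda>i. indicator C x *\<^sub>R \<bar>?Q (X i) x - ?g x\<bar>) \<longlonglongrightarrow> 0"
          using S_plus_AE_differentiable[OF t u]
        proof eventually_elim
          case (elim x)
          have "(\<lambda>i. ?Q (X i) x) \<longlonglongrightarrow> ?g x"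
            using quotient_tendsto[OF t u w elim] fl by (rule filterlim_compose)
          then have "(\<lambda>i. indicator C x *\<^sub>R \<bar>?Q (X i) x - ?g x\<bar>) \<longlonglongrightarrow> indicator C x *\<^sub>R \<bar>?g x - ?g x\<bar>"
            by (intro tendsto_intros)
          then show ?case by simp
        qed
        show "AE x in lebesgue. norm (indicator C x *\<^sub>R \<bar>?Q (X i) x - ?g x\<bar>) \<le> 2 * (indicator C x *\<^sub>R (\<bar>w x\<bar> + B))" for i
        proof (rule AE_I2)
          fix x
          have "\<bar>?Q (X i) x - ?g x\<bar> \<le> 2 * (\<bar>w x\<bar> + B)"
            unfolding mult_2 using B[OF Xp[of i], of x] gB[of x] abs_triangle_ineq4[of "?Q (X i) x" "?g x"] by linarith
          then show "norm (indicator C x *\<^sub>R \<bar>?Q (X i) x - ?g x\<bar>) \<le> 2 * (indicator C x *\<^sub>R (\<bar>w x\<bar> + B))"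
            by (simp add: indicator_def)
        qed
      qed simp
      then show ?thesis by (simp add: set_lebesgue_integral_def)
    qed
    then show ?thesis unfolding ar tendsto_at_iff_sequentially o_def by blast
  qed
  show "tendsto_L1_loc ?Q ?g (at_right 0)"
    unfolding tendsto_L1_loc_def
  proof (intro conjI g1 allI impI conv)
    have "L1_loc (?Q \<delta>)" if "\<delta> > 0" for \<delta>
      unfolding L1_loc_def using that
      by (intro allI impI set_integrable_continuous_compact quotient_continuous[OF t u w]) auto
    then show "\<forall>\<^sub>F \<delta> in at_right 0. L1_loc (?Q \<delta>)"
      by (intro eventually_at_rightI[of 0 1]) auto
  qed
qed

end

theorem theorem1:
  fixes H :: "real^'n \<Rightarrow> real^'n \<Rightarrow> real"
    and u\<^sub>0 w :: "real^'n \<Rightarrow> real"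
    and T t :: real
  assumes "T > 0"
    and "u\<^sub>0 \<in> Lip"
    and "H1 H" and "H2 H" and "H3 H" and "H4 H"
    and "w \<in> Lip"
    and "t \<in> {0<..T}"
  shows "(AE x in lebesgue. S_plus H t u\<^sub>0 differentiable (at x)) \<and>
    (\<forall>x. S_plus H t u\<^sub>0 differentiable (at x) \<longrightarrow>
       (\<exists>!z. backward_characteristic H t x (grad (S_plus H t u\<^sub>0) x) z)) \<and>
    Linf_loc (dS_plus H t u\<^sub>0 w) \<and>
    tendsto_L1_loc
      (\<lambda>\<delta> x. (S_plus H t (\<lambda>y. u\<^sub>0 y + \<delta> * w y) x - S_plus H t u\<^sub>0 x) / \<delta>)
      (dS_plus H t u\<^sub>0 w) (at_right 0)"
proof -
  obtain c0 C0 CL where "hamiltonian H (H_p H) (H_x H) c0 C0 CL"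
    using hamiltonian_exists assms(3-6) by blast
  then interpret hamiltonian H "H_p H" "H_x H" c0 C0 CL .
  have t: "t > 0" using assms by simp
  obtain K K' where "K-lipschitz_on UNIV u\<^sub>0" "K'-lipschitz_on UNIV w"
    using assms(2,7) by (auto simp: Lip_def)
  note uw = t this
  show ?thesis
    using S_plus_AE_differentiable[OF uw(1,2)] backward_characteristic_ex1[OF uw(1,2)] quotient_tendsto_L1_loc[OF uw]
    by blast
qed

end
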